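(* Let $\kappa\in\mathbb{N}_0$ and $(\mu,p)\in\mathbb{E}_{\le\kappa}$, set $q:=\mathscr{C}_\kappa[\mu,p]$, and let $f:[x_0,\infty)\to(0,\infty)$ with $x_0>0$ be measurable. Assume that the following conditions, which are equivalent to each other, hold: (i) there exists $M\subseteq\mathbb{C}^+$ with an accumulation point in $\mathbb{C}^+$ such that for all $z\in M$ the limit $\lim_{r\to\infty}\frac{q(rz)}{f(r)}$ exists and is non-zero; (ii) $f$ is regularly varying and there exists $z_0\in\mathbb{C}^+$ such that $\lim_{r\to\infty}\frac{q(rz_0)}{f(r)}$ exists and is non-zero; (iii) $f$ is regularly varying with index $\alpha\in[-2\kappa-1,2\kappa+1]$ and there exists $\omega\in\mathbb{C}\setminus\{0\}$ such that $\lim_{r\to\infty}\frac{q(rz)}{f(r)}=Q_{\alpha,\omega}(z)$ locally uniformly for $z\in\mathbb{C}^+$. Let $\alpha$ and $\omega$ be as in (iii). Then $\alpha\in[-1,2\kappa+1]$ and $Q_{\alpha,\omega}\in\operatorname{ran}\mathscr{C}_\kappa$. Let $\mu_{\alpha,\omega}$ be the measure component of $\mathscr{C}_\kappa^{-1}Q_{\alpha,\omega}$. For all $a,b\in\mathbb{R}$ with $a<b$ and $\mu_{\alpha,\omega}(\{a\})=\mu_{\alpha,\omega}(\{b\})=0$, we have $$\lim_{r\to\infty}\frac{1}{rf(r)}\mu\bigl((ra,rb)\bigr)=\mu_{\alpha,\omega}\bigl((a,b)\bigr).$$ In particular, if $\alpha>-1$, then $$\lim_{r\to\infty}\frac{1}{rf(r)}\mu\bigl((0,r)\bigr)=\frac{1}{\pi}\cdot\frac{|\omega|}{\alpha+1}\cos\Bigl(\frac{\alpha\pi}{2}-\arg\omega\Bigr),$$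 $$\lim_{r\to\infty}\frac{1}{rf(r)}\mu\bigl((-r,0)\bigr)=\frac{1}{\pi}\cdot\frac{|\omega|}{\alpha+1}\cos\Bigl(\frac{\alpha\pi}{2}+\arg\omega\Bigr);$$ if $\alpha=-1$, then $\omega>0$ and $$\lim_{r\to\infty}\frac{1}{rf(r)}\mu\bigl((-r,r)\bigr)=\omega.$$
   Context: "Measure" means positive Borel measure; $\mathbb{C}^+=\{z\in\mathbb{C}:\operatorname{Im}z>0\}$. Complex powers are taken with the branch analytic on $\mathbb{C}\setminus(-\infty,0]$ with value $1$ at $1$. For $\kappa\in\mathbb{N}_0$ let $\mathbb{E}_{\le\kappa}$ be the set of all pairs $(\mu,p)$ where $\mu$ is a measure on $\mathbb{R}$ with $\int_{\mathbb{R}}(1+t^2)^{-\kappa-1}d\mu(t)<\infty$, and $p$ is a polynomial with real coefficients of degree at most $2\kappa+1$ whose coefficient of $z^{2\kappa+1}$ satisfies $\frac{1}{(2\kappa+1)!}p^{(2\kappa+1)}(0)\ge\int_{\mathbb{R}}(1+t^2)^{-\kappa-1}d\mu(t)$. The map $\mathscr{C}_\kappa$ from $\mathbb{E}_{\le\kappa}$ to the holomorphic functions on $\mathbb{C}^+$ is $$\mathscr{C}_\kappa[\mu,p](z):=p(z)+(1+z^2)^{\kappa+1}\int_{\mathbb{R}}\frac{1}{t-z}\cdot\frac{d\mu(t)}{(1+t^2)^{\kappa+1}},\qquad z\in\mathbb{C}^+.$$ It is injective, so for $Q\in\operatorname{ran}\mathscr{C}_\kappa$ there is a unique $(\mu,p)=\mathscr{C}_\kappa^{-1}Q$,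 and $\mu$ is called its measure component. For $\alpha\in\mathbb{R}$ and $\omega\in\mathbb{C}\setminus\{0\}$ set $Q_{\alpha,\omega}(z):=i\omega\bigl(\frac{z}{i}\bigr)^\alpha$, $z\in\mathbb{C}^+$. A measurable function $f:[x_0,\infty)\to(0,\infty)$ with $x_0>0$ is regularly varying with index $\alpha\in\mathbb{R}$ if $\lim_{r\to\infty}f(\lambda r)/f(r)=\lambda^\alpha$ for all $\lambda>0$. *)

theory Defs
  imports "HOL-Analysis.Analysis" "HOL-Computational_Algebra.Polynomial"
begin

definition upper_half_plane :: "complex set" where
  "upper_half_plane = {z. Im z > 0}"

text \<open>
  The set of pairs called E with index at most kappa. The integrability condition is stated with
  the extended non-negative integral; it makes the Bochner integral in the last condition
  meaningful, and makes the measure finite on bounded sets.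
\<close>
definition E_le :: "nat \<Rightarrow> (real measure \<times> real poly) set" where
  "E_le \<kappa> = {(\<mu>, p).
     sets \<mu> = sets borel \<and>
     (\<integral>\<^sup>+ t. ennreal (1 / (1 + t\<^sup>2) ^ (\<kappa> + 1)) \<partial>\<mu>) < \<infinity> \<and>
     degree p \<le> 2 * \<kappa> + 1 \<and>
     coeff p (2 * \<kappa> + 1) \<ge> (\<integral> t. 1 / (1 + t\<^sup>2) ^ (\<kappa> + 1) \<partial>\<mu>)}"

text \<open>
  Functions on the upper half-plane are represented by total functions that are undefined
  elsewhere, so that equality of functions, and hence range and inverse of the transform, have
  their usual meaning.
\<close>
definition cauchy_transform :: "nat \<Rightarrow> real measure \<times> real poly \<Rightarrow> complex \<Rightarrow> complex" where
  "cauchy_transform \<kappa> = (\<lambda>(\<mu>, p). \<lambda>z\<in>upper_half_plane.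
     poly (map_poly complex_of_real p) z +
     (1 + z\<^sup>2) ^ (\<kappa> + 1) *
       (\<integral> t. 1 / (complex_of_real t - z) * complex_of_real (1 / (1 + t\<^sup>2) ^ (\<kappa> + 1)) \<partial>\<mu>))"

text \<open>
  The transform is injective on \<open>E_le \<kappa>\<close>, so for a function in its range the inverse
  below is the unique preimage.
\<close>
definition measure_component :: "nat \<Rightarrow> (complex \<Rightarrow> complex) \<Rightarrow> real measure" where
  "measure_component \<kappa> Q = fst (inv_into (E_le \<kappa>) (cauchy_transform \<kappa>) Q)"

definition Q_fun :: "real \<Rightarrow> complex \<Rightarrow> complex \<Rightarrow> complex" where
  "Q_fun \<alpha> \<omega> = (\<lambda>z\<in>upper_half_plane. \<i> * \<omega> * (z / \<i>) powr complex_of_real \<alpha>)"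

text \<open>
  A function from \<open>[x0, \<infinity>)\<close> to the positive reals is a total function of which only the values on
  that half-line are used. Measurability is Lebesgue measurability, as usual for regular variation.
\<close>
definition pos_measurable_from :: "real \<Rightarrow> (real \<Rightarrow> real) \<Rightarrow> bool" where
  "pos_measurable_from x0 f \<longleftrightarrow>
     x0 > 0 \<and> f \<in> borel_measurable (lebesgue_on {x0..}) \<and> (\<forall>x\<ge>x0. f x > 0)"

definition regularly_varying_index :: "real \<Rightarrow> (real \<Rightarrow> real) \<Rightarrow> real \<Rightarrow> bool" where
  "regularly_varying_index x0 f \<alpha> \<longleftrightarrow> pos_measurable_from x0 f \<and>
     (\<forall>c>0. ((\<lambda>r. f (c * r) / f r) \<longlongrightarrow> c powr \<alpha>) at_top)"

definition regularly_varying :: "real \<Rightarrow> (real \<Rightarrow> real) \<Rightarrow> bool" where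
  "regularly_varying x0 f \<longleftrightarrow> (\<exists>\<alpha>. regularly_varying_index x0 f \<alpha>)"

definition locally_uniform_limit_on ::
    "'a::topological_space set \<Rightarrow> ('i \<Rightarrow> 'a \<Rightarrow> 'b::metric_space) \<Rightarrow> ('a \<Rightarrow> 'b) \<Rightarrow> 'i filter \<Rightarrow> bool" where
  "locally_uniform_limit_on S g l F \<longleftrightarrow>
     (\<forall>z\<in>S. \<exists>U. open U \<and> z \<in> U \<and> uniform_limit (U \<inter> S) g l F)"

definition rescaled :: "(complex \<Rightarrow> complex) \<Rightarrow> (real \<Rightarrow> real) \<Rightarrow> real \<Rightarrow> complex \<Rightarrow> complex" where
  "rescaled q f r z = q (complex_of_real r * z) / complex_of_real (f r)"

definition cond_i :: "(complex \<Rightarrow> complex) \<Rightarrow> (real \<Rightarrow> real) \<Rightarrow> bool" where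
  "cond_i q f \<longleftrightarrow>
     (\<exists>M \<subseteq> upper_half_plane. (\<exists>w \<in> upper_half_plane. w islimpt M) \<and>
        (\<forall>z\<in>M. \<exists>l. l \<noteq> 0 \<and> ((\<lambda>r. rescaled q f r z) \<longlongrightarrow> l) at_top))"

definition cond_ii :: "(complex \<Rightarrow> complex) \<Rightarrow> real \<Rightarrow> (real \<Rightarrow> real) \<Rightarrow> bool" where
  "cond_ii q x0 f \<longleftrightarrow> regularly_varying x0 f \<and>
     (\<exists>z\<in>upper_half_plane. \<exists>l. l \<noteq> 0 \<and> ((\<lambda>r. rescaled q f r z) \<longlongrightarrow> l) at_top)"

text \<open>The third condition for given values of the index and the constant.\<close>
definition cond_iii ::
    "nat \<Rightarrow> (complex \<Rightarrow> complex) \<Rightarrow> real \<Rightarrow> (real \<Rightarrow> real) \<Rightarrow> real \<Rightarrow> complex \<Rightarrow> bool" where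
  "cond_iii \<kappa> q x0 f \<alpha> \<omega> \<longleftrightarrow> regularly_varying_index x0 f \<alpha> \<and>
     \<alpha> \<in> {- 2 * real \<kappa> - 1 .. 2 * real \<kappa> + 1} \<and> \<omega> \<noteq> 0 \<and>
     locally_uniform_limit_on upper_half_plane (rescaled q f) (Q_fun \<alpha> \<omega>) at_top"

end

theory Submission
  imports Defs
    "HOL-Probability.Helly_Selection"
    "HOL-Probability.Sinc_Integral"
    "HOL-Complex_Analysis.Conformal_Mappings"
begin

text \<open>
  The class of transforms is invariant under \<open>z \<mapsto> r z\<close> and under positive multiples, so the functions
  \<open>q(rz)/f(r)\<close> are again transforms of pairs with measures \<open>\<mu>(r dt)/(r f(r))\<close>. A family of pairs with
  bounded polynomial coefficients is compact (Helly), because the leading coefficient dominates the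
  mass of the regularised measure. Convergence on a set with an accumulation point forces the coefficients to
  stay bounded: otherwise the normalised pairs would have a nonzero limit representing the function 0,
  but a real polynomial of degree at most \<open>2\<kappa> + 1\<close> divisible by \<open>(1 + z\<^sup>2)\<^bsup>\<kappa>+1\<^esup>\<close> vanishes. Hence the
  rescaled functions converge on the whole half-plane; the limit is homogeneous, therefore a power, and
  its growth along the imaginary axis restricts the exponent. Uniqueness of the representation
  upgrades convergence of the functions to convergence of the regularised Cauchy transforms, and Stieltjes
  inversion turns this into convergence of the measures. Boundary values of
  the power on the real axis give the explicit constants.
\<close>

section \<open>Cauchy transforms of finite measures\<close>

text \<open>The weight 1 + t^2 singles out the points \<open>\<i>\<close> and \<open>-\<i>\<close>,
  and dilation moves them: after rescaling by r the natural weight is r^2 + t^2. The class survives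
  dilation because exchanging the weights changes the integral term only by a real polynomial whose
  top coefficient is exactly the difference of the two regularised masses. The constraint on the top
  coefficient has to be an inequality for compactness: limits of measures may lose mass at infinity,
  which preserves an inequality but destroys an equality. The measures are never followed directly
  as r grows. Every sequence of radii has a subsequence along which the pairs converge; the limit
  function is prescribed, so uniqueness prescribes its Cauchy integral, and with it the interval
  masses. Two measures representing the limit occur, one produced by compactness and one chosen as a
  preimage under the transform. The interval limit is proved for an arbitrary representing measure,
  so the first can serve for computing constants and the second for the general statement.\<close>

abbreviation cpoly :: "real poly \<Rightarrow> complex \<Rightarrow> complex" where
  "cpoly P \<equiv> poly (map_poly complex_of_real P)"

lemma cpoly_pCons [simp]: "cpoly (pCons a P) z = of_real a + z * cpoly P z"
  by (simp add: map_poly_pCons)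

lemma cpoly_add [simp]: "cpoly (P + R) z = cpoly P z + cpoly R z"
  by (induction P R rule: poly_induct2) (auto simp: algebra_simps)

lemma cpoly_smult [simp]: "cpoly (smult a P) z = of_real a * cpoly P z"
  by (induction P) (auto simp: algebra_simps)

lemma cpoly_mult [simp]: "cpoly (P * R) z = cpoly P z * cpoly R z"
  by (induction P) (auto simp: algebra_simps)

lemma cpoly_1 [simp]: "cpoly 1 z = 1"
  by (simp add: one_pCons)

lemma cpoly_power [simp]: "cpoly (P ^ k) z = cpoly P z ^ k"
  by (induction k) auto

lemma cpoly_diff [simp]: "cpoly (P - R) z = cpoly P z - cpoly R z"
  using cpoly_add[of P "smult (-1) R" z] cpoly_smult[of "-1" R z] by simp

lemma cpoly_sum [simp]: "cpoly (\<Sum>i\<in>A. P i) z = (\<Sum>i\<in>A. cpoly (P i) z)"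
  by (induction A rule: infinite_finite_induct) auto

lemma cpoly_pcompose [simp]: "cpoly (P \<circ>\<^sub>p R) z = cpoly P (cpoly R z)"
  by (induction P) (auto simp: pcompose_pCons)

lemma cpoly_of_real: "cpoly P (of_real x) = of_real (poly P x)"
  by (induction P) auto

lemma cpoly_eq_sum:
  assumes "degree P < d"
  shows "cpoly P z = (\<Sum>i<d. of_real (coeff P i) * z ^ i)"
proof -
  have "cpoly P z = (\<Sum>i\<le>degree P. of_real (coeff P i) * z ^ i)"
    by (simp add: poly_altdef degree_map_poly coeff_map_poly)
  also have "\<dots> = (\<Sum>i<d. of_real (coeff P i) * z ^ i)"
    using assms by (intro sum.mono_neutral_left) (auto simp: coeff_eq_0 not_le)
  finally show ?thesis .
qed

text \<open>A real remainder a + bz that vanishes at \<open>\<i>\<close> has a = b = 0, so a zero at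
  \<open>\<i>\<close> alone already splits off the whole factor 1 + z^2. Dividing it out leaves the
  same situation with one power less. About g only a limit at \<open>\<i>\<close> is assumed,
  because a difference of Cauchy integrals will take its place.\<close>

lemma real_poly_dvd_power:
  assumes ev: "eventually (\<lambda>z. cpoly P z = (1 + z\<^sup>2) ^ n * g z) (at \<i> within S)"
    and nt: "at \<i> within S \<noteq> bot"
    and cont: "((g \<longlongrightarrow> l) (at \<i> within S))"
  shows "[:1, 0, 1:] ^ n dvd P"
  using ev
proof (induction n arbitrary: P)
  case 0
  show ?case by simp
next
  case (Suc n)
  define D :: "real poly" where "D = [:1, 0, 1:]"
  have D: "cpoly D z = 1 + z\<^sup>2" for z
    by (simp add: D_def power2_eq_square)
  have degD: "degree D = 2" by (simp add: D_def)
  define R where "R = P mod D"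
  have "degree R < 2"
    using degree_mod_less'[of D P] degD by (cases "R = 0") (auto simp: R_def D_def)
  then obtain a b where R: "R = [:a, b:]"
    by (metis One_nat_def degree_eq_zeroE less_2_cases pCons_0_0 degree1_coeffs)
  have P: "P = P div D * D + R" by (simp add: R_def)
  \<comment> \<open>Both sides of the hypothesis have limits at \<open>\<i>\<close>, and the factor
    1 + z^2 makes the one on the right 0.\<close>
  have lim: "((\<lambda>z. (1 + z\<^sup>2) ^ Suc n * g z) \<longlongrightarrow> (1 + \<i>\<^sup>2) ^ Suc n * l) (at \<i> within S)"
    by (intro tendsto_intros cont)
  have "((\<lambda>z. cpoly P z) \<longlongrightarrow> (1 + \<i>\<^sup>2) ^ Suc n * l) (at \<i> within S)"
    by (subst filterlim_cong[OF refl refl Suc.prems]) (rule lim)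
  moreover have "((\<lambda>z. cpoly P z) \<longlongrightarrow> cpoly P \<i>) (at \<i> within S)"
    by (intro tendsto_intros)
  ultimately have "cpoly P \<i> = (1 + \<i>\<^sup>2) ^ Suc n * l"
    using nt tendsto_unique by blast
  then have "cpoly P \<i> = 0" by simp
  moreover have "cpoly P \<i> = cpoly (P div D) \<i> * cpoly D \<i> + cpoly R \<i>"
    using P by (metis cpoly_add cpoly_mult)
  ultimately have "of_real a + \<i> * of_real b = (0::complex)"
    by (simp add: D R)
  then have "a = 0" "b = 0" by (auto simp: complex_eq_iff)
  then have PD: "P = P div D * D" using P R by simp
  have "eventually (\<lambda>z. z \<noteq> \<i>) (at \<i> within S)"
    by (simp add: eventually_at_filter)
  moreover have "eventually (\<lambda>z. z \<noteq> -\<i>) (at \<i> within S)"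
    by (intro tendsto_imp_eventually_ne[OF tendsto_ident_at]) simp
  ultimately have "eventually (\<lambda>z. cpoly (P div D) z = (1 + z\<^sup>2) ^ n * g z) (at \<i> within S)"
    using Suc.prems
  proof eventually_elim
    case (elim z)
    have "1 + z\<^sup>2 = (z - \<i>) * (z + \<i>)" by (simp add: algebra_simps power2_eq_square)
    moreover have "z + \<i> \<noteq> 0" using elim(2) by (simp add: add_eq_0_iff2)
    ultimately have nz: "1 + z\<^sup>2 \<noteq> 0" using elim(1) by simp
    have "cpoly (P div D) z * (1 + z\<^sup>2) = cpoly P z"
      using PD D by (metis cpoly_mult)
    also have "\<dots> = ((1 + z\<^sup>2) ^ n * g z) * (1 + z\<^sup>2)" using elim(3) by simp
    finally show ?case using nz by (simp only: mult_cancel_right) simp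
  qed
  from Suc.IH[OF this] show ?case
    using PD by (metis D_def mult.commute mult_dvd_mono dvd_refl power_Suc)
qed

text \<open>The divisor has degree 2n, more than a non-zero P can have. This is the source of
  uniqueness of the polynomial part of a transform.\<close>

lemma real_poly_zero_of_factor:
  assumes "eventually (\<lambda>z. cpoly P z = (1 + z\<^sup>2) ^ n * g z) (at \<i>)" "(g \<longlongrightarrow> l) (at \<i>)"
    and "degree P < 2 * n"
  shows "P = 0"
proof (rule ccontr)
  assume "P \<noteq> 0"
  have "[:1, 0, 1:] ^ n dvd P"
    using real_poly_dvd_power[where S = UNIV] assms by simp
  then have "degree ([:1, 0, 1 :: real:] ^ n) \<le> degree P"
    using \<open>P \<noteq> 0\<close> by (rule dvd_imp_degree_le)
  then show False using assms(3) by (simp add: degree_power_eq)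
qed

definition cauchy_int :: "real measure \<Rightarrow> complex \<Rightarrow> complex" where
  "cauchy_int \<tau> z = (\<integral>t. 1 / (complex_of_real t - z) \<partial>\<tau>)"

text \<open>Below, \<open>n\<close> is \<open>\<kappa> + 1\<close> and \<open>\<tau>\<close> is the finite measure with density \<open>1 / (1 + t\<^sup>2) ^ n\<close> with respect
  to the measure \<open>\<mu>\<close> of the pair.\<close>

definition cauchy_sum :: "nat \<Rightarrow> real measure \<Rightarrow> real poly \<Rightarrow> complex \<Rightarrow> complex" where
  "cauchy_sum n \<tau> P z = cpoly P z + (1 + z\<^sup>2) ^ n * cauchy_int \<tau> z"

text \<open>The inequality bounds the mass by a coefficient, so bounded coefficients are all that
  compactness asks for; being non-strict, it survives limits in which mass escapes to
  infinity.\<close>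

definition admissible :: "nat \<Rightarrow> real measure \<Rightarrow> real poly \<Rightarrow> bool" where
  "admissible n \<tau> P \<longleftrightarrow> finite_borel_measure \<tau> \<and> degree P < 2 * n \<and>
     measure \<tau> UNIV \<le> coeff P (2 * n - 1)"

section \<open>Bounds and holomorphy of the Cauchy integral\<close>

lemma cauchy_kernel_nz: "Im z > 0 \<Longrightarrow> complex_of_real t - z \<noteq> 0"
  by (auto simp: complex_eq_iff)

lemma cauchy_kernel_bound:
  assumes "Im z > 0" shows "cmod (1 / (of_real t - z)) \<le> 1 / Im z"
proof -
  have "Im z \<le> cmod (of_real t - z)"
    using abs_Im_le_cmod[of "of_real t - z"] by simp
  then show ?thesis using assms by (simp add: norm_divide frac_le)
qed

context finite_borel_measure
begin

lemma borel_meas_eq: "borel_measurable M = borel_measurable borel"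
  using M_is_borel by (intro measurable_cong_sets) auto

lemma space_eq_UNIV: "space M = UNIV"
  using sets_eq_imp_space_eq[OF M_is_borel] by simp

lemma integrable_bounded:
  fixes g :: "real \<Rightarrow> 'b::{banach, second_countable_topology}"
  assumes "g \<in> borel_measurable borel" "\<And>t. norm (g t) \<le> B"
  shows "integrable M g"
  by (rule integrable_const_bound[where B = B]) (use assms borel_meas_eq in auto)

lemma norm_integral_le:
  fixes g :: "real \<Rightarrow> 'b::{banach, second_countable_topology}"
  assumes "g \<in> borel_measurable borel" "\<And>t. norm (g t) \<le> B"
  shows "norm (integral\<^sup>L M g) \<le> B * measure M UNIV"
proof -
  have "norm (integral\<^sup>L M g) \<le> (\<integral>t. norm (g t) \<partial>M)"
    by (rule integral_norm_bound)
  also have "\<dots> \<le> (\<integral>t. B \<partial>M)"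
    using assms by (intro integral_mono integrable_bounded[where B = "\<bar>B\<bar>"]) (auto intro: order_trans[OF _ abs_ge_self])
  also have "\<dots> = B * measure M UNIV" by (simp add: space_eq_UNIV mult.commute)
  finally show ?thesis .
qed

lemma integrable_cauchy: "Im z > 0 \<Longrightarrow> integrable M (\<lambda>t. 1 / (complex_of_real t - z))"
  by (rule integrable_bounded[where B = "1 / Im z"]) (use cauchy_kernel_bound in auto)

lemma cauchy_int_bound: "Im z > 0 \<Longrightarrow> cmod (cauchy_int M z) \<le> measure M UNIV / Im z"
  using norm_integral_le[of "\<lambda>t. 1 / (complex_of_real t - z)" "1 / Im z"] cauchy_kernel_bound[of z]
  by (simp add: cauchy_int_def)

lemma cauchy_int_diff_eq:
  assumes "Im z > 0" "Im w > 0"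
  shows "cauchy_int M w - cauchy_int M z =
    (w - z) * (\<integral>t. 1 / ((complex_of_real t - w) * (complex_of_real t - z)) \<partial>M)"
proof -
  have "cauchy_int M w - cauchy_int M z =
      (\<integral>t. 1 / (complex_of_real t - w) - 1 / (complex_of_real t - z) \<partial>M)"
    unfolding cauchy_int_def
    by (intro Bochner_Integration.integral_diff[symmetric] integrable_cauchy assms)
  also have "\<dots> = (\<integral>t. (w - z) * (1 / ((complex_of_real t - w) * (complex_of_real t - z))) \<partial>M)"
    using cauchy_kernel_nz[OF assms(1)] cauchy_kernel_nz[OF assms(2)]
    by (intro Bochner_Integration.integral_cong refl) (simp add: field_simps)
  finally show ?thesis by (simp only: integral_mult_right_zero)
qed

text \<open>The constant involves the measure only through its mass, so families of bounded mass are
  equicontinuous near each point. This permits evaluation points that move with the index.\<close>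

lemma cauchy_int_lipschitz:
  assumes "Im z > 0" "Im w > 0"
  shows "cmod (cauchy_int M w - cauchy_int M z) \<le> cmod (w - z) * (measure M UNIV / (Im w * Im z))"
proof -
  have "cmod (1 / ((of_real t - w) * (of_real t - z))) \<le> 1 / (Im w * Im z)" for t
    using mult_mono[OF cauchy_kernel_bound[OF assms(2), of t] cauchy_kernel_bound[OF assms(1), of t]] assms
    by (simp add: norm_mult norm_divide)
  then have "cmod (\<integral>t. 1 / ((of_real t - w) * (of_real t - z)) \<partial>M)
      \<le> 1 / (Im w * Im z) * measure M UNIV"
    by (intro norm_integral_le) auto
  then show ?thesis
    unfolding cauchy_int_diff_eq[OF assms] norm_mult by (intro mult_left_mono) auto
qed

lemma cauchy_int_has_derivative:
  assumes z: "Im z > 0"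
  shows "(cauchy_int M has_field_derivative (\<integral>t. 1 / (complex_of_real t - z)\<^sup>2 \<partial>M)) (at z)"
proof -
  let ?k = "\<lambda>w t. 1 / ((complex_of_real t - w) * (complex_of_real t - z))"
  \<comment> \<open>Above half the height of z the kernels of the difference quotient have a common
    constant bound, integrable because the measure is finite.\<close>
  have ev: "eventually (\<lambda>w. Im w > Im z / 2) (at z)"
    by (rule order_tendstoD) (use z in \<open>auto intro!: tendsto_intros\<close>)
  have k: "cmod (?k w t) \<le> 2 / Im z * (1 / Im z)" if "Im w > Im z / 2" for w t
  proof -
    have w: "Im w > 0" using that z by simp
    have "cmod (?k w t) \<le> 1 / Im w * (1 / Im z)"
      using mult_mono[OF cauchy_kernel_bound[OF w, of t] cauchy_kernel_bound[OF z, of t]] w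
      by (simp add: norm_mult norm_divide)
    also have "\<dots> \<le> 2 / Im z * (1 / Im z)"
      using that w z by (intro mult_right_mono) (simp_all add: field_simps)
    finally show ?thesis .
  qed
  have "((\<lambda>w. \<integral>t. ?k w t \<partial>M) \<longlongrightarrow> (\<integral>t. ?k z t \<partial>M)) (at z)"
  proof (rule tendsto_at_iff_sequentially[THEN iffD2], intro allI impI, unfold o_def)
    fix X :: "nat \<Rightarrow> complex" assume "\<forall>i. X i \<in> UNIV - {z}" and X: "X \<longlonglongrightarrow> z"
    have "eventually (\<lambda>i. Im (X i) > Im z / 2) sequentially"
      by (rule order_tendstoD[OF tendsto_Im[OF X]]) (use z in simp)
    then obtain N where N: "\<And>i. i \<ge> N \<Longrightarrow> Im (X i) > Im z / 2"
      by (auto simp: eventually_sequentially)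
    have "(\<lambda>i. \<integral>t. ?k (X (i + N)) t \<partial>M) \<longlonglongrightarrow> (\<integral>t. ?k z t \<partial>M)"
    proof (rule integral_dominated_convergence[where w = "\<lambda>_. 2 / Im z * (1 / Im z)"])
      show "AE t in M. (\<lambda>i. ?k (X (i + N)) t) \<longlonglongrightarrow> ?k z t"
        by (intro AE_I2 tendsto_intros LIMSEQ_ignore_initial_segment[OF X])
          (use cauchy_kernel_nz[OF z] in auto)
      show "AE t in M. cmod (?k (X (i + N)) t) \<le> 2 / Im z * (1 / Im z)" for i
        using k N by auto
    qed (auto simp: borel_meas_eq)
    then show "(\<lambda>i. \<integral>t. ?k (X i) t \<partial>M) \<longlonglongrightarrow> (\<integral>t. ?k z t \<partial>M)"
      by (rule LIMSEQ_offset)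
  qed
  moreover have "eventually (\<lambda>w. (\<integral>t. ?k w t \<partial>M) = (cauchy_int M w - cauchy_int M z) / (w - z)) (at z)"
    using ev eventually_neq_at_within[of z z UNIV]
    by eventually_elim (use z in \<open>simp add: cauchy_int_diff_eq\<close>)
  ultimately show ?thesis
    unfolding has_field_derivative_iff power2_eq_square by (simp cong: filterlim_cong)
qed

lemma cauchy_int_holomorphic: "cauchy_int M holomorphic_on upper_half_plane"
  using cauchy_int_has_derivative
  by (auto simp: holomorphic_on_def upper_half_plane_def field_differentiable_def
      intro: has_field_derivative_at_within)

lemma continuous_on_cauchy_int_line:
  assumes "y > 0"
  shows "continuous_on UNIV (\<lambda>x. cauchy_int M (Complex x y))"
proof (rule continuous_on_compose2[OF holomorphic_on_imp_continuous_on[OF cauchy_int_holomorphic]])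
  have "(\<lambda>x. Complex x y) = (\<lambda>x. of_real x + \<i> * of_real y)" by (auto simp: complex_eq_iff)
  then show "continuous_on UNIV (\<lambda>x. Complex x y)" by (auto intro!: continuous_intros)
qed (use assms in \<open>auto simp: upper_half_plane_def\<close>)

lemma cauchy_sum_holomorphic: "cauchy_sum n M P holomorphic_on upper_half_plane"
  unfolding cauchy_sum_def by (intro holomorphic_intros cauchy_int_holomorphic)

end

lemma open_upper_half_plane: "open upper_half_plane"
  unfolding upper_half_plane_def by (simp add: open_halfspace_Im_gt)

lemma convex_upper_half_plane: "convex upper_half_plane"
  unfolding upper_half_plane_def by (simp add: convex_halfspace_Im_gt)

section \<open>Change of the regularising weight\<close>

lemma scaled_weight_le:
  fixes s t :: real
  assumes "s > 0"
  shows "min 1 (s\<^sup>2) * (1 + t\<^sup>2) \<le> s\<^sup>2 + t\<^sup>2"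
proof (cases "s\<^sup>2 \<le> 1")
  case True
  then have "s\<^sup>2 * t\<^sup>2 \<le> 1 * t\<^sup>2" by (intro mult_right_mono) auto
  then show ?thesis using True by (simp add: algebra_simps)
qed (auto simp: min_def)

text \<open>Put A = (1 + u^2)/(1 + t^2) and B = (s^2 + u^2)/(s^2 + t^2). Then A - B contains the
  factor t - u, hence so does A^n - B^n; the pole of the Cauchy kernel cancels and a polynomial in u
  remains.\<close>

lemma poly_weight_dvd:
  fixes t s :: real and u :: complex
  assumes u: "Im u > 0" and s: "s > 0"
  shows "(1 + u\<^sup>2) ^ n / (1 + t\<^sup>2) ^ n / (t - u) - (s\<^sup>2 + u\<^sup>2) ^ n / (s\<^sup>2 + t\<^sup>2) ^ n / (t - u) =
    (\<Sum>i<n. (1 + u\<^sup>2) ^ i * (s\<^sup>2 + u\<^sup>2) ^ (n - Suc i) *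
       of_real ((1 - s\<^sup>2) / ((1 + t\<^sup>2) ^ Suc i * (s\<^sup>2 + t\<^sup>2) ^ (n - i))) * (u + t))"
proof -
  define a where "a = complex_of_real (1 + t\<^sup>2)"
  define b where "b = complex_of_real (s\<^sup>2 + t\<^sup>2)"
  have "1 + t\<^sup>2 > 0" "s\<^sup>2 + t\<^sup>2 > 0"
    using s by (auto intro: add_pos_nonneg)
  then have nz: "a \<noteq> 0" "b \<noteq> 0" unfolding a_def b_def by (metis of_real_eq_0_iff less_irrefl)+
  have tu: "t - u \<noteq> 0" using cauchy_kernel_nz[OF u] .
  define A where "A = (1 + u\<^sup>2) / a"
  define B where "B = (s\<^sup>2 + u\<^sup>2) / b"
  have "(1 + u\<^sup>2) * b - (s\<^sup>2 + u\<^sup>2) * a = (t - u) * ((u + t) * (1 - s\<^sup>2))"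
    unfolding a_def b_def by (simp add: algebra_simps power2_eq_square)
  then have AB: "A - B = (t - u) * ((u + t) * (1 - s\<^sup>2) / (a * b))"
    unfolding A_def B_def using nz by (simp add: field_simps)
  have "A ^ n / (t - u) - B ^ n / (t - u) = (A ^ n - B ^ n) / (t - u)"
    by (simp add: diff_divide_distrib)
  also have "\<dots> = (u + t) * (1 - s\<^sup>2) / (a * b) * (\<Sum>i<n. B ^ (n - Suc i) * A ^ i)"
    unfolding power_diff_sumr2 AB mult.assoc using tu by (rule nonzero_mult_div_cancel_left)
  also have "\<dots> = (\<Sum>i<n. (1 + u\<^sup>2) ^ i * (s\<^sup>2 + u\<^sup>2) ^ (n - Suc i) *
       ((1 - s\<^sup>2) / (a ^ Suc i * b ^ (n - i))) * (u + t))"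
    unfolding sum_distrib_left
  proof (intro sum.cong refl)
    fix i assume "i \<in> {..<n}"
    then have "b ^ (n - i) = b * b ^ (n - Suc i)" by (simp flip: power_Suc add: Suc_diff_Suc)
    then show "(u + t) * (1 - s\<^sup>2) / (a * b) * (B ^ (n - Suc i) * A ^ i) =
        (1 + u\<^sup>2) ^ i * (s\<^sup>2 + u\<^sup>2) ^ (n - Suc i) * ((1 - s\<^sup>2) / (a ^ Suc i * b ^ (n - i))) * (u + t)"
      using nz by (simp add: A_def B_def power_divide field_simps)
  qed
  finally show ?thesis
    by (simp add: A_def B_def a_def b_def power_divide)
qed

lemma integral_diff_cmult:
  fixes g h :: "'a \<Rightarrow> complex"
  assumes "integrable M g" "integrable M h"
  shows "(\<integral>t. a * g t - b * h t \<partial>M) = a * integral\<^sup>L M g - b * integral\<^sup>L M h"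
  using assms by simp

text \<open>Dilation by s replaces the weight 1 + t^2 by s^2 + t^2. Passing from one to the other
  costs only the polynomial R, and its top coefficient is the change of mass, so the inequality
  between top coefficient and mass is preserved.\<close>

lemma cauchy_weight_change:
  fixes s :: real
  assumes M: "sets M = sets borel" and int: "integrable M (\<lambda>t. 1 / (1 + t\<^sup>2) ^ n)" and s: "s > 0" and n: "n > 0"
  obtains R where "degree R < 2 * n"
    "coeff R (2 * n - 1) = (\<integral>t. 1 / (s\<^sup>2 + t\<^sup>2) ^ n \<partial>M) - (\<integral>t. 1 / (1 + t\<^sup>2) ^ n \<partial>M)"
    "integrable M (\<lambda>t. 1 / (s\<^sup>2 + t\<^sup>2) ^ n)"
    "\<And>u::complex. Im u > 0 \<Longrightarrow>
       (1 + u\<^sup>2) ^ n * (\<integral>t. 1 / (complex_of_real t - u) * complex_of_real (1 / (1 + t\<^sup>2) ^ n) \<partial>M) =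
       cpoly R u + (s\<^sup>2 + u\<^sup>2) ^ n * (\<integral>t. 1 / (complex_of_real t - u) * complex_of_real (1 / (s\<^sup>2 + t\<^sup>2) ^ n) \<partial>M)"
proof -
  have bm: "borel_measurable M = borel_measurable borel"
    using M by (intro measurable_cong_sets) auto
  have dom: "integrable M g"
    if "g \<in> borel_measurable borel" "\<And>t. norm (g t) \<le> K * (1 / (1 + t\<^sup>2) ^ n)"
    for K and g :: "real \<Rightarrow> 'b::{banach, second_countable_topology}"
  proof (rule Bochner_Integration.integrable_bound[OF integrable_mult_right[OF int, of "\<bar>K\<bar>"]])
    have "norm (g t) \<le> norm (\<bar>K\<bar> * (1 / (1 + t\<^sup>2) ^ n))" for t
    proof -
      have "K * (1 / (1 + t\<^sup>2) ^ n) \<le> \<bar>K\<bar> * (1 / (1 + t\<^sup>2) ^ n)" by (intro mult_right_mono) auto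
      with that(2)[of t] show ?thesis by simp
    qed
    then show "AE t in M. norm (g t) \<le> norm (\<bar>K\<bar> * (1 / (1 + t\<^sup>2) ^ n))" by simp
  qed (use that(1) in \<open>simp add: bm\<close>)
  have pos: "1 + t\<^sup>2 > 0" "s\<^sup>2 + t\<^sup>2 > 0" for t :: real
    using s by (auto intro: add_pos_nonneg)
  \<comment> \<open>The smaller of 1 and s^2 compares the weights: 1/(s^2 + t^2) is at most 1/m
    times 1/(1 + t^2), and likewise for powers.\<close>
  define m where "m = min 1 (s\<^sup>2)"
  have m: "m > 0" using s by (simp add: m_def)
  have w: "1 / (s\<^sup>2 + t\<^sup>2) ^ k \<le> (1 / m) ^ k * (1 / (1 + t\<^sup>2) ^ k)" for t k
  proof -
    have "(m * (1 + t\<^sup>2)) ^ k \<le> (s\<^sup>2 + t\<^sup>2) ^ k"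
      using scaled_weight_le[OF s, of t] m pos(1)[of t] by (intro power_mono) (auto simp: m_def)
    then have "1 / (s\<^sup>2 + t\<^sup>2) ^ k \<le> 1 / (m * (1 + t\<^sup>2)) ^ k"
      using m pos[of t] by (intro divide_left_mono) auto
    then show ?thesis by (simp add: power_mult_distrib power_divide)
  qed
  have int_s: "integrable M (\<lambda>t. 1 / (s\<^sup>2 + t\<^sup>2) ^ n)"
    by (rule dom[of _ "(1 / m) ^ n"]) (use w pos(2) in \<open>auto simp: abs_of_pos\<close>)
  define c where "c i t = (1 - s\<^sup>2) / ((1 + t\<^sup>2) ^ Suc i * (s\<^sup>2 + t\<^sup>2) ^ (n - i))" for i t
  have cm [measurable]: "c i \<in> borel_measurable borel" for i
    unfolding c_def by measurable
  \<comment> \<open>The denominators of \<open>c i\<close> have total order n + 1, one more than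
    integrability asks for. The spare factor 1 + t^2 pays for the extra t in
    \<open>c i t * t\<close>.\<close>
  have c_bd: "\<bar>c i t\<bar> * (1 + t\<^sup>2) \<le> \<bar>1 - s\<^sup>2\<bar> * (1 / m) ^ (n - i) * (1 / (1 + t\<^sup>2) ^ n)" if "i < n" for i t
  proof -
    have "\<bar>c i t\<bar> * (1 + t\<^sup>2) = \<bar>1 - s\<^sup>2\<bar> * (1 / (1 + t\<^sup>2) ^ i * (1 / (s\<^sup>2 + t\<^sup>2) ^ (n - i)))"
      using pos[of t] by (simp add: c_def abs_mult)
    also have "\<dots> \<le> \<bar>1 - s\<^sup>2\<bar> * (1 / (1 + t\<^sup>2) ^ i * ((1 / m) ^ (n - i) * (1 / (1 + t\<^sup>2) ^ (n - i))))"
      using pos[of t] by (intro mult_left_mono w) auto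
    also have "\<dots> = \<bar>1 - s\<^sup>2\<bar> * (1 / m) ^ (n - i) * (1 / ((1 + t\<^sup>2) ^ i * (1 + t\<^sup>2) ^ (n - i)))"
      by simp
    also have "(1 + t\<^sup>2) ^ i * (1 + t\<^sup>2) ^ (n - i) = (1 + t\<^sup>2) ^ n"
      using that by (simp flip: power_add)
    finally show ?thesis .
  qed
  have tle: "\<bar>t\<bar> \<le> 1 + t\<^sup>2" for t :: real
    using zero_le_power2[of "\<bar>t\<bar> - 1"] by (simp add: power2_diff)
  have int_c: "integrable M (c i)" if "i < n" for i
  proof (rule dom[of _ "\<bar>1 - s\<^sup>2\<bar> * (1 / m) ^ (n - i)"])
    show "norm (c i t) \<le> \<bar>1 - s\<^sup>2\<bar> * (1 / m) ^ (n - i) * (1 / (1 + t\<^sup>2) ^ n)" for t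
      using order_trans[OF mult_left_mono[of 1 "1 + t\<^sup>2" "\<bar>c i t\<bar>"] c_bd[OF that]] by simp
  qed simp
  have int_tc: "integrable M (\<lambda>t. c i t * t)" if "i < n" for i
  proof (rule dom[of _ "\<bar>1 - s\<^sup>2\<bar> * (1 / m) ^ (n - i)"])
    show "norm (c i t * t) \<le> \<bar>1 - s\<^sup>2\<bar> * (1 / m) ^ (n - i) * (1 / (1 + t\<^sup>2) ^ n)" for t
      using order_trans[OF mult_left_mono[OF tle, of "\<bar>c i t\<bar>" t] c_bd[OF that]] by (simp add: abs_mult)
  qed simp
  define \<alpha> where "\<alpha> i = (\<integral>t. c i t \<partial>M)" for i
  define \<beta> where "\<beta> i = (\<integral>t. c i t * t \<partial>M)" for i
  \<comment> \<open>\<open>S i\<close> is monic of degree 2n - 2, so its product with the linear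
    factor has \<open>\<alpha> i\<close> as coefficient of degree 2n - 1; the moments
    \<open>\<beta> i\<close> only enter below.\<close>
  define S where "S i = [:1, 0, 1:] ^ i * [:s\<^sup>2, 0, 1:] ^ (n - Suc i)" for i
  define R where "R = (\<Sum>i<n. S i * [:\<beta> i, \<alpha> i:])"
  have degS: "degree (S i) = 2 * n - 2" "coeff (S i) (2 * n - 2) = 1" if "i < n" for i
  proof -
    show d: "degree (S i) = 2 * n - 2"
      using that by (simp add: S_def degree_mult_eq degree_power_eq)
    have "lead_coeff (S i) = 1"
      by (simp add: S_def lead_coeff_mult lead_coeff_power)
    then show "coeff (S i) (2 * n - 2) = 1" by (simp add: d)
  qed
  have "degree R < 2 * n"
    unfolding R_def
  proof (rule degree_sum_less)
    fix i assume i: "i \<in> {..<n}"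
    have "degree (S i * [:\<beta> i, \<alpha> i:]) \<le> degree (S i) + degree [:\<beta> i, \<alpha> i:]" by (rule degree_mult_le)
    also have "\<dots> \<le> 2 * n - 2 + 1" using degS[of i] i by (intro add_mono) auto
    also have "\<dots> < 2 * n" using n by simp
    finally show "degree (S i * [:\<beta> i, \<alpha> i:]) < 2 * n" .
  qed (use n in simp)
  moreover have "coeff R (2 * n - 1) = (\<integral>t. 1 / (s\<^sup>2 + t\<^sup>2) ^ n \<partial>M) - (\<integral>t. 1 / (1 + t\<^sup>2) ^ n \<partial>M)"
  proof -
    have "coeff (S i * [:\<beta> i, \<alpha> i:]) (2 * n - 1) = \<alpha> i" if "i < n" for i
    proof -
      have e: "2 * n - 1 = Suc (2 * n - 2)" using n by simp
      have "coeff (S i) (Suc (2 * n - 2)) = 0" using degS[OF that] by (intro coeff_eq_0) simp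
      then show ?thesis unfolding e using degS[OF that]
        by (simp add: mult_pCons_right coeff_pCons)
    qed
    then have "coeff R (2 * n - 1) = (\<Sum>i<n. \<alpha> i)" by (simp add: R_def coeff_sum)
    also have "\<dots> = (\<integral>t. (\<Sum>i<n. c i t) \<partial>M)"
      unfolding \<alpha>_def by (rule Bochner_Integration.integral_sum[symmetric]) (use int_c in auto)
    also have "\<dots> = (\<integral>t. 1 / (s\<^sup>2 + t\<^sup>2) ^ n - 1 / (1 + t\<^sup>2) ^ n \<partial>M)"
    proof (intro Bochner_Integration.integral_cong refl)
      fix t
      \<comment> \<open>The telescoping of powers once more, now for the weights without the Cauchy
        kernel: the \<open>c i\<close> add up to the difference of the two weights.\<close>
      define a b where "a = 1 / (1 + t\<^sup>2)" and "b = 1 / (s\<^sup>2 + t\<^sup>2)"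
      have ab: "b - a = (1 - s\<^sup>2) * (a * b)"
      proof -
        have gen: "1 / y - 1 / x = (x - y) * (1 / x * (1 / y))" if "x > 0" "y > 0" for x y :: real
          using that by (simp add: field_simps)
        show ?thesis using gen[OF pos, of t t] by (simp add: a_def b_def)
      qed
      have "b ^ n - a ^ n = (1 - s\<^sup>2) * (a * b) * (\<Sum>i<n. a ^ (n - Suc i) * b ^ i)"
        unfolding power_diff_sumr2 ab ..
      also have "(\<Sum>i<n. a ^ (n - Suc i) * b ^ i) = (\<Sum>i<n. b ^ (n - Suc i) * a ^ i)"
        by (subst sum.nat_diff_reindex[symmetric]) (auto intro!: sum.cong)
      also have "(1 - s\<^sup>2) * (a * b) * (\<Sum>i<n. b ^ (n - Suc i) * a ^ i) = (\<Sum>i<n. c i t)"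
        unfolding sum_distrib_left
      proof (intro sum.cong refl)
        fix i assume "i \<in> {..<n}"
        then have e: "n - i = Suc (n - Suc i)" by (simp add: Suc_diff_Suc)
        show "(1 - s\<^sup>2) * (a * b) * (b ^ (n - Suc i) * a ^ i) = c i t"
          unfolding c_def e by (simp add: a_def b_def power_divide)
      qed
      finally show "(\<Sum>i<n. c i t) = 1 / (s\<^sup>2 + t\<^sup>2) ^ n - 1 / (1 + t\<^sup>2) ^ n"
        by (simp add: a_def b_def power_divide)
    qed
    also have "\<dots> = (\<integral>t. 1 / (s\<^sup>2 + t\<^sup>2) ^ n \<partial>M) - (\<integral>t. 1 / (1 + t\<^sup>2) ^ n \<partial>M)"
      by (intro Bochner_Integration.integral_diff int int_s)
    finally show ?thesis .
  qed
  moreover have "(1 + u\<^sup>2) ^ n * (\<integral>t. 1 / (complex_of_real t - u) * complex_of_real (1 / (1 + t\<^sup>2) ^ n) \<partial>M) =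
       cpoly R u + (s\<^sup>2 + u\<^sup>2) ^ n * (\<integral>t. 1 / (complex_of_real t - u) * complex_of_real (1 / (s\<^sup>2 + t\<^sup>2) ^ n) \<partial>M)"
    if u: "Im u > 0" for u :: complex
  proof -
    have intK: "integrable M (\<lambda>t. 1 / (complex_of_real t - u) * complex_of_real (g t))"
      if g: "integrable M g" "g \<in> borel_measurable borel" for g
    proof (rule Bochner_Integration.integrable_bound[OF integrable_mult_right[OF g(1), of "1 / Im u"]])
      show "AE t in M. norm (1 / (complex_of_real t - u) * complex_of_real (g t)) \<le> norm (1 / Im u * g t)"
      proof (rule AE_I2)
        fix t
        have "cmod (1 / (of_real t - u)) * \<bar>g t\<bar> \<le> 1 / Im u * \<bar>g t\<bar>"
          by (intro mult_right_mono cauchy_kernel_bound u) auto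
        then show "norm (1 / (complex_of_real t - u) * complex_of_real (g t)) \<le> norm (1 / Im u * g t)"
          using u by (simp add: norm_mult norm_divide abs_mult)
      qed
    qed (use g in \<open>auto simp: bm\<close>)
    have i1: "integrable M (\<lambda>t. 1 / (complex_of_real t - u) * complex_of_real (1 / (1 + t\<^sup>2) ^ n))"
      by (intro intK int) auto
    have i2: "integrable M (\<lambda>t. 1 / (complex_of_real t - u) * complex_of_real (1 / (s\<^sup>2 + t\<^sup>2) ^ n))"
      by (intro intK int_s) auto
    have "(1 + u\<^sup>2) ^ n * (\<integral>t. 1 / (complex_of_real t - u) * complex_of_real (1 / (1 + t\<^sup>2) ^ n) \<partial>M) -
      (s\<^sup>2 + u\<^sup>2) ^ n * (\<integral>t. 1 / (complex_of_real t - u) * complex_of_real (1 / (s\<^sup>2 + t\<^sup>2) ^ n) \<partial>M)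
      = (\<integral>t. (1 + u\<^sup>2) ^ n * (1 / (complex_of_real t - u) * complex_of_real (1 / (1 + t\<^sup>2) ^ n)) -
          (s\<^sup>2 + u\<^sup>2) ^ n * (1 / (complex_of_real t - u) * complex_of_real (1 / (s\<^sup>2 + t\<^sup>2) ^ n)) \<partial>M)"
      by (rule integral_diff_cmult[OF i1 i2, symmetric])
    also have "\<dots> = (\<integral>t. (\<Sum>i<n. (1 + u\<^sup>2) ^ i * (s\<^sup>2 + u\<^sup>2) ^ (n - Suc i) *
        (u * of_real (c i t) + of_real (c i t * t))) \<partial>M)"
    proof (intro Bochner_Integration.integral_cong refl)
      fix t
      show "(1 + u\<^sup>2) ^ n * (1 / (complex_of_real t - u) * complex_of_real (1 / (1 + t\<^sup>2) ^ n)) -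
          (s\<^sup>2 + u\<^sup>2) ^ n * (1 / (complex_of_real t - u) * complex_of_real (1 / (s\<^sup>2 + t\<^sup>2) ^ n)) =
          (\<Sum>i<n. (1 + u\<^sup>2) ^ i * (s\<^sup>2 + u\<^sup>2) ^ (n - Suc i) * (u * of_real (c i t) + of_real (c i t * t)))"
      proof -
        have "(\<Sum>i<n. (1 + u\<^sup>2) ^ i * (s\<^sup>2 + u\<^sup>2) ^ (n - Suc i) * (u * of_real (c i t) + of_real (c i t * t))) =
            (\<Sum>i<n. (1 + u\<^sup>2) ^ i * (s\<^sup>2 + u\<^sup>2) ^ (n - Suc i) * of_real (c i t) * (u + t))"
          by (intro sum.cong refl) (simp add: algebra_simps)
        also have "\<dots> = (1 + u\<^sup>2) ^ n / (1 + t\<^sup>2) ^ n / (t - u) - (s\<^sup>2 + u\<^sup>2) ^ n / (s\<^sup>2 + t\<^sup>2) ^ n / (t - u)"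
          unfolding c_def by (rule poly_weight_dvd[OF u s, symmetric])
        finally show ?thesis by (simp add: mult.commute)
      qed
    qed
    also have "\<dots> = (\<Sum>i<n. (1 + u\<^sup>2) ^ i * (s\<^sup>2 + u\<^sup>2) ^ (n - Suc i) * (u * of_real (\<alpha> i) + of_real (\<beta> i)))"
    proof -
      have I1: "integrable M (\<lambda>t. u * complex_of_real (c i t))" if "i < n" for i
        using int_c[OF that] by (intro integrable_mult_right integrable_of_real)
      have I2: "integrable M (\<lambda>t. complex_of_real (c i t * t))" if "i < n" for i
        using int_tc[OF that] by (intro integrable_of_real)
      have "(\<integral>t. u * complex_of_real (c i t) + complex_of_real (c i t * t) \<partial>M) = u * of_real (\<alpha> i) + of_real (\<beta> i)"
        if "i < n" for i
        using I1[OF that] I2[OF that] unfolding \<alpha>_def \<beta>_def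
        by (subst Bochner_Integration.integral_add) (auto simp del: of_real_mult)
      then show ?thesis
        using I1 I2
        by (subst Bochner_Integration.integral_sum)
          (auto simp del: of_real_mult intro!: integrable_mult_right Bochner_Integration.integrable_add sum.cong)
    qed
    also have "\<dots> = cpoly R u"
      by (auto simp: R_def S_def power2_eq_square algebra_simps intro!: sum.cong)
    finally show ?thesis by (simp add: algebra_simps)
  qed
  ultimately show thesis
    using int_s that by blast
qed

section \<open>Compactness of Cauchy transforms\<close>

text \<open>With x = arctan t the kernel 1/(t - z) becomes cos x / (sin x - z cos x), which is
  continuous up to the end points -pi/2 and pi/2 with value 0 there. Clamping x extends it to a
  bounded continuous function on the whole line, as weak convergence requires.\<close>

definition arctan_kernel :: "complex \<Rightarrow> real \<Rightarrow> complex" where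
  "arctan_kernel z x = (let y = max (-(pi/2)) (min (pi/2) x) in
     of_real (cos y) / (of_real (sin y) - z * of_real (cos y)))"

lemma arctan_kernel_denom_nz:
  assumes "Im z > 0"
  shows "complex_of_real (sin y) - z * of_real (cos y) \<noteq> 0"
proof
  assume *: "complex_of_real (sin y) - z * of_real (cos y) = 0"
  have "Im z * cos y = 0" using arg_cong[OF *, of Im] by simp
  then have "cos y = 0" using assms by simp
  moreover have "sin y = 0" using * \<open>cos y = 0\<close> by simp
  ultimately show False using sin_cos_squared_add[of y] by simp
qed

lemma isCont_arctan_kernel: "Im z > 0 \<Longrightarrow> isCont (arctan_kernel z) x"
  unfolding arctan_kernel_def Let_def
  by (intro continuous_intros) (use arctan_kernel_denom_nz in auto)

lemma arctan_kernel_bounded: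
  assumes "Im z > 0"
  obtains B where "\<And>x. cmod (arctan_kernel z x) \<le> B"
proof -
  have "compact (arctan_kernel z ` {-(pi/2)..pi/2})"
    using isCont_arctan_kernel[OF assms]
    by (intro compact_continuous_image continuous_at_imp_continuous_on) auto
  then obtain B where B: "\<And>x. x \<in> {-(pi/2)..pi/2} \<Longrightarrow> cmod (arctan_kernel z x) \<le> B"
    using compact_imp_bounded bounded_iff by (metis imageI)
  have "cmod (arctan_kernel z x) \<le> B" for x
  proof -
    define y where "y = max (-(pi/2)) (min (pi/2) x)"
    have "y \<in> {-(pi/2)..pi/2}" using pi_gt_zero unfolding y_def by (simp only: atLeastAtMost_iff) linarith
    moreover have "arctan_kernel z x = arctan_kernel z y"
      using \<open>y \<in> _\<close> by (simp add: arctan_kernel_def flip: y_def)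
    ultimately show ?thesis using B by simp
  qed
  then show thesis by (rule that)
qed

lemma arctan_kernel_arctan:
  assumes "Im z > 0"
  shows "arctan_kernel z (arctan t) = 1 / (of_real t - z)"
proof -
  have "arctan t = max (-(pi/2)) (min (pi/2) (arctan t))"
    using arctan_bounded[of t] by simp
  then have "arctan_kernel z (arctan t) = of_real (cos (arctan t)) / (of_real (sin (arctan t)) - z * of_real (cos (arctan t)))"
    by (simp only: arctan_kernel_def Let_def flip: \<open>arctan t = _\<close>)
  also have "sin (arctan t) = t * cos (arctan t)"
    by (metis cos_arctan_not_zero nonzero_eq_divide_eq tan_arctan tan_def)
  finally show ?thesis
    using cauchy_kernel_nz[OF assms, of t] by (simp add: left_diff_distrib[symmetric] del: cos_arctan)
qed

text \<open>The kernel is 0 at and beyond the end points, so atoms that a weak limit carries there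
  do not contribute to the Cauchy integral.\<close>

lemma arctan_kernel_eq:
  assumes "Im z > 0"
  shows "arctan_kernel z x = indicator {-(pi/2)<..<pi/2} x *\<^sub>R (1 / (of_real (tan x) - z))"
proof (cases "x \<in> {-(pi/2)<..<pi/2}")
  case True
  then have "arctan_kernel z (arctan (tan x)) = 1 / (of_real (tan x) - z)"
    using arctan_kernel_arctan[OF assms] by blast
  then show ?thesis using True by (simp add: arctan_tan)
next
  case False
  then have "cos (max (-(pi/2)) (min (pi/2) x)) = 0"
    by (auto simp: max_def min_def)
  then show ?thesis using False by (simp add: arctan_kernel_def)
qed

text \<open>Mapping the line to \<open>(-pi/2, pi/2)\<close> by the arc tangent makes every bounded sequence tight; the mass
  that the weak limit puts on the end points belongs to infinity and is dropped.\<close>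

lemma cauchy_int_compactness:
  fixes \<tau> :: "nat \<Rightarrow> real measure"
  assumes fin: "\<And>k. finite_borel_measure (\<tau> k)" and bd: "\<And>k. measure (\<tau> k) UNIV \<le> B"
  obtains s \<sigma> m where "strict_mono (s :: nat \<Rightarrow> nat)" "finite_borel_measure \<sigma>"
    "(\<lambda>k. measure (\<tau> (s k)) UNIV) \<longlonglongrightarrow> m" "measure \<sigma> UNIV \<le> m"
    "\<And>z. Im z > 0 \<Longrightarrow> (\<lambda>k. cauchy_int (\<tau> (s k)) z) \<longlonglongrightarrow> cauchy_int \<sigma> z"
proof -
  have "bounded (range (\<lambda>k. measure (\<tau> k) UNIV))"
    using bd by (intro boundedI[where B = B]) auto
  then obtain s1 m where s1: "strict_mono s1" and m: "((\<lambda>k. measure (\<tau> k) UNIV) \<circ> s1) \<longlonglongrightarrow> m"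
    using bounded_imp_convergent_subsequence by blast
  have m: "(\<lambda>k. measure (\<tau> (s1 k)) UNIV) \<longlonglongrightarrow> m" using m by (simp add: o_def)
  have m0: "m \<ge> 0" using m by (rule LIMSEQ_le_const) auto
  show thesis
  \<comment> \<open>Normalising to probability measures requires a positive limiting mass. If the
    mass tends to 0, so do the Cauchy integrals, and the null measure is the limit.\<close>
  proof (cases "m = 0")
    case True
    define \<sigma> where "\<sigma> = (null_measure borel :: real measure)"
    have fs: "finite_borel_measure \<sigma>"
      by (auto simp: \<sigma>_def finite_borel_measure_def finite_borel_measure_axioms_def intro!: finite_measureI)
    have "(\<lambda>k. cauchy_int (\<tau> (s1 k)) z) \<longlonglongrightarrow> cauchy_int \<sigma> z" if z: "Im z > 0" for z
    proof -
      have "(\<lambda>k. cauchy_int (\<tau> (s1 k)) z) \<longlonglongrightarrow> 0"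
      proof (rule Lim_null_comparison)
        show "eventually (\<lambda>k. cmod (cauchy_int (\<tau> (s1 k)) z) \<le> measure (\<tau> (s1 k)) UNIV / Im z) sequentially"
          using finite_borel_measure.cauchy_int_bound[OF fin z] by simp
        show "(\<lambda>k. measure (\<tau> (s1 k)) UNIV / Im z) \<longlonglongrightarrow> 0"
          using tendsto_divide[OF m tendsto_const[of "Im z"]] z True by simp
      qed
      then show ?thesis by (simp add: cauchy_int_def \<sigma>_def)
    qed
    then show thesis
      using that[OF s1 fs m] by (simp add: \<sigma>_def m0)
  next
    case False
    then have mpos: "m > 0" using m0 by simp
    then have "eventually (\<lambda>k. measure (\<tau> (s1 k)) UNIV > 0) sequentially"
      by (rule order_tendstoD(1)[OF m])
    then obtain N where N: "\<And>k. k \<ge> N \<Longrightarrow> measure (\<tau> (s1 k)) UNIV > 0"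
      by (auto simp: eventually_sequentially)
    define s2 where "s2 k = s1 (k + N)" for k
    have s2: "strict_mono s2"
      using s1 by (auto simp: strict_mono_def s2_def)
    have m2: "(\<lambda>k. measure (\<tau> (s2 k)) UNIV) \<longlonglongrightarrow> m"
      unfolding s2_def using m by (rule LIMSEQ_ignore_initial_segment)
    define c where "c k = measure (\<tau> (s2 k)) UNIV" for k
    have c: "c k > 0" for k unfolding c_def s2_def using N by simp
    define L where "L k = distr (density (\<tau> (s2 k)) (\<lambda>_. ennreal (1 / c k))) borel arctan" for k
    have meas: "borel_measurable (\<tau> (s2 k)) = borel_measurable borel" "sets (\<tau> (s2 k)) = sets borel" for k
      using finite_borel_measure.borel_meas_eq[OF fin] finite_borel_measure.M_is_borel[OF fin] by auto
    have arctan_m: "arctan \<in> borel_measurable borel"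
      by (intro borel_measurable_continuous_onI continuous_intros)
    have arctan_m': "arctan \<in> measurable (density (\<tau> (s2 k)) (\<lambda>_. ennreal (1 / c k))) borel" for k
      by (subst measurable_cong_sets[OF _ refl, of _ borel]) (use arctan_m meas(2)[of k] in auto)
    have LI: "(\<integral>x. g x \<partial>L k) = (1 / c k) *\<^sub>R (\<integral>t. g (arctan t) \<partial>\<tau> (s2 k))"
      if g: "g \<in> borel_measurable borel" for g :: "real \<Rightarrow> complex" and k
    proof -
      have "(\<lambda>t. g (arctan t)) \<in> borel_measurable (\<tau> (s2 k))"
        unfolding meas using measurable_compose[OF arctan_m g] .
      then show ?thesis
        unfolding L_def using c[of k] g arctan_m'[of k]
        by (subst integral_distr) (auto simp: integral_density)
    qed
    have Lem: "emeasure (L k) A = ennreal (1 / c k) * emeasure (\<tau> (s2 k)) (arctan -` A)"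
      if A: "A \<in> sets borel" for A k
    proof -
      have "arctan -` A \<in> sets (\<tau> (s2 k))"
        unfolding meas using measurable_sets[OF arctan_m A] by simp
      moreover have "space (\<tau> (s2 k)) = UNIV"
        using sets_eq_imp_space_eq[OF meas(2)] by simp
      ultimately show ?thesis
        unfolding L_def using A arctan_m'[of k]
        by (simp add: emeasure_distr emeasure_density nn_integral_cmult_indicator)
    qed
    have tau1: "ennreal (1 / c k) * emeasure (\<tau> (s2 k)) UNIV = 1" for k
    proof -
      interpret finite_borel_measure "\<tau> (s2 k)" by (rule fin)
      show ?thesis
        using c[of k] by (simp add: emeasure_eq_measure flip: ennreal_mult' c_def)
    qed
    have rd: "real_distribution (L k)" for k
    proof -
      have "emeasure (L k) (space (L k)) = 1"
        using Lem[of UNIV k] tau1 by (simp add: L_def)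
      then have "prob_space (L k)" by (rule prob_spaceI)
      then show ?thesis
        by (simp add: real_distribution_def real_distribution_axioms_def L_def)
    qed
    have "tight L"
      unfolding tight_def
    proof (intro conjI allI impI rd)
      fix \<epsilon> :: real assume \<epsilon>: "\<epsilon> > 0"
      \<comment> \<open>As pi/2 < 2, this single interval carries the full mass of every
        \<open>L k\<close>, which gives tightness for every epsilon at once.\<close>
      have "arctan -` {-2<..2} = UNIV"
      proof -
        have "-2 < arctan t \<and> arctan t \<le> 2" for t
          using arctan_bounded[of t] pi_less_4 by linarith
        then show ?thesis by auto
      qed
      then have "emeasure (L k) {-2<..2} = 1" for k
        using Lem[of "{-2<..2}" k] tau1 by simp
      then have "measure (L k) {-2<..2} = 1" for k by (simp add: measure_def)
      then show "\<exists>a b. a < b \<and> (\<forall>n. 1 - \<epsilon> < measure (L n) {a<..b})"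
        using \<epsilon> by (intro exI[of _ "-2"] exI[of _ 2]) simp
    qed
    then obtain r M where r: "strict_mono r" and M: "real_distribution M"
      and conv: "weak_conv_m (L \<circ> id \<circ> r) M"
      using tight_imp_convergent_subsubsequence[of L id] strict_mono_id by metis
    interpret M: real_distribution M by (rule M)
    define J where "J = {-(pi/2)<..<pi/2}"
    \<comment> \<open>Restriction to the open interval discards the mass that went to infinity,
      which is why only an inequality holds for the mass of \<open>\<sigma>\<close>. The factor m
      undoes the normalisation.\<close>
    define D where "D = density M (\<lambda>x. ennreal (m * indicator J x))"
    have tan_m: "(tan :: real \<Rightarrow> real) \<in> borel_measurable borel"
      unfolding tan_def[abs_def] by measurable
    have tan_D: "tan \<in> measurable D borel"
      using tan_m by (simp add: D_def measurable_cong_sets[OF M.events_eq_borel refl])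
    define \<sigma> where "\<sigma> = distr D borel tan"
    have Mm: "borel_measurable M = borel_measurable borel" by (rule M.borel_meas_eq)
    have "emeasure \<sigma> UNIV \<le> ennreal m"
    proof -
      have "emeasure \<sigma> UNIV = emeasure D (space D)"
        using tan_D by (simp add: \<sigma>_def emeasure_distr)
      also have "\<dots> = (\<integral>\<^sup>+x. ennreal (m * indicator J x) \<partial>M)"
        unfolding D_def by (subst emeasure_density) (auto simp: Mm J_def indicator_def intro!: nn_integral_cong)
      also have "\<dots> \<le> (\<integral>\<^sup>+x. ennreal m \<partial>M)"
        using mpos by (intro nn_integral_mono) (auto simp: indicator_def)
      also have "\<dots> = ennreal m" using M.emeasure_space_1 by simp
      finally show ?thesis .
    qed
    then have \<sigma>: "finite_borel_measure \<sigma>" "measure \<sigma> UNIV \<le> m"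
      using mpos
      by (auto simp: finite_borel_measure_def finite_borel_measure_axioms_def \<sigma>_def measure_def
          intro!: finite_measureI enn2real_leI) (auto simp: top_unique)
    have "(\<lambda>k. cauchy_int (\<tau> (s2 (r k))) z) \<longlonglongrightarrow> cauchy_int \<sigma> z" if z: "Im z > 0" for z
    proof -
      have km: "arctan_kernel z \<in> borel_measurable borel"
        using isCont_arctan_kernel[OF z] by (intro borel_measurable_continuous_onI) (auto simp: continuous_on_eq_continuous_at)
      obtain B where B: "\<And>x. cmod (arctan_kernel z x) \<le> B" using arctan_kernel_bounded[OF z] by blast
      have "(\<lambda>k. \<integral>x. arctan_kernel z x \<partial>L (r k)) \<longlonglongrightarrow> (\<integral>x. arctan_kernel z x \<partial>M)"
        using weak_conv_imp_integral_bdd_continuous_conv[of "\<lambda>k. L (r k)" M "arctan_kernel z" B]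
          rd M conv isCont_arctan_kernel[OF z] B by (simp add: o_def)
      then have "(\<lambda>k. c (r k) *\<^sub>R (\<integral>x. arctan_kernel z x \<partial>L (r k))) \<longlonglongrightarrow> m *\<^sub>R (\<integral>x. arctan_kernel z x \<partial>M)"
        using LIMSEQ_subseq_LIMSEQ[OF m2 r] by (intro tendsto_scaleR) (simp_all add: c_def o_def)
      moreover have "c (r k) *\<^sub>R (\<integral>x. arctan_kernel z x \<partial>L (r k)) = cauchy_int (\<tau> (s2 (r k))) z" for k
        using c[of "r k"] by (simp add: LI[OF km] arctan_kernel_arctan[OF z] cauchy_int_def)
      moreover have "cauchy_int \<sigma> z = m *\<^sub>R (\<integral>x. arctan_kernel z x \<partial>M)"
      proof -
        have "cauchy_int \<sigma> z = (\<integral>x. 1 / (complex_of_real (tan x) - z) \<partial>D)"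
          unfolding cauchy_int_def \<sigma>_def by (intro integral_distr tan_D) auto
        also have "\<dots> = (\<integral>x. (m * indicator J x) *\<^sub>R (1 / (complex_of_real (tan x) - z)) \<partial>M)"
          unfolding D_def
        proof (rule integral_density)
          show "(\<lambda>x. 1 / (complex_of_real (tan x) - z)) \<in> borel_measurable M"
            unfolding Mm by (rule measurable_compose[OF tan_m]) auto
        qed (use mpos in \<open>auto simp: Mm J_def\<close>)
        also have "\<dots> = (\<integral>x. m *\<^sub>R arctan_kernel z x \<partial>M)"
          unfolding arctan_kernel_eq[OF z] J_def by simp
        finally show ?thesis by simp
      qed
      ultimately show ?thesis by simp
    qed
    moreover have "strict_mono (\<lambda>k. s2 (r k))"
      using strict_mono_o[OF s2 r] by (simp add: o_def)
    moreover have "(\<lambda>k. measure (\<tau> (s2 (r k))) UNIV) \<longlonglongrightarrow> m"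
      using LIMSEQ_subseq_LIMSEQ[OF m2 r] by (simp add: o_def)
    ultimately show thesis
      using that[of "\<lambda>k. s2 (r k)" \<sigma> m] \<sigma> by blast
  qed
qed

section \<open>Limits and uniqueness of admissible pairs\<close>

lemma bounded_seqs_convergent_subseq:
  fixes a :: "nat \<Rightarrow> nat \<Rightarrow> real"
  assumes "\<And>i k. i < d \<Longrightarrow> \<bar>a i k\<bar> \<le> B"
  shows "\<exists>s. strict_mono (s :: nat \<Rightarrow> nat) \<and> (\<forall>i<d. convergent (\<lambda>k. a i (s k)))"
  using assms
proof (induction d)
  case 0
  show ?case by (intro exI[of _ id]) (auto simp: strict_mono_def)
next
  case (Suc d)
  then obtain s where s: "strict_mono (s :: nat \<Rightarrow> nat)" "\<And>i. i < d \<Longrightarrow> convergent (\<lambda>k. a i (s k))"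
    by (meson less_SucI)
  have "bounded (range (\<lambda>k. a d (s k)))"
    using Suc.prems[of d] by (intro boundedI[where B = B]) auto
  then obtain r l where r: "strict_mono r" "((\<lambda>k. a d (s k)) \<circ> r) \<longlonglongrightarrow> l"
    using bounded_imp_convergent_subsequence by blast
  have "convergent (\<lambda>k. a i (s (r k)))" if "i < Suc d" for i
  proof (cases "i = d")
    case True
    then show ?thesis using r(2) by (auto simp: convergent_def o_def)
  next
    case False
    then have "convergent (\<lambda>k. a i (s k))" using that s(2) by simp
    then show ?thesis using convergent_subseq_convergent[OF _ r(1)] by (auto simp: o_def)
  qed
  then show ?case
    using strict_mono_o[OF s(1) r(1)] by (intro exI[of _ "s \<circ> r"]) (simp add: o_def)
qed

lemma admissible_coeff_bound:
  assumes "admissible n \<tau> P" "\<And>i. \<bar>coeff P i\<bar> \<le> B"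
  shows "measure \<tau> UNIV \<le> B"
  using assms unfolding admissible_def by (meson abs_ge_self order_trans)

text \<open>The clause on moving points \<open>w\<close> records continuous convergence, the
  sequential form of locally uniform convergence.\<close>

definition cauchy_sums_tendsto ::
    "nat \<Rightarrow> (nat \<Rightarrow> real measure) \<Rightarrow> (nat \<Rightarrow> real poly) \<Rightarrow> real measure \<Rightarrow> real poly \<Rightarrow> bool" where
  "cauchy_sums_tendsto n \<tau> P \<sigma> R \<longleftrightarrow>
     (\<forall>i. (\<lambda>k. coeff (P k) i) \<longlonglongrightarrow> coeff R i) \<and>
     (\<forall>z. Im z > 0 \<longrightarrow> (\<lambda>k. cauchy_int (\<tau> k) z) \<longlonglongrightarrow> cauchy_int \<sigma> z) \<and>
     (\<forall>z w. Im z > 0 \<longrightarrow> w \<longlonglongrightarrow> z \<longrightarrow>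
        (\<lambda>k. cauchy_sum n (\<tau> k) (P k) (w k)) \<longlonglongrightarrow> cauchy_sum n \<sigma> R z)"

lemma cauchy_sums_tendstoD:
  assumes "cauchy_sums_tendsto n \<tau> P \<sigma> R"
  shows "(\<lambda>k. coeff (P k) i) \<longlonglongrightarrow> coeff R i"
    and "Im z > 0 \<Longrightarrow> (\<lambda>k. cauchy_int (\<tau> k) z) \<longlonglongrightarrow> cauchy_int \<sigma> z"
    and "Im z > 0 \<Longrightarrow> w \<longlonglongrightarrow> z \<Longrightarrow> (\<lambda>k. cauchy_sum n (\<tau> k) (P k) (w k)) \<longlonglongrightarrow> cauchy_sum n \<sigma> R z"
  using assms unfolding cauchy_sums_tendsto_def by auto

text \<open>The top coefficient dominates the mass, so a bound on the coefficients lets the measures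
  and the finitely many coefficients converge together along a subsequence.\<close>

lemma cauchy_sum_compactness:
  assumes adm: "\<And>k. admissible n (\<tau> k) (P k)" and bd: "\<And>k i. \<bar>coeff (P k) i\<bar> \<le> B"
  obtains s \<sigma> R where "strict_mono (s :: nat \<Rightarrow> nat)" "admissible n \<sigma> R"
    "cauchy_sums_tendsto n (\<lambda>k. \<tau> (s k)) (\<lambda>k. P (s k)) \<sigma> R"
proof -
  have fin: "finite_borel_measure (\<tau> k)" and deg: "degree (P k) < 2 * n"
    and lead: "measure (\<tau> k) UNIV \<le> coeff (P k) (2 * n - 1)" for k
    using adm unfolding admissible_def by auto
  have mB: "measure (\<tau> k) UNIV \<le> B" for k
    using admissible_coeff_bound[OF adm bd] .
  obtain s1 \<sigma> m where s1: "strict_mono s1" and \<sigma>: "finite_borel_measure \<sigma>"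
    and m: "(\<lambda>k. measure (\<tau> (s1 k)) UNIV) \<longlonglongrightarrow> m" "measure \<sigma> UNIV \<le> m"
    and conv: "\<And>z. Im z > 0 \<Longrightarrow> (\<lambda>k. cauchy_int (\<tau> (s1 k)) z) \<longlonglongrightarrow> cauchy_int \<sigma> z"
    using cauchy_int_compactness[of \<tau>, OF fin mB] by blast
  obtain s2 where s2: "strict_mono s2" and cc: "\<And>i. i < 2 * n \<Longrightarrow> convergent (\<lambda>k. coeff (P (s1 (s2 k))) i)"
    using bounded_seqs_convergent_subseq[of "2 * n" "\<lambda>i k. coeff (P (s1 k)) i" B] bd by auto
  define s where "s k = s1 (s2 k)" for k
  have s: "strict_mono s" using strict_mono_o[OF s1 s2] by (simp add: s_def[abs_def] o_def)
  define b where "b i = lim (\<lambda>k. coeff (P (s k)) i)" for i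
  have b: "(\<lambda>k. coeff (P (s k)) i) \<longlonglongrightarrow> b i" if "i < 2 * n" for i
    using cc[OF that] unfolding b_def s_def by (simp add: convergent_LIMSEQ_iff)
  define R where "R = (\<Sum>i<2*n. monom (b i) i)"
  have coeffR: "coeff R i = (if i < 2 * n then b i else 0)" for i
    by (simp add: R_def coeff_sum)
  have cR: "(\<lambda>k. coeff (P (s k)) i) \<longlonglongrightarrow> coeff R i" for i
  proof (cases "i < 2 * n")
    case True
    then show ?thesis using b by (simp add: coeffR)
  next
    case False
    then have "coeff (P (s k)) i = 0" for k
      using deg[of "s k"] by (intro coeff_eq_0) simp
    then show ?thesis using False by (simp add: coeffR)
  qed
  have n: "n > 0" using deg[of 0] by simp
  have degR: "degree R < 2 * n"
  proof -
    have "degree R \<le> 2 * n - 1" by (rule degree_le) (auto simp: coeffR)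
    then show ?thesis using n by simp
  qed
  have ms: "(\<lambda>k. measure (\<tau> (s k)) UNIV) \<longlonglongrightarrow> m"
    using LIMSEQ_subseq_LIMSEQ[OF m(1) s2] by (simp add: s_def o_def)
  \<comment> \<open>Here the lost mass is harmless: the mass of \<open>\<sigma>\<close> is at most
    m, and m is at most the limiting top coefficient.\<close>
  have "m \<le> coeff R (2 * n - 1)"
    by (rule LIMSEQ_le[OF ms cR]) (use lead in auto)
  then have admR: "admissible n \<sigma> R"
    unfolding admissible_def using \<sigma> m(2) degR by auto
  have conv_s: "(\<lambda>k. cauchy_int (\<tau> (s k)) z) \<longlonglongrightarrow> cauchy_int \<sigma> z" if "Im z > 0" for z
    using LIMSEQ_subseq_LIMSEQ[OF conv[OF that] s2] by (simp add: s_def o_def)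
  have lim: "(\<lambda>k. cauchy_sum n (\<tau> (s k)) (P (s k)) (w k)) \<longlonglongrightarrow> cauchy_sum n \<sigma> R z"
    if z: "Im z > 0" and w: "w \<longlonglongrightarrow> z" for w z
  proof -
    have "(\<lambda>k. cauchy_int (\<tau> (s k)) (w k) - cauchy_int (\<tau> (s k)) z) \<longlonglongrightarrow> 0"
    proof (rule Lim_null_comparison)
      have "eventually (\<lambda>k. Im (w k) > Im z / 2) sequentially"
        by (rule order_tendstoD[OF tendsto_Im[OF w]]) (use z in simp)
      then show "eventually (\<lambda>k. cmod (cauchy_int (\<tau> (s k)) (w k) - cauchy_int (\<tau> (s k)) z)
          \<le> cmod (w k - z) * (B / (Im z / 2 * Im z))) sequentially"
      proof eventually_elim
        case (elim k)
        then have wk: "Im (w k) > 0" using z by simp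
        interpret finite_borel_measure "\<tau> (s k)" by (rule fin)
        have "cmod (cauchy_int (\<tau> (s k)) (w k) - cauchy_int (\<tau> (s k)) z)
            \<le> cmod (w k - z) * (measure (\<tau> (s k)) UNIV / (Im (w k) * Im z))"
          by (rule cauchy_int_lipschitz[OF z wk])
        also have "\<dots> \<le> cmod (w k - z) * (B / (Im z / 2 * Im z))"
          using elim z wk mB[of "s k"] order_trans[OF measure_nonneg mB[of "s k"]]
          by (intro mult_left_mono frac_le) auto
        finally show ?case .
      qed
      have "(\<lambda>k. cmod (w k - z) * (B / (Im z / 2 * Im z))) \<longlonglongrightarrow> cmod (z - z) * (B / (Im z / 2 * Im z))"
        by (intro tendsto_intros w) (use z in auto)
      then show "(\<lambda>k. cmod (w k - z) * (B / (Im z / 2 * Im z))) \<longlonglongrightarrow> 0" by simp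
    qed
    from tendsto_add[OF this conv_s[OF z]]
    have c: "(\<lambda>k. cauchy_int (\<tau> (s k)) (w k)) \<longlonglongrightarrow> cauchy_int \<sigma> z" by simp
    have "(\<lambda>k. \<Sum>i<2*n. of_real (coeff (P (s k)) i) * w k ^ i) \<longlonglongrightarrow> (\<Sum>i<2*n. of_real (coeff R i) * z ^ i)"
      by (intro tendsto_intros cR w)
    then have "(\<lambda>k. cpoly (P (s k)) (w k)) \<longlonglongrightarrow> cpoly R z"
      by (simp add: cpoly_eq_sum[OF deg] cpoly_eq_sum[OF degR])
    then show ?thesis
      unfolding cauchy_sum_def by (intro tendsto_intros c w)
  qed
  have "cauchy_sums_tendsto n (\<lambda>k. \<tau> (s k)) (\<lambda>k. P (s k)) \<sigma> R"
    unfolding cauchy_sums_tendsto_def using cR conv_s lim by auto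
  then show thesis by (rule that[OF s admR])
qed

lemma cauchy_sum_eqI:
  assumes "admissible n \<tau> P" "admissible n \<sigma> R"
    and "M \<subseteq> upper_half_plane" "w \<in> upper_half_plane" "w islimpt M"
    and "\<And>z. z \<in> M \<Longrightarrow> cauchy_sum n \<tau> P z = cauchy_sum n \<sigma> R z"
    and "z \<in> upper_half_plane"
  shows "cauchy_sum n \<tau> P z = cauchy_sum n \<sigma> R z"
proof -
  interpret t: finite_borel_measure \<tau> using assms(1) by (simp add: admissible_def)
  interpret s: finite_borel_measure \<sigma> using assms(2) by (simp add: admissible_def)
  have "cauchy_sum n \<tau> P z - cauchy_sum n \<sigma> R z = 0"
    by (rule analytic_continuation[where f = "\<lambda>z. cauchy_sum n \<tau> P z - cauchy_sum n \<sigma> R z"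
          and S = upper_half_plane and U = M and \<xi> = w])
      (use assms open_upper_half_plane convex_upper_half_plane in
        \<open>auto intro!: holomorphic_intros t.cauchy_sum_holomorphic s.cauchy_sum_holomorphic convex_connected\<close>)
  then show ?thesis by simp
qed

text \<open>Equal sums exhibit P - R as (1 + z^2)^n times a difference of Cauchy integrals, which is
  continuous at \<open>\<i>\<close>; a real polynomial of degree below 2n with this property is 0.
  After that the factor can be cancelled wherever it is non-zero.\<close>

lemma cauchy_sum_unique:
  assumes "admissible n \<tau> P" "admissible n \<sigma> R"
    and eq: "\<And>z. Im z > 0 \<Longrightarrow> cauchy_sum n \<tau> P z = cauchy_sum n \<sigma> R z"
  shows "P = R" and "Im z > 0 \<Longrightarrow> cauchy_int \<tau> z = cauchy_int \<sigma> z"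
proof -
  interpret t: finite_borel_measure \<tau> using assms(1) by (simp add: admissible_def)
  interpret s: finite_borel_measure \<sigma> using assms(2) by (simp add: admissible_def)
  have c: "isCont (\<lambda>z. cauchy_int \<sigma> z - cauchy_int \<tau> z) z" if "Im z > 0" for z
    using t.cauchy_int_has_derivative[OF that] s.cauchy_int_has_derivative[OF that]
    by (intro continuous_intros) (auto dest: DERIV_isCont)
  have ev: "eventually (\<lambda>z. Im z > 0) (at \<i>)"
    by (rule order_tendstoD) (auto intro!: tendsto_intros)
  have "P - R = 0"
  proof (rule real_poly_zero_of_factor[where n = n])
    show "eventually (\<lambda>z. cpoly (P - R) z = (1 + z\<^sup>2) ^ n * (cauchy_int \<sigma> z - cauchy_int \<tau> z)) (at \<i>)"
      using ev
    proof eventually_elim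
      case (elim z)
      have "(a + b * c = d + b * e) \<Longrightarrow> a - d = b * (e - c)" for a b c d e :: complex
        by (simp add: algebra_simps)
      from this[OF eq[OF elim, unfolded cauchy_sum_def]] show ?case by simp
    qed
    show "((\<lambda>z. cauchy_int \<sigma> z - cauchy_int \<tau> z) \<longlongrightarrow> cauchy_int \<sigma> \<i> - cauchy_int \<tau> \<i>) (at \<i>)"
      using c[of \<i>] by (simp add: isCont_def)
    have "degree P \<le> 2 * n - 1" "degree R \<le> 2 * n - 1" "n > 0"
      using assms(1,2) by (auto simp: admissible_def)
    then show "degree (P - R) < 2 * n"
      using degree_diff_le[of P "2 * n - 1" R] by linarith
  qed
  then show PR: "P = R" by simp
  have ci: "cauchy_int \<tau> z = cauchy_int \<sigma> z" if "Im z > 0" "z \<noteq> \<i>" for z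
  proof -
    have "1 + z\<^sup>2 = (z - \<i>) * (z + \<i>)" by (simp add: algebra_simps power2_eq_square)
    moreover have "z + \<i> \<noteq> 0" using that(1) by (auto simp: complex_eq_iff)
    ultimately have "1 + z\<^sup>2 \<noteq> 0" using that(2) by simp
    then show ?thesis using eq[OF that(1)] PR by (simp add: cauchy_sum_def)
  qed
  show "cauchy_int \<tau> z = cauchy_int \<sigma> z" if "Im z > 0"
  proof (cases "z = \<i>")
    case True
    \<comment> \<open>At \<open>\<i>\<close> the factor 1 + z^2 vanishes and cannot be cancelled;
      the value there follows by continuity from the neighbouring points.\<close>
    have "((\<lambda>z. cauchy_int \<sigma> z - cauchy_int \<tau> z) \<longlongrightarrow> cauchy_int \<sigma> \<i> - cauchy_int \<tau> \<i>) (at \<i>)"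
      using c[of \<i>] by (simp add: isCont_def)
    moreover have "((\<lambda>z. cauchy_int \<sigma> z - cauchy_int \<tau> z) \<longlongrightarrow> 0) (at \<i>)"
    proof (rule tendsto_eventually)
      show "eventually (\<lambda>z. cauchy_int \<sigma> z - cauchy_int \<tau> z = 0) (at \<i>)"
        using ev eventually_neq_at_within[of \<i> \<i> UNIV] by eventually_elim (use ci in simp)
    qed
    ultimately have "cauchy_int \<sigma> \<i> - cauchy_int \<tau> \<i> = 0"
      using tendsto_unique at_neq_bot by blast
    then show ?thesis using True by simp
  qed (use ci that in blast)
qed

text \<open>Admissible pairs form a cone. Positive multiples are what normalising a sequence by the
  size of its coefficients uses.\<close>

lemma admissible_scale:
  assumes adm: "admissible n \<tau> P" and c: "c > 0"
  shows "admissible n (density \<tau> (\<lambda>_. ennreal c)) (smult c P)"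
    and "cauchy_sum n (density \<tau> (\<lambda>_. ennreal c)) (smult c P) z = of_real c * cauchy_sum n \<tau> P z"
proof -
  interpret finite_borel_measure \<tau> using adm by (simp add: admissible_def)
  have em: "emeasure (density \<tau> (\<lambda>_. ennreal c)) UNIV = ennreal c * emeasure \<tau> UNIV"
    using emeasure_density_const[of UNIV \<tau> "ennreal c"] by (simp add: M_is_borel)
  have "finite_measure (density \<tau> (\<lambda>_. ennreal c))"
    by (rule finite_measureI)
      (simp add: em space_eq_UNIV ennreal_mult_eq_top_iff emeasure_finite)
  then have fin: "finite_borel_measure (density \<tau> (\<lambda>_. ennreal c))"
    by (simp add: finite_borel_measure_def finite_borel_measure_axioms_def M_is_borel)
  have "measure (density \<tau> (\<lambda>_. ennreal c)) UNIV = c * measure \<tau> UNIV"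
    using c by (simp add: measure_def em enn2real_mult)
  then show "admissible n (density \<tau> (\<lambda>_. ennreal c)) (smult c P)"
    using adm c fin unfolding admissible_def by (auto intro: mult_left_mono)
  have "cauchy_int (density \<tau> (\<lambda>_. ennreal c)) z = of_real c * cauchy_int \<tau> z"
    unfolding cauchy_int_def using c
    by (subst integral_density) (auto simp: borel_meas_eq scaleR_conv_of_real simp flip: integral_mult_right_zero)
  then show "cauchy_sum n (density \<tau> (\<lambda>_. ennreal c)) (smult c P) z = of_real c * cauchy_sum n \<tau> P z"
    by (simp add: cauchy_sum_def algebra_simps)
qed

lemma admissible_0: "n > 0 \<Longrightarrow> admissible n (null_measure borel) 0"
  by (auto simp: admissible_def finite_borel_measure_def finite_borel_measure_axioms_def intro!: finite_measureI)

lemma cauchy_sum_0: "cauchy_sum n (null_measure borel) 0 z = 0"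
  by (simp add: cauchy_sum_def cauchy_int_def)

text \<open>Normalising an unbounded sequence would give, in the limit, a nonzero polynomial representing 0.\<close>

lemma coeffs_bounded_of_convergent:
  assumes adm: "\<And>k. admissible n (\<tau> k) (P k)"
    and M: "M \<subseteq> upper_half_plane" "w \<in> upper_half_plane" "w islimpt M"
    and conv: "\<And>z. z \<in> M \<Longrightarrow> convergent (\<lambda>k. cauchy_sum n (\<tau> k) (P k) z)"
  shows "\<exists>B. \<forall>k i. \<bar>coeff (P k) i\<bar> \<le> B"
proof (rule ccontr)
  \<comment> \<open>The sum norm of the coefficients. Division by it makes the norm 1, a property
    that passes to the limit since only finitely many coefficients are involved.\<close>
  define N where "N k = (\<Sum>i<2*n. \<bar>coeff (P k) i\<bar>)" for k
  have deg: "degree (P k) < 2 * n" for k using adm by (auto simp: admissible_def)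
  have n: "n > 0" using deg[of 0] by simp
  have cN: "\<bar>coeff (P k) i\<bar> \<le> N k" for k i
  proof (cases "i < 2 * n")
    case True
    then show ?thesis unfolding N_def by (intro member_le_sum) auto
  next
    case False
    then have "coeff (P k) i = 0" using deg[of k] by (intro coeff_eq_0) simp
    then show ?thesis by (simp add: N_def sum_nonneg)
  qed
  assume unb: "\<not> ?thesis"
  have "\<exists>k. N k > B" for B
  proof (rule ccontr)
    assume "\<not> ?thesis"
    then have "\<And>k. N k \<le> B" by (simp add: not_less)
    then show False using unb cN by (meson order_trans)
  qed
  then have ex: "\<exists>k>j. N k > real j" for j
  proof -
    define B where "B = Max (insert (real j) (N ` {..j}))"
    obtain k where k: "N k > B" using \<open>\<And>B. \<exists>k. N k > B\<close> by blast
    have "N i \<le> B" if "i \<le> j" for i unfolding B_def using that by (intro Max_ge) auto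
    moreover have "real j \<le> B" unfolding B_def by (intro Max_ge) auto
    ultimately have "\<not> k \<le> j" "N k > real j" using k by (auto simp: not_less dest: leD)
    then show ?thesis by (intro exI[of _ k]) auto
  qed
  then obtain t where t: "\<And>j. t j > j \<and> N (t j) > real j" by metis
  define c where "c j = 1 / N (t j)" for j
  have Npos: "N (t j) > 0" for j using t[of j] by (meson of_nat_0_le_iff order_le_less_trans)
  have c: "c j > 0" for j using Npos by (simp add: c_def)
  define \<tau>' where "\<tau>' j = density (\<tau> (t j)) (\<lambda>_. ennreal (c j))" for j
  define P' where "P' j = smult (c j) (P (t j))" for j
  have adm': "admissible n (\<tau>' j) (P' j)" for j
    unfolding \<tau>'_def P'_def by (rule admissible_scale(1)[OF adm c])
  have "\<bar>coeff (P' j) i\<bar> \<le> 1" for j i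
    using cN[of "t j" i] Npos[of j] by (simp add: P'_def c_def abs_mult divide_le_eq)
  from cauchy_sum_compactness[of n \<tau>' P', OF adm' this]
  obtain s \<sigma> R where s: "strict_mono s" and R: "admissible n \<sigma> R"
    and tend: "cauchy_sums_tendsto n (\<lambda>k. \<tau>' (s k)) (\<lambda>k. P' (s k)) \<sigma> R"
    by blast
  note cR = cauchy_sums_tendstoD(1)[OF tend] and lim = cauchy_sums_tendstoD(3)[OF tend]
  have "cauchy_sum n \<sigma> R z = 0" if z: "z \<in> M" for z
  proof -
    have "Im z > 0" using z M by (auto simp: upper_half_plane_def)
    from lim[OF this tendsto_const]
    have l: "(\<lambda>k. cauchy_sum n (\<tau>' (s k)) (P' (s k)) z) \<longlonglongrightarrow> cauchy_sum n \<sigma> R z" .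
    \<comment> \<open>Convergence enters only through boundedness: bounded values divided by norms
      that grow beyond every bound tend to 0.\<close>
    have "Bseq (\<lambda>k. cauchy_sum n (\<tau> k) (P k) z)" using conv[OF z] by (rule convergent_imp_Bseq)
    then obtain K where K: "\<And>k. cmod (cauchy_sum n (\<tau> k) (P k) z) \<le> K" by (auto simp: Bseq_def)
    have "(\<lambda>k. cauchy_sum n (\<tau>' (s k)) (P' (s k)) z) \<longlonglongrightarrow> 0"
    proof (rule Lim_null_comparison)
      have "cmod (cauchy_sum n (\<tau>' (s k)) (P' (s k)) z) \<le> K * inverse (real k)" if k: "k > 0" for k
      proof -
        have "cmod (cauchy_sum n (\<tau>' (s k)) (P' (s k)) z) = c (s k) * cmod (cauchy_sum n (\<tau> (t (s k))) (P (t (s k))) z)"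
          unfolding \<tau>'_def P'_def admissible_scale(2)[OF adm c] using c[of "s k"] by (simp add: norm_mult)
        also have "\<dots> \<le> inverse (real k) * K"
        proof (intro mult_mono K)
          have "real k \<le> N (t (s k))"
            using t[of "s k"] seq_suble[OF s, of k] by (meson of_nat_le_iff less_imp_le order_trans)
          then show "c (s k) \<le> inverse (real k)" using k by (simp add: c_def field_simps)
        qed auto
        finally show ?thesis by (simp add: mult.commute)
      qed
      then show "eventually (\<lambda>k. cmod (cauchy_sum n (\<tau>' (s k)) (P' (s k)) z) \<le> K * inverse (real k)) sequentially"
        using eventually_gt_at_top by (rule eventually_mono[rotated])
      show "(\<lambda>k. K * inverse (real k)) \<longlonglongrightarrow> 0"
        using tendsto_mult[OF tendsto_const[of K] lim_inverse_n] by simp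
    qed
    with l show ?thesis using LIMSEQ_unique by blast
  qed
  have "cauchy_sum n \<sigma> R z = cauchy_sum n (null_measure borel) 0 z" if "Im z > 0" for z
    by (rule cauchy_sum_eqI[OF R admissible_0[OF n] M])
      (use that cauchy_sum_0 \<open>\<And>z. z \<in> M \<Longrightarrow> cauchy_sum n \<sigma> R z = 0\<close> in \<open>auto simp: upper_half_plane_def\<close>)
  then have "R = 0" using cauchy_sum_unique(1)[OF R admissible_0[OF n]] by blast
  have "(\<lambda>k. \<Sum>i<2*n. \<bar>coeff (P' (s k)) i\<bar>) \<longlonglongrightarrow> (\<Sum>i<2*n. \<bar>coeff R i\<bar>)"
    by (intro tendsto_intros cR)
  moreover have "(\<Sum>i<2*n. \<bar>coeff (P' (s k)) i\<bar>) = 1" for k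
  proof -
    have "(\<Sum>i<2*n. \<bar>coeff (P' (s k)) i\<bar>) = c (s k) * N (t (s k))"
      unfolding N_def P'_def sum_distrib_left using c[of "s k"] by (intro sum.cong) (auto simp: abs_mult)
    then show ?thesis using Npos[of "s k"] by (simp add: c_def)
  qed
  ultimately have "(\<Sum>i<2*n. \<bar>coeff R i\<bar>) = 1" by (simp add: LIMSEQ_const_iff)
  then show False using \<open>R = 0\<close> by simp
qed

section \<open>Rescaling\<close>

text \<open>The link between pairs of the class and finite measures: the regularised image of
  \<open>\<mu>\<close> under t -> t/r represents c times the transform at rz, and multiplying the
  weight back recovers \<open>\<mu>\<close> on dilated sets. The case r = c = 1 is the plain
  regularisation.\<close>

lemma E_le_rescale:
  assumes E: "(\<mu>, p) \<in> E_le \<kappa>" and r: "r > 0" and c: "c > 0"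
  shows "\<exists>\<tau> P. admissible (\<kappa> + 1) \<tau> P \<and>
    (\<forall>z. Im z > 0 \<longrightarrow> cauchy_sum (\<kappa> + 1) \<tau> P z = of_real c * cauchy_transform \<kappa> (\<mu>, p) (of_real r * z)) \<and>
    (\<forall>A\<in>sets borel. (\<integral>t. indicator A t * (1 + t\<^sup>2) ^ (\<kappa> + 1) \<partial>\<tau>) = c / r * measure \<mu> ((\<lambda>t. t / r) -` A))"
proof -
  define n where "n = \<kappa> + 1"
  have n: "n > 0" and n2: "2 * \<kappa> + 1 = 2 * n - 1" by (auto simp: n_def)
  have M: "sets \<mu> = sets borel"
    and nn: "(\<integral>\<^sup>+ t. ennreal (1 / (1 + t\<^sup>2) ^ n) \<partial>\<mu>) < \<infinity>"
    and degp: "degree p < 2 * n"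
    and cp: "coeff p (2 * n - 1) \<ge> (\<integral> t. 1 / (1 + t\<^sup>2) ^ n \<partial>\<mu>)"
    using E unfolding E_le_def n2 by (auto simp: n_def)
  have bm: "borel_measurable \<mu> = borel_measurable borel"
    using M by (intro measurable_cong_sets) auto
  have sp: "space \<mu> = UNIV" using sets_eq_imp_space_eq[OF M] by simp
  have int: "integrable \<mu> (\<lambda>t. 1 / (1 + t\<^sup>2) ^ n)"
    using nn by (intro integrableI_bounded) (auto simp: bm)
  obtain R where degR: "degree R < 2 * n"
    and cR: "coeff R (2 * n - 1) = (\<integral>t. 1 / (r\<^sup>2 + t\<^sup>2) ^ n \<partial>\<mu>) - (\<integral>t. 1 / (1 + t\<^sup>2) ^ n \<partial>\<mu>)"
    and int_r: "integrable \<mu> (\<lambda>t. 1 / (r\<^sup>2 + t\<^sup>2) ^ n)"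
    and R: "\<And>u::complex. Im u > 0 \<Longrightarrow>
       (1 + u\<^sup>2) ^ n * (\<integral>t. 1 / (complex_of_real t - u) * complex_of_real (1 / (1 + t\<^sup>2) ^ n) \<partial>\<mu>) =
       cpoly R u + (r\<^sup>2 + u\<^sup>2) ^ n * (\<integral>t. 1 / (complex_of_real t - u) * complex_of_real (1 / (r\<^sup>2 + t\<^sup>2) ^ n) \<partial>\<mu>)"
    using cauchy_weight_change[OF M int r n] by blast
  \<comment> \<open>The image point is t/r, so the weight has to be taken there. The factor 1/r
    compensates for 1/(t/r - z) = r/(t - rz).\<close>
  define w where "w t = c / r * (1 / (1 + (t / r)\<^sup>2) ^ n)" for t :: real
  have pos: "0 < 1 + t\<^sup>2" "0 < r\<^sup>2 + t\<^sup>2" for t :: real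
    using r by (auto intro: add_pos_nonneg)
  have w_eq: "w t = c * r ^ (2 * n - 1) * (1 / (r\<^sup>2 + t\<^sup>2) ^ n)" for t
  proof -
    have "1 + (t / r)\<^sup>2 = (r\<^sup>2 + t\<^sup>2) / r\<^sup>2" using r by (simp add: field_simps)
    then have "w t = c / r * (r ^ (2 * n) / (r\<^sup>2 + t\<^sup>2) ^ n)"
      by (simp add: w_def power_divide power_mult)
    moreover have "r ^ (2 * n) = r * r ^ (2 * n - 1)" using n by (simp flip: power_Suc)
    ultimately show ?thesis using r by simp
  qed
  have w0: "w t \<ge> 0" for t using c r pos[of t] by (simp add: w_eq)
  have wm [measurable]: "w \<in> borel_measurable borel" unfolding w_def by measurable
  have int_w: "integrable \<mu> w"
    unfolding w_eq[abs_def] by (intro integrable_mult_right int_r)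
  define \<tau> where "\<tau> = distr (density \<mu> (\<lambda>t. ennreal (w t))) borel (\<lambda>t. t / r)"
  have sm: "(\<lambda>t. t / r) \<in> measurable (density \<mu> (\<lambda>t. ennreal (w t))) borel"
    by (simp add: bm)
  have LI: "(\<integral>t. g t \<partial>\<tau>) = (\<integral>t. w t *\<^sub>R g (t / r) \<partial>\<mu>)"
    if [measurable]: "g \<in> borel_measurable borel" for g :: "real \<Rightarrow> 'b::{banach, second_countable_topology}"
    unfolding \<tau>_def using w0 sm
    by (subst integral_distr) (auto simp: bm intro!: integral_density)
  have fin: "finite_borel_measure \<tau>"
  proof -
    have "emeasure \<tau> UNIV = (\<integral>\<^sup>+ t. ennreal (w t) \<partial>\<mu>)"
      unfolding \<tau>_def using sm M sp by (simp add: emeasure_distr emeasure_density space_density bm)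
    also have "\<dots> < \<infinity>"
      using integrableD(2)[OF int_w] w0 by (simp add: less_top)
    finally have "emeasure \<tau> UNIV \<noteq> \<infinity>" by simp
    then have "finite_measure \<tau>" by (intro finite_measureI) (simp add: \<tau>_def)
    then show ?thesis by (simp add: finite_borel_measure_def finite_borel_measure_axioms_def \<tau>_def)
  qed
  interpret \<tau>: finite_borel_measure \<tau> by (rule fin)
  have mass: "measure \<tau> UNIV = c * r ^ (2 * n - 1) * (\<integral>t. 1 / (r\<^sup>2 + t\<^sup>2) ^ n \<partial>\<mu>)"
  proof -
    have "measure \<tau> UNIV = (\<integral>t. 1 \<partial>\<tau>)" by (simp add: \<tau>.space_eq_UNIV)
    also have "\<dots> = (\<integral>t. w t \<partial>\<mu>)" by (subst LI) auto
    also have "\<dots> = c * r ^ (2 * n - 1) * (\<integral>t. 1 / (r\<^sup>2 + t\<^sup>2) ^ n \<partial>\<mu>)"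
      unfolding w_eq by (rule integral_mult_right_zero)
    finally show ?thesis .
  qed
  \<comment> \<open>Composition with rz multiplies the top coefficient by r^(2n-1), the same power
    that \<open>w_eq\<close> puts into the mass, so the inequality is inherited from the
    pair.\<close>
  define P where "P = smult c ((p + R) \<circ>\<^sub>p [:0, r:])"
  have "admissible n \<tau> P"
    unfolding admissible_def
  proof (intro conjI fin)
    show "degree P < 2 * n"
      using c r degp degR by (simp add: P_def degree_pcompose degree_add_less)
    have "coeff P (2 * n - 1) = c * r ^ (2 * n - 1) * (coeff p (2 * n - 1) + coeff R (2 * n - 1))"
      by (simp add: P_def coeff_pcompose_linear)
    also have "\<dots> \<ge> c * r ^ (2 * n - 1) * (\<integral>t. 1 / (r\<^sup>2 + t\<^sup>2) ^ n \<partial>\<mu>)"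
      using cp c r by (intro mult_left_mono) (simp_all only: cR, auto)
    finally show "measure \<tau> UNIV \<le> coeff P (2 * n - 1)" by (simp add: mass)
  qed
  moreover have "cauchy_sum n \<tau> P z = of_real c * cauchy_transform \<kappa> (\<mu>, p) (of_real r * z)"
    if z: "Im z > 0" for z
  proof -
    define u where "u = complex_of_real r * z"
    have u: "Im u > 0" using r z by (simp add: u_def)
    define I where "I = (\<integral>t. 1 / (complex_of_real t - u) * complex_of_real (1 / (r\<^sup>2 + t\<^sup>2) ^ n) \<partial>\<mu>)"
    have "cauchy_transform \<kappa> (\<mu>, p) u = cpoly p u + (1 + u\<^sup>2) ^ n *
        (\<integral> t. 1 / (complex_of_real t - u) * complex_of_real (1 / (1 + t\<^sup>2) ^ n) \<partial>\<mu>)"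
      using u by (simp add: cauchy_transform_def n_def upper_half_plane_def)
    also have "\<dots> = cpoly p u + cpoly R u + (r\<^sup>2 + u\<^sup>2) ^ n * I"
      unfolding R[OF u] I_def by (simp add: add.assoc)
    finally have 1: "cauchy_transform \<kappa> (\<mu>, p) u = cpoly (p + R) u + (r\<^sup>2 + u\<^sup>2) ^ n * I" by simp
    have "cauchy_int \<tau> z = (\<integral>t. w t *\<^sub>R (1 / (complex_of_real (t / r) - z)) \<partial>\<mu>)"
      unfolding cauchy_int_def by (rule LI) auto
    also have "\<dots> = (\<integral>t. of_real (c * r ^ (2 * n)) *
        (1 / (complex_of_real t - u) * complex_of_real (1 / (r\<^sup>2 + t\<^sup>2) ^ n)) \<partial>\<mu>)"
    proof (intro Bochner_Integration.integral_cong refl)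
      fix t
      have "complex_of_real (t / r) - z = (of_real t - u) / of_real r"
        using r by (simp add: u_def field_simps)
      moreover have "r ^ (2 * n) = r * r ^ (2 * n - 1)" using n by (simp flip: power_Suc)
      ultimately show "w t *\<^sub>R (1 / (complex_of_real (t / r) - z)) = of_real (c * r ^ (2 * n)) *
        (1 / (complex_of_real t - u) * complex_of_real (1 / (r\<^sup>2 + t\<^sup>2) ^ n))"
        by (simp add: w_eq scaleR_conv_of_real mult_ac)
    qed
    also have "\<dots> = of_real (c * r ^ (2 * n)) * I"
      unfolding I_def by (rule integral_mult_right_zero)
    finally have 2: "cauchy_int \<tau> z = of_real (c * r ^ (2 * n)) * I" .
    have 3: "of_real (r ^ (2 * n)) * (1 + z\<^sup>2) ^ n = (r\<^sup>2 + u\<^sup>2) ^ n"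
    proof -
      have "of_real (r\<^sup>2) * (1 + z\<^sup>2) = r\<^sup>2 + u\<^sup>2" by (simp add: u_def power2_eq_square algebra_simps)
      then show ?thesis by (metis of_real_power power_mult power_mult_distrib)
    qed
    have "cauchy_sum n \<tau> P z = of_real c * cpoly (p + R) u + (1 + z\<^sup>2) ^ n * (of_real (c * r ^ (2 * n)) * I)"
      unfolding cauchy_sum_def 2 by (simp add: P_def u_def mult.commute)
    also have "\<dots> = of_real c * (cpoly (p + R) u + (of_real (r ^ (2 * n)) * (1 + z\<^sup>2) ^ n) * I)"
      by (simp add: algebra_simps)
    finally show ?thesis unfolding 3 u_def[symmetric] 1 .
  qed
  moreover have "(\<integral>t. indicator A t * (1 + t\<^sup>2) ^ n \<partial>\<tau>) = c / r * measure \<mu> ((\<lambda>t. t / r) -` A)"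
    if A [measurable]: "A \<in> sets borel" for A
  proof -
    have "(\<integral>t. indicator A t * (1 + t\<^sup>2) ^ n \<partial>\<tau>) = (\<integral>t. w t *\<^sub>R (indicator A (t / r) * (1 + (t / r)\<^sup>2) ^ n) \<partial>\<mu>)"
      by (rule LI) measurable
    also have "\<dots> = (\<integral>t. c / r * indicator ((\<lambda>t. t / r) -` A) t \<partial>\<mu>)"
      using pos by (intro Bochner_Integration.integral_cong refl) (simp add: w_def indicator_def less_imp_neq[symmetric])
    also have "\<dots> = c / r * measure \<mu> ((\<lambda>t. t / r) -` A)"
      by (simp add: sp)
    finally show ?thesis .
  qed
  ultimately show ?thesis unfolding n_def by blast
qed

section \<open>Limits of rescaled functions\<close>

lemma tendsto_of_subseq:
  fixes X :: "nat \<Rightarrow> 'a::metric_space"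
  assumes "\<And>s. strict_mono s \<Longrightarrow> \<exists>r. strict_mono (r :: nat \<Rightarrow> nat) \<and> (\<lambda>k. X (s (r k))) \<longlonglongrightarrow> L"
  shows "X \<longlonglongrightarrow> L"
proof (rule ccontr)
  assume "\<not> X \<longlonglongrightarrow> L"
  then obtain e where e: "e > 0" "\<And>N. \<exists>k\<ge>N. dist (X k) L \<ge> e"
    unfolding lim_sequentially by (meson not_less)
  then have "infinite {k. dist (X k) L \<ge> e}"
    unfolding infinite_nat_iff_unbounded_le by auto
  from infinite_enumerate[OF this] obtain s :: "nat \<Rightarrow> nat" where s: "strict_mono s" "\<forall>k. s k \<in> {k. dist (X k) L \<ge> e}"
    by blast
  obtain r where "(\<lambda>k. X (s (r k))) \<longlonglongrightarrow> L" using assms[OF s(1)] by blast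
  then have "eventually (\<lambda>k. dist (X (s (r k))) L < e) sequentially"
    by (rule tendstoD) (rule e)
  then obtain k where "dist (X (s (r k))) L < e" by (auto simp: eventually_sequentially)
  with s(2) show False by (simp add: not_le[symmetric])
qed

section \<open>The family q(rz)/f(r) and its limit\<close>

locale rescaled_family =
  fixes n :: nat and T :: "real \<Rightarrow> real measure" and P :: "real \<Rightarrow> real poly"
    and q :: "complex \<Rightarrow> complex" and f :: "real \<Rightarrow> real" and x0 :: real
  assumes x0: "x0 > 0" and f_pos: "r \<ge> x0 \<Longrightarrow> f r > 0"
    and adm: "r \<ge> x0 \<Longrightarrow> admissible n (T r) (P r)"
    and repr: "r \<ge> x0 \<Longrightarrow> Im z > 0 \<Longrightarrow> cauchy_sum n (T r) (P r) z = rescaled q f r z"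

text \<open>Condition (i) in the form of a locale. The other two conditions are reduced to it, so
  all the analysis starts from here.\<close>

locale converging_family = rescaled_family +
  fixes M :: "complex set" and w :: complex
  assumes M: "M \<subseteq> upper_half_plane" "w \<in> upper_half_plane" "w islimpt M"
    and lim_M: "z \<in> M \<Longrightarrow> \<exists>l. l \<noteq> 0 \<and> ((\<lambda>r. rescaled q f r z) \<longlongrightarrow> l) at_top"
begin

lemma lim_M_seq:
  assumes "z \<in> M" "filterlim X at_top sequentially"
  shows "(\<lambda>k. rescaled q f (X k) z) \<longlonglongrightarrow> Lim at_top (\<lambda>r. rescaled q f r z)"
proof -
  obtain l where l: "((\<lambda>r. rescaled q f r z) \<longlongrightarrow> l) at_top" using lim_M[OF assms(1)] by blast
  then have "Lim at_top (\<lambda>r. rescaled q f r z) = l" by (intro tendsto_Lim) auto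
  with filterlim_compose[OF l assms(2)] show ?thesis by simp
qed

lemma Im_M: "z \<in> M \<Longrightarrow> Im z > 0"
  using M(1) by (auto simp: upper_half_plane_def)

text \<open>If no bound held for large r, one could pick radii tending to infinity with unbounded
  coefficients, and the normalisation argument for sequences would be contradicted along
  them.\<close>

lemma eventually_coeffs_bounded:
  "\<exists>B r0. r0 \<ge> x0 \<and> (\<forall>r\<ge>r0. \<forall>i. \<bar>coeff (P r) i\<bar> \<le> B)"
proof (rule ccontr)
  assume neg: "\<not> ?thesis"
  have "\<exists>r\<ge>max x0 (real k). \<exists>i. \<bar>coeff (P r) i\<bar> > real k" for k
    using neg by (meson max.cobounded1 not_le)
  then obtain X where X: "\<And>k. X k \<ge> max x0 (real k)" "\<And>k. \<exists>i. \<bar>coeff (P (X k)) i\<bar> > real k"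
    by metis
  have "filterlim X at_top sequentially"
    by (rule filterlim_at_top_mono[OF filterlim_real_sequentially])
      (use X(1) in \<open>auto intro!: always_eventually\<close>)
  note seq = lim_M_seq[OF _ this]
  have "\<exists>B. \<forall>k i. \<bar>coeff (P (X k)) i\<bar> \<le> B"
  proof (rule coeffs_bounded_of_convergent[OF _ M])
    show "admissible n (T (X k)) (P (X k))" for k using adm X(1) by simp
    show "convergent (\<lambda>k. cauchy_sum n (T (X k)) (P (X k)) z)" if "z \<in> M" for z
      using seq[OF that] X(1) Im_M[OF that] by (simp add: repr convergent_def) blast
  qed
  then obtain B where B: "\<And>k i. \<bar>coeff (P (X k)) i\<bar> \<le> B" by blast
  obtain k where "real k > B" using reals_Archimedean2 by blast
  then show False using X(2)[of k] B[of k] by (meson less_le_trans not_less order_less_imp_le)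
qed

text \<open>Subsequential limits exist by compactness, and all of them agree on M because the limits
  there are prescribed. The identity theorem makes them agree on the half-plane, so the whole family
  converges. Arbitrary sequences of radii and moving points prepare the locally uniform
  statement.\<close>

lemma ex_limit:
  "\<exists>\<sigma> R. admissible n \<sigma> R \<and> (\<forall>X w z. filterlim X at_top sequentially \<longrightarrow> w \<longlonglongrightarrow> z \<longrightarrow> Im z > 0 \<longrightarrow>
     (\<lambda>k. rescaled q f (X k) (w k)) \<longlonglongrightarrow> cauchy_sum n \<sigma> R z)"
proof -
  obtain B r0 where r0: "r0 \<ge> x0" and B: "\<And>r i. r \<ge> r0 \<Longrightarrow> \<bar>coeff (P r) i\<bar> \<le> B"
    using eventually_coeffs_bounded by blast
  have sub: "\<exists>s \<sigma> R. strict_mono (s :: nat \<Rightarrow> nat) \<and> admissible n \<sigma> R \<and>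
      (\<forall>z\<in>M. cauchy_sum n \<sigma> R z = Lim at_top (\<lambda>r. rescaled q f r z)) \<and>
      cauchy_sums_tendsto n (\<lambda>k. T (X (s k))) (\<lambda>k. P (X (s k))) \<sigma> R"
    if X: "filterlim X at_top sequentially" "\<And>k. X k \<ge> r0" for X
  proof -
    have "admissible n (T (X k)) (P (X k))" for k using adm X(2)[of k] r0 by simp
    moreover have "\<bar>coeff (P (X k)) i\<bar> \<le> B" for k i using B X(2) by blast
    ultimately obtain s \<sigma> R where s: "strict_mono (s :: nat \<Rightarrow> nat)" "admissible n \<sigma> R"
      "cauchy_sums_tendsto n (\<lambda>k. T (X (s k))) (\<lambda>k. P (X (s k))) \<sigma> R"
      using cauchy_sum_compactness[of n "\<lambda>k. T (X k)" "\<lambda>k. P (X k)" B] by blast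
    have "cauchy_sum n \<sigma> R z = Lim at_top (\<lambda>r. rescaled q f r z)" if z: "z \<in> M" for z
    proof -
      have "X (s k) \<ge> x0" for k using X(2)[of "s k"] r0 by simp
      then have "(\<lambda>k. rescaled q f (X (s k)) z) \<longlonglongrightarrow> cauchy_sum n \<sigma> R z"
        using cauchy_sums_tendstoD(3)[OF s(3) Im_M[OF z] tendsto_const] Im_M[OF z] by (simp add: repr)
      moreover have "(\<lambda>k. rescaled q f (X (s k)) z) \<longlonglongrightarrow> Lim at_top (\<lambda>r. rescaled q f r z)"
        by (intro lim_M_seq z filterlim_compose[OF X(1)] filterlim_subseq s)
      ultimately show ?thesis by (rule LIMSEQ_unique)
    qed
    with s show ?thesis by blast
  qed
  have "filterlim (\<lambda>k. r0 + real k) at_top sequentially"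
    by (intro filterlim_tendsto_add_at_top[OF tendsto_const] filterlim_real_sequentially)
  from sub[OF this] obtain \<sigma> R where \<sigma>: "admissible n \<sigma> R"
    and \<sigma>M: "\<And>z. z \<in> M \<Longrightarrow> cauchy_sum n \<sigma> R z = Lim at_top (\<lambda>r. rescaled q f r z)"
    by auto
  have "(\<lambda>k. rescaled q f (X k) (v k)) \<longlonglongrightarrow> cauchy_sum n \<sigma> R z"
    if X: "filterlim X at_top sequentially" and v: "v \<longlonglongrightarrow> z" and z: "Im z > 0" for X v z
  proof -
    have "eventually (\<lambda>k. X k \<ge> r0) sequentially" using X by (simp add: filterlim_at_top)
    moreover have "eventually (\<lambda>k. Im (v k) > 0) sequentially"
      by (rule order_tendstoD(1)[OF tendsto_Im[OF v] z])
    ultimately have "eventually (\<lambda>k. X k \<ge> r0 \<and> Im (v k) > 0) sequentially"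
      by (rule eventually_conj)
    then obtain N where N: "\<And>k. k \<ge> N \<Longrightarrow> X k \<ge> r0 \<and> Im (v k) > 0"
      by (auto simp: eventually_sequentially)
    have "(\<lambda>k. rescaled q f (X (k + N)) (v (k + N))) \<longlonglongrightarrow> cauchy_sum n \<sigma> R z"
    proof (rule tendsto_of_subseq)
      fix s :: "nat \<Rightarrow> nat" assume s: "strict_mono s"
      have sN: "filterlim (\<lambda>k. s k + N) at_top sequentially"
        by (rule filterlim_subseq) (use s in \<open>auto simp: strict_mono_def\<close>)
      have "filterlim (\<lambda>k. X (s k + N)) at_top sequentially"
        by (rule filterlim_compose[OF X sN])
      moreover have "X (s k + N) \<ge> r0" for k using N by simp
      ultimately obtain t \<sigma>' R' where t: "strict_mono (t :: nat \<Rightarrow> nat)" "admissible n \<sigma>' R'"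
        and \<sigma>'M: "\<forall>z\<in>M. cauchy_sum n \<sigma>' R' z = Lim at_top (\<lambda>r. rescaled q f r z)"
        and tend: "cauchy_sums_tendsto n (\<lambda>k. T (X (s (t k) + N))) (\<lambda>k. P (X (s (t k) + N))) \<sigma>' R'"
        by (rule sub[THEN exE]) (elim exE conjE, rule that)
      have eq: "cauchy_sum n \<sigma>' R' z = cauchy_sum n \<sigma> R z"
        by (rule cauchy_sum_eqI[OF t(2) \<sigma> M]) (use \<sigma>M \<sigma>'M z in \<open>auto simp: upper_half_plane_def\<close>)
      have "filterlim (\<lambda>k. s (t k) + N) at_top sequentially"
        by (rule filterlim_compose[OF sN filterlim_subseq[OF t(1)]])
      then have "(\<lambda>k. v (s (t k) + N)) \<longlonglongrightarrow> z" by (rule filterlim_compose[OF v])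
      from cauchy_sums_tendstoD(3)[OF tend z this]
      have "(\<lambda>k. rescaled q f (X (s (t k) + N)) (v (s (t k) + N))) \<longlonglongrightarrow> cauchy_sum n \<sigma>' R' z"
        using N r0 by (subst (asm) repr) (auto intro: order_trans)
      then show "\<exists>r. strict_mono r \<and> (\<lambda>k. rescaled q f (X (s (r k) + N)) (v (s (r k) + N))) \<longlonglongrightarrow> cauchy_sum n \<sigma> R z"
        using t(1) eq by auto
    qed
    then show ?thesis by (rule LIMSEQ_offset)
  qed
  with \<sigma> show ?thesis by blast
qed

end

text \<open>If uniformity failed on a small ball, points of failure would accumulate in the closed
  ball, against convergence along moving points and continuity of the limit.\<close>

lemma locally_uniform_limitI:
  fixes g :: "real \<Rightarrow> 'a::heine_borel \<Rightarrow> 'b::metric_space"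
  assumes S: "open S"
    and seq: "\<And>X w z. filterlim X at_top sequentially \<Longrightarrow> w \<longlonglongrightarrow> z \<Longrightarrow> z \<in> S \<Longrightarrow> (\<lambda>k. g (X k) (w k)) \<longlonglongrightarrow> l z"
    and cont: "continuous_on S l"
  shows "locally_uniform_limit_on S g l at_top"
  unfolding locally_uniform_limit_on_def
proof
  fix z assume "z \<in> S"
  then obtain d where d: "d > 0" "cball z d \<subseteq> S" using S open_contains_cball by blast
  have "uniform_limit (ball z d \<inter> S) g l at_top"
  proof (rule ccontr)
    assume "\<not> ?thesis"
    then obtain e where e: "e > 0" "\<not> eventually (\<lambda>r. \<forall>x\<in>ball z d \<inter> S. dist (g r x) (l x) < e) at_top"
      by (auto simp: uniform_limit_iff)
    then have "\<exists>r\<ge>real k. \<exists>x\<in>ball z d. dist (g r x) (l x) \<ge> e" for k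
      unfolding eventually_at_top_linorder by (meson IntD1 not_less)
    then obtain X x where X: "\<And>k. X k \<ge> real k" and x: "\<And>k. x k \<in> ball z d" "\<And>k. dist (g (X k) (x k)) (l (x k)) \<ge> e"
      by metis
    have X_lim: "filterlim X at_top sequentially"
      by (rule filterlim_at_top_mono[OF filterlim_real_sequentially]) (use X in auto)
    have "x k \<in> cball z d" for k using x(1)[of k] by simp
    have xS: "x k \<in> S" for k using \<open>x k \<in> cball z d\<close> d(2) by blast
    obtain y s where y: "y \<in> cball z d" and s: "strict_mono (s :: nat \<Rightarrow> nat)" "(x \<circ> s) \<longlonglongrightarrow> y"
      using compact_cball[of z d] \<open>\<And>k. x k \<in> cball z d\<close> unfolding compact_def by blast
    have xs: "(\<lambda>k. x (s k)) \<longlonglongrightarrow> y" using s(2) by (simp add: o_def)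
    have yS: "y \<in> S" using y d by auto
    have "(\<lambda>k. g (X (s k)) (x (s k))) \<longlonglongrightarrow> l y"
      by (rule seq[OF filterlim_compose[OF X_lim filterlim_subseq[OF s(1)]] xs yS])
    moreover have "(\<lambda>k. l (x (s k))) \<longlonglongrightarrow> l y"
      using xS yS by (intro continuous_on_tendsto_compose[OF cont xs]) (auto intro!: always_eventually)
    ultimately have "(\<lambda>k. dist (g (X (s k)) (x (s k))) (l (x (s k)))) \<longlonglongrightarrow> dist (l y) (l y)"
      by (rule tendsto_dist)
    then have "eventually (\<lambda>k. dist (g (X (s k)) (x (s k))) (l (x (s k))) < e) sequentially"
      using e(1) by (intro order_tendstoD) auto
    then show False using x(2) by (auto simp: eventually_sequentially not_less[symmetric])
  qed
  then show "\<exists>U. open U \<and> z \<in> U \<and> uniform_limit (U \<inter> S) g l at_top"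
    using d(1) by (intro exI[of _ "ball z d"]) auto
qed

lemma locally_uniform_limit_on_tendsto:
  assumes "locally_uniform_limit_on S g l F" "z \<in> S"
  shows "((\<lambda>r. g r z) \<longlongrightarrow> l z) F"
proof -
  obtain U where "z \<in> U" "uniform_limit (U \<inter> S) g l F"
    using assms unfolding locally_uniform_limit_on_def by blast
  then show ?thesis
    using assms(2) by (auto intro: tendsto_uniform_limitI)
qed

section \<open>Homogeneous holomorphic functions on the half-plane\<close>

lemma upper_half_plane_div_i: "z \<in> upper_half_plane \<Longrightarrow> Re (z / \<i>) > 0"
  by (simp add: upper_half_plane_def Re_divide)

text \<open>No regularity of g is assumed; its derivative at 1 is inherited from c -> Q(c z0).
  Differentiating the homogeneity at c = 1 gives Euler's equation zQ' = \<alpha>Q, whose solutions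
  are multiples of a power. Division by \<open>\<i>\<close> moves the half-plane to the right
  half-plane, away from the branch cut.\<close>

lemma homogeneous_holomorphic_is_power:
  assumes hol: "Q holomorphic_on upper_half_plane"
    and nz: "z0 \<in> upper_half_plane" "Q z0 \<noteq> 0"
    and hom: "\<And>c z. c > 0 \<Longrightarrow> z \<in> upper_half_plane \<Longrightarrow> Q (of_real c * z) = of_real (g c) * Q z"
  obtains \<alpha> \<omega> where "\<omega> \<noteq> 0" "\<And>z. z \<in> upper_half_plane \<Longrightarrow> Q z = \<i> * \<omega> * (z / \<i>) powr of_real \<alpha>"
    "\<And>c. c > 0 \<Longrightarrow> g c = c powr \<alpha>"
proof -
  let ?H = upper_half_plane
  have dQ: "(Q has_field_derivative deriv Q z) (at z)" if "z \<in> ?H" for z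
    using holomorphic_derivI[OF hol open_upper_half_plane that] .
  have vd: "((\<lambda>c. Q (of_real c * z)) has_vector_derivative z * deriv Q z) (at 1)" if z: "z \<in> ?H" for z
  proof -
    have "((\<lambda>c. of_real c * z) has_vector_derivative z) (at (1::real))"
      by (auto intro!: derivative_eq_intros)
    moreover have "(Q has_field_derivative deriv Q z) (at (of_real 1 * z))" using dQ[OF z] by simp
    ultimately show ?thesis
      using field_vector_diff_chain_at[of "\<lambda>c. of_real c * z" z 1 Q "deriv Q z"] by (simp add: o_def)
  qed
  define \<beta> where "\<beta> = z0 * deriv Q z0 / Q z0"
  have ev: "eventually (\<lambda>c::real. c > 0) (nhds 1)"
    by (rule eventually_nhds_in_open[of "{0<..}", simplified]) auto
  have "((\<lambda>c. Q (of_real c * z0) / Q z0) has_vector_derivative \<beta>) (at 1)"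
    using has_vector_derivative_divide[OF vd[OF nz(1)], of "Q z0"] by (simp add: \<beta>_def)
  then have g\<beta>: "((\<lambda>c. complex_of_real (g c)) has_vector_derivative \<beta>) (at 1)"
    by (rule has_vector_derivative_transform_within_open[of _ _ _ "{0<..}"]) (use hom nz in auto)
  \<comment> \<open>The values of g are real, so its derivative at 1, which becomes the exponent, is
    real as well.\<close>
  have "((\<lambda>c. Im (complex_of_real (g c))) has_vector_derivative Im \<beta>) (at 1)"
    using bounded_linear.has_vector_derivative[OF bounded_linear_Im g\<beta>] by (simp add: o_def)
  then have "((\<lambda>c::real. 0::real) has_vector_derivative Im \<beta>) (at 1)" by simp
  then have "Im \<beta> = 0"
    using has_vector_derivative_const[of "0::real" "at (1::real)"] vector_derivative_unique_at by blast
  define \<alpha> where "\<alpha> = Re \<beta>"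
  have \<beta>: "\<beta> = of_real \<alpha>" using \<open>Im \<beta> = 0\<close> by (simp add: \<alpha>_def complex_eq_iff)
  have euler: "z * deriv Q z = of_real \<alpha> * Q z" if z: "z \<in> ?H" for z
  proof -
    have "((\<lambda>c. complex_of_real (g c) * Q z) has_vector_derivative \<beta> * Q z) (at 1)"
      using g\<beta> by (rule has_vector_derivative_mult_left)
    then have "((\<lambda>c. Q (of_real c * z)) has_vector_derivative \<beta> * Q z) (at 1)"
      by (rule has_vector_derivative_transform_within_open[of _ _ _ "{0<..}"]) (use hom z in auto)
    with vd[OF z] show ?thesis using vector_derivative_unique_at \<beta> by blast
  qed
  \<comment> \<open>Euler's equation says precisely that this function has derivative 0.\<close>
  define F where "F z = Q z * (z / \<i>) powr (- of_real \<alpha>)" for z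
  have zi: "z / \<i> \<notin> \<real>\<^sub>\<le>\<^sub>0" "z \<noteq> 0" if "z \<in> ?H" for z
    using upper_half_plane_div_i[OF that] by (auto simp: complex_nonpos_Reals_iff)
  have "(F has_field_derivative 0) (at z within ?H)" if z: "z \<in> ?H" for z
  proof -
    have "(F has_field_derivative deriv Q z * (z / \<i>) powr (- of_real \<alpha>) +
        Q z * (- of_real \<alpha> * (z / \<i>) powr (- of_real \<alpha> - 1) * (1 / \<i>))) (at z)"
    proof -
      have "((\<lambda>z. (z / \<i>) powr (- of_real \<alpha>)) has_field_derivative
          - of_real \<alpha> * (z / \<i>) powr (- of_real \<alpha> - 1) * (1 / \<i>)) (at z)"
        by (rule DERIV_chain2[where g = "\<lambda>z. z / \<i>" and f = "\<lambda>z. z powr (- of_real \<alpha>)", OF has_field_derivative_powr[OF zi(1)[OF z]]]) (auto intro!: derivative_eq_intros)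
      from DERIV_mult[OF dQ[OF z] this] show ?thesis
        unfolding F_def by (simp only: mult.commute)
    qed
    also have "(z / \<i>) powr (- of_real \<alpha> - 1) = (z / \<i>) powr (- of_real \<alpha>) / (z / \<i>)"
      using zi[OF z] by (simp add: powr_diff)
    also have "deriv Q z * (z / \<i>) powr (- of_real \<alpha>) +
        Q z * (- of_real \<alpha> * ((z / \<i>) powr (- of_real \<alpha>) / (z / \<i>)) * (1 / \<i>)) =
        (z / \<i>) powr (- of_real \<alpha>) / z * (z * deriv Q z - of_real \<alpha> * Q z)"
      using zi[OF z] by (simp add: field_simps del: divide_i)
    finally have "(F has_field_derivative 0) (at z)" using euler[OF z] by simp
    then show ?thesis by (rule has_field_derivative_at_within)
  qed
  then obtain c where c: "\<And>z. z \<in> ?H \<Longrightarrow> F z = c"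
    using has_field_derivative_zero_constant[OF convex_upper_half_plane] by metis
  have i: "\<i> \<in> ?H" by (simp add: upper_half_plane_def)
  then have c_eq: "c = Q \<i>" using c[OF i] by (simp add: F_def)
  have Q: "Q z = Q \<i> * (z / \<i>) powr of_real \<alpha>" if z: "z \<in> ?H" for z
  proof -
    have "Q z = Q z * ((z / \<i>) powr (- of_real \<alpha>) * (z / \<i>) powr of_real \<alpha>)"
      using zi[OF z] by (simp add: powr_minus del: divide_i)
    also have "\<dots> = F z * (z / \<i>) powr of_real \<alpha>" by (simp only: F_def mult.assoc)
    finally show ?thesis using c[OF z] c_eq by simp
  qed
  have nzi: "Q \<i> \<noteq> 0" using Q[OF nz(1)] nz(2) by auto
  define \<omega> where "\<omega> = Q \<i> / \<i>"
  show thesis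
  proof (rule that)
    show "\<omega> \<noteq> 0" using nzi by (simp add: \<omega>_def)
    show "Q z = \<i> * \<omega> * (z / \<i>) powr of_real \<alpha>" if "z \<in> ?H" for z
      using Q[OF that] by (simp add: \<omega>_def)
    show "g c = c powr \<alpha>" if c: "c > 0" for c
    proof -
      have "of_real c * \<i> \<in> ?H" using c by (simp add: upper_half_plane_def)
      then have "of_real (g c) * Q \<i> = Q \<i> * (of_real c * \<i> / \<i>) powr of_real \<alpha>"
        using hom[OF c i] Q by metis
      also have "of_real c * \<i> / \<i> = complex_of_real c"
        by (rule nonzero_mult_div_cancel_right) simp
      finally have "complex_of_real (g c) = of_real c powr of_real \<alpha>"
        using nzi by simp
      also have "\<dots> = of_real (c powr \<alpha>)" using c by (simp add: powr_of_real)
      finally show ?thesis using of_real_eq_iff by blast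
    qed
  qed
qed

section \<open>Stieltjes inversion\<close>

lemma uniformly_continuous_compact_support:
  fixes \<phi> :: "real \<Rightarrow> real"
  assumes cont: "continuous_on UNIV \<phi>" and supp: "\<And>x. x \<notin> {a..b} \<Longrightarrow> \<phi> x = 0"
  shows "uniformly_continuous_on UNIV \<phi>"
  unfolding uniformly_continuous_on_def
proof (intro allI impI)
  fix e :: real assume e: "e > 0"
  have "uniformly_continuous_on {a-1..b+1} \<phi>"
    by (intro compact_uniformly_continuous continuous_on_subset[OF cont]) auto
  then obtain d where d: "d > 0" "\<And>x x'. x \<in> {a-1..b+1} \<Longrightarrow> x' \<in> {a-1..b+1} \<Longrightarrow> dist x' x < d \<Longrightarrow> dist (\<phi> x') (\<phi> x) < e"
    unfolding uniformly_continuous_on_def using e by metis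
  show "\<exists>d>0. \<forall>x\<in>UNIV. \<forall>x'\<in>UNIV. dist x' x < d \<longrightarrow> dist (\<phi> x') (\<phi> x) < e"
  proof (intro exI[of _ "min d 1"] conjI ballI impI)
    fix x x' :: real assume x: "dist x' x < min d 1"
    show "dist (\<phi> x') (\<phi> x) < e"
    proof (cases "x \<in> {a..b} \<or> x' \<in> {a..b}")
      case True
      then have "x \<in> {a-1..b+1}" "x' \<in> {a-1..b+1}" using x by (auto simp: dist_real_def)
      then show ?thesis using d(2) x by simp
    qed (use supp e in simp)
  qed (use d in simp)
qed

lemma continuous_bounded_on_interval:
  fixes W :: "real \<Rightarrow> real"
  assumes "continuous_on UNIV W"
  obtains C where "C \<ge> 0" "\<And>t. t \<in> {a..b} \<Longrightarrow> \<bar>W t\<bar> \<le> C"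
proof -
  have "compact (W ` {a..b})"
    by (intro compact_continuous_image continuous_on_subset[OF assms]) auto
  then obtain C where C: "\<And>x. x \<in> {a..b} \<Longrightarrow> \<bar>W x\<bar> \<le> C"
    using compact_imp_bounded bounded_iff by (metis imageI real_norm_def)
  show thesis
  proof (rule that[of "max C 0"])
    show "\<bar>W t\<bar> \<le> max C 0" if "t \<in> {a..b}" for t
      using C[OF that] by (simp add: le_max_iff_disj)
  qed simp
qed

lemma compact_support_bounded:
  fixes \<phi> :: "real \<Rightarrow> real"
  assumes cont: "continuous_on UNIV \<phi>" and supp: "\<And>x. x \<notin> {a..b} \<Longrightarrow> \<phi> x = 0"
  obtains B where "B \<ge> 0" "\<And>x. \<bar>\<phi> x\<bar> \<le> B"
proof -
  obtain B where B: "B \<ge> 0" "\<And>x. x \<in> {a..b} \<Longrightarrow> \<bar>\<phi> x\<bar> \<le> B"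
    using continuous_bounded_on_interval[OF cont] by blast
  have "\<bar>\<phi> x\<bar> \<le> B" for x
    using B supp[of x] by (cases "x \<in> {a..b}") auto
  with B(1) show thesis by (rule that)
qed

lemma compact_support_integrable:
  fixes \<phi> :: "real \<Rightarrow> real"
  assumes cont: "continuous_on UNIV \<phi>" and supp: "\<And>x. x \<notin> {a..b} \<Longrightarrow> \<phi> x = 0"
  shows "integrable lborel \<phi>"
proof -
  have "set_integrable lborel {a..b} \<phi>"
    by (intro borel_integrable_atLeastAtMost' continuous_on_subset[OF cont]) auto
  moreover have "(\<lambda>x. indicator {a..b} x *\<^sub>R \<phi> x) = \<phi>"
    using supp by (auto simp: indicator_def fun_eq_iff)
  ultimately show ?thesis by (simp only: set_integrable_def)
qed

section \<open>The Poisson kernel as an approximate identity\<close>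

lemma
  shows integrable_1_plus_square: "integrable lborel (\<lambda>s::real. 1 / (1 + s\<^sup>2))"
    and integral_1_plus_square: "(\<integral>s. 1 / (1 + s\<^sup>2) \<partial>lborel) = pi"
proof -
  show "integrable lborel (\<lambda>s::real. 1 / (1 + s\<^sup>2))"
    using integrable_inverse_1_plus_square by (simp add: set_integrable_def inverse_eq_divide)
  show "(\<integral>s. 1 / (1 + s\<^sup>2) \<partial>lborel) = pi"
    using LBINT_inverse_1_plus_square
    by (simp add: interval_lebesgue_integral_def set_lebesgue_integral_def inverse_eq_divide)
qed

lemma Im_cauchy_kernel: "Im (1 / (complex_of_real t - Complex x y)) = y / ((t - x)\<^sup>2 + y\<^sup>2)"
  by (simp add: Im_divide power2_eq_square)

text \<open>This is pi times the usual Poisson integral; leaving out the normalisation is why pi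
  appears as a factor in the inversion formulas.\<close>

definition poisson :: "(real \<Rightarrow> real) \<Rightarrow> real \<Rightarrow> real \<Rightarrow> real" where
  "poisson \<phi> y t = (\<integral>x. \<phi> x * (y / ((t - x)\<^sup>2 + y\<^sup>2)) \<partial>lborel)"

lemma poisson_eq:
  assumes y: "y > 0"
  shows "poisson \<phi> y t = (\<integral>s. \<phi> (t + y * s) * (1 / (1 + s\<^sup>2)) \<partial>lborel)"
proof -
  have "poisson \<phi> y t = \<bar>y\<bar> *\<^sub>R (\<integral>s. \<phi> (t + y * s) * (y / ((t - (t + y * s))\<^sup>2 + y\<^sup>2)) \<partial>lborel)"
    unfolding poisson_def by (rule lborel_integral_real_affine) (use y in simp)
  also have "\<dots> = (\<integral>s. y * (\<phi> (t + y * s) * (y / ((t - (t + y * s))\<^sup>2 + y\<^sup>2))) \<partial>lborel)"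
    using y by (simp only: abs_of_pos real_scaleR_def integral_mult_right_zero)
  also have "\<dots> = (\<integral>s. \<phi> (t + y * s) * (1 / (1 + s\<^sup>2)) \<partial>lborel)"
  proof (intro Bochner_Integration.integral_cong refl)
    fix s
    have "(t - (t + y * s))\<^sup>2 + y\<^sup>2 = y * (y * (1 + s\<^sup>2))" by (simp add: power2_eq_square algebra_simps)
    then show "y * (\<phi> (t + y * s) * (y / ((t - (t + y * s))\<^sup>2 + y\<^sup>2))) = \<phi> (t + y * s) * (1 / (1 + s\<^sup>2))"
      using y by simp
  qed
  finally show ?thesis .
qed

text \<open>The substitution x = t + ys leaves the fixed kernel 1/(1 + s^2). Uniform continuity
  handles small ys, and the remaining tail is an integral free of t, whence the uniformity in
  t.\<close>

lemma poisson_approx: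
  assumes uc: "uniformly_continuous_on UNIV \<phi>" and B: "\<And>x. \<bar>\<phi> x\<bar> \<le> B" and e: "e > 0"
  shows "\<exists>N. \<forall>k\<ge>N. \<forall>t. \<bar>poisson \<phi> (inverse (Suc k)) t - pi * \<phi> t\<bar> \<le> e"
proof -
  have cont: "continuous_on UNIV \<phi>" using uc by (rule uniformly_continuous_imp_continuous)
  have [measurable]: "\<phi> \<in> borel_measurable borel" by (rule borel_measurable_continuous_onI[OF cont])
  have B0: "B \<ge> 0" using B[of 0] by simp
  \<comment> \<open>The fixed kernel has integral pi, so this choice spends half of e on the region
    where \<open>\<phi>\<close> varies little.\<close>
  define c where "c = e / (2 * pi)"
  have c: "c > 0" using e by (simp add: c_def)
  obtain d where d: "d > 0" "\<And>x x'. dist x' x < d \<Longrightarrow> dist (\<phi> x') (\<phi> x) < c"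
    using uc c unfolding uniformly_continuous_on_def by (metis UNIV_I)
  let ?y = "\<lambda>k. inverse (real (Suc k))"
  define tail where "tail k s = (if \<bar>?y k * s\<bar> \<ge> d then 1 / (1 + s\<^sup>2) else (0::real))" for k s
  have tail_m [measurable]: "tail k \<in> borel_measurable lborel" for k
    unfolding tail_def by measurable
  have tail_b: "norm (tail k s) \<le> 1 / (1 + s\<^sup>2)" for k s
    by (simp add: tail_def add_pos_nonneg)
  have int_tail: "integrable lborel (tail k)" for k
    by (rule Bochner_Integration.integrable_bound[OF integrable_1_plus_square])
      (use tail_b in \<open>auto simp: add_pos_nonneg\<close>)
  have "(\<lambda>k. \<integral>s. tail k s \<partial>lborel) \<longlonglongrightarrow> (\<integral>s. 0 \<partial>(lborel :: real measure))"
  proof (rule integral_dominated_convergence[where w = "\<lambda>s. 1 / (1 + s\<^sup>2)"])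
    show "AE s in lborel. (\<lambda>k. tail k s) \<longlonglongrightarrow> 0"
    proof (rule AE_I2)
      fix s
      have "(\<lambda>k. \<bar>?y k * s\<bar>) \<longlonglongrightarrow> \<bar>0 * s\<bar>"
        by (intro tendsto_intros LIMSEQ_inverse_real_of_nat)
      then have "eventually (\<lambda>k. \<bar>?y k * s\<bar> < d) sequentially"
        using d(1) by (intro order_tendstoD) auto
      then show "(\<lambda>k. tail k s) \<longlonglongrightarrow> 0"
        by (intro tendsto_eventually, elim eventually_mono) (simp add: tail_def)
    qed
  qed (use tail_b integrable_1_plus_square in auto)
  then have "(\<lambda>k. \<integral>s. tail k s \<partial>lborel) \<longlonglongrightarrow> 0" by simp
  from tendsto_mult[OF tendsto_const this, of "2 * B"]
  have "eventually (\<lambda>k. 2 * B * (\<integral>s. tail k s \<partial>lborel) < e / 2) sequentially"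
    using e by (auto dest: order_tendstoD(2)[of _ _ _ "e / 2"])
  then obtain N where N: "\<And>k. k \<ge> N \<Longrightarrow> 2 * B * (\<integral>s. tail k s \<partial>lborel) < e / 2"
    by (auto simp: eventually_sequentially)
  have "\<bar>poisson \<phi> (?y k) t - pi * \<phi> t\<bar> \<le> e" if k: "k \<ge> N" for k t
  proof -
    have y: "?y k > 0" by simp
    have i1: "integrable lborel (\<lambda>s. \<phi> (t + ?y k * s) * (1 / (1 + s\<^sup>2)))"
    proof (rule Bochner_Integration.integrable_bound[OF integrable_mult_right[OF integrable_1_plus_square, of B]])
      show "AE s in lborel. norm (\<phi> (t + ?y k * s) * (1 / (1 + s\<^sup>2))) \<le> norm (B * (1 / (1 + s\<^sup>2)))"
        using B B0 by (intro AE_I2) (auto simp: abs_mult add_pos_nonneg intro!: divide_right_mono)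
    qed measurable
    have i2: "integrable lborel (\<lambda>s. \<phi> t * (1 / (1 + s\<^sup>2)))"
      by (intro integrable_mult_right integrable_1_plus_square)
    have "poisson \<phi> (?y k) t - pi * \<phi> t =
        (\<integral>s. \<phi> (t + ?y k * s) * (1 / (1 + s\<^sup>2)) \<partial>lborel) - (\<integral>s. \<phi> t * (1 / (1 + s\<^sup>2)) \<partial>lborel)"
      unfolding poisson_eq[OF y] integral_mult_right_zero integral_1_plus_square by simp
    also have "\<dots> = (\<integral>s. \<phi> (t + ?y k * s) * (1 / (1 + s\<^sup>2)) - \<phi> t * (1 / (1 + s\<^sup>2)) \<partial>lborel)"
      by (rule Bochner_Integration.integral_diff[symmetric, OF i1 i2])
    finally have "\<bar>poisson \<phi> (?y k) t - pi * \<phi> t\<bar> =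
        norm (\<integral>s. \<phi> (t + ?y k * s) * (1 / (1 + s\<^sup>2)) - \<phi> t * (1 / (1 + s\<^sup>2)) \<partial>lborel)" by simp
    also have "\<dots> \<le> (\<integral>s. norm (\<phi> (t + ?y k * s) * (1 / (1 + s\<^sup>2)) - \<phi> t * (1 / (1 + s\<^sup>2))) \<partial>lborel)"
      by (rule integral_norm_bound)
    also have "\<dots> \<le> (\<integral>s. c * (1 / (1 + s\<^sup>2)) + 2 * B * tail k s \<partial>lborel)"
    proof (rule integral_mono)
      show "integrable lborel (\<lambda>s. norm (\<phi> (t + ?y k * s) * (1 / (1 + s\<^sup>2)) - \<phi> t * (1 / (1 + s\<^sup>2))))"
        by (intro integrable_norm Bochner_Integration.integrable_diff i1 i2)
      show "integrable lborel (\<lambda>s. c * (1 / (1 + s\<^sup>2)) + 2 * B * tail k s)"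
        by (intro Bochner_Integration.integrable_add integrable_mult_right integrable_1_plus_square int_tail)
      fix s :: real
      have pos: "1 + s\<^sup>2 > 0" by (simp add: add_pos_nonneg)
      have "norm (\<phi> (t + ?y k * s) * (1 / (1 + s\<^sup>2)) - \<phi> t * (1 / (1 + s\<^sup>2))) =
          \<bar>\<phi> (t + ?y k * s) - \<phi> t\<bar> * (1 / (1 + s\<^sup>2))"
        using pos by (simp add: left_diff_distrib[symmetric] abs_mult diff_divide_distrib[symmetric])
      also have "\<dots> \<le> c * (1 / (1 + s\<^sup>2)) + 2 * B * tail k s"
      proof (cases "\<bar>?y k * s\<bar> \<ge> d")
        case True
        have "\<bar>\<phi> (t + ?y k * s) - \<phi> t\<bar> \<le> 2 * B" using B[of "t + ?y k * s"] B[of t] by linarith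
        then have "\<bar>\<phi> (t + ?y k * s) - \<phi> t\<bar> * (1 / (1 + s\<^sup>2)) \<le> 2 * B * (1 / (1 + s\<^sup>2))"
          using pos by (intro mult_right_mono) auto
        also have "\<dots> = 2 * B * tail k s" using True by (simp add: tail_def)
        also have "\<dots> \<le> c * (1 / (1 + s\<^sup>2)) + 2 * B * tail k s" using c pos by simp
        finally show ?thesis .
      next
        case False
        then have "\<bar>\<phi> (t + ?y k * s) - \<phi> t\<bar> \<le> c"
          using d(2)[of "t + ?y k * s" t] by (simp add: dist_real_def)
        then have "\<bar>\<phi> (t + ?y k * s) - \<phi> t\<bar> * (1 / (1 + s\<^sup>2)) \<le> c * (1 / (1 + s\<^sup>2))"
          using pos by (intro mult_right_mono) auto
        then show ?thesis using False by (simp add: tail_def)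
      qed
      finally show "norm (\<phi> (t + ?y k * s) * (1 / (1 + s\<^sup>2)) - \<phi> t * (1 / (1 + s\<^sup>2))) \<le>
        c * (1 / (1 + s\<^sup>2)) + 2 * B * tail k s" .
    qed
    also have "\<dots> = c * pi + 2 * B * (\<integral>s. tail k s \<partial>lborel)"
    proof -
      have "(\<integral>s. c * (1 / (1 + s\<^sup>2)) + 2 * B * tail k s \<partial>lborel) =
          (\<integral>s. c * (1 / (1 + s\<^sup>2)) \<partial>lborel) + (\<integral>s. 2 * B * tail k s \<partial>lborel)"
        by (intro Bochner_Integration.integral_add integrable_mult_right integrable_1_plus_square int_tail)
      then show ?thesis by (simp only: integral_mult_right_zero integral_1_plus_square)
    qed
    also have "\<dots> \<le> e / 2 + e / 2" using N[OF k] by (simp add: c_def)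
    finally show ?thesis by simp
  qed
  then show ?thesis by blast
qed

context finite_borel_measure
begin

text \<open>The imaginary part of the Cauchy kernel is the Poisson kernel, so Fubini exchanges the
  two integrations. Integrability comes from the compact support of \<open>\<phi>\<close> and the
  finite mass.\<close>

lemma integral_poisson:
  fixes \<phi> :: "real \<Rightarrow> real"
  assumes cont: "continuous_on UNIV \<phi>" and supp: "\<And>x. x \<notin> {a..b} \<Longrightarrow> \<phi> x = 0" and y: "y > 0"
  shows "(\<integral>t. poisson \<phi> y t \<partial>M) = (\<integral>x. \<phi> x * Im (cauchy_int M (Complex x y)) \<partial>lborel)"
    and "poisson \<phi> y \<in> borel_measurable borel"
proof -
  interpret L: pair_sigma_finite lborel M ..
  have [measurable]: "\<phi> \<in> borel_measurable borel" by (rule borel_measurable_continuous_onI[OF cont])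
  have [measurable_cong]: "sets M = sets borel" by (rule M_is_borel)
  let ?g = "\<lambda>x t. \<phi> x * (y / ((t - x)\<^sup>2 + y\<^sup>2))"
  have Kb: "norm (y / ((t - x)\<^sup>2 + y\<^sup>2)) \<le> 1 / y" for t x
    using abs_Im_le_cmod[of "1 / (complex_of_real t - Complex x y)"] cauchy_kernel_bound[of "Complex x y" t] y
    unfolding Im_cauchy_kernel by simp
  have gb: "norm (?g x t) \<le> \<bar>\<phi> x\<bar> * (1 / y)" for x t
    using mult_left_mono[OF Kb, of "\<bar>\<phi> x\<bar>"] by (simp only: real_norm_def abs_mult abs_ge_zero)
  have m: "(\<lambda>(x, t). ?g x t) \<in> borel_measurable (lborel \<Otimes>\<^sub>M M)"
    by measurable
  have int: "integrable (lborel \<Otimes>\<^sub>M M) (\<lambda>(x, t). ?g x t)"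
  proof (rule L.Fubini_integrable[OF m])
    show "integrable lborel (\<lambda>x. \<integral>t. norm (case (x, t) of (x, t) \<Rightarrow> ?g x t) \<partial>M)"
    proof (rule Bochner_Integration.integrable_bound)
      show "integrable lborel (\<lambda>x. \<bar>\<phi> x\<bar> * (1 / y) * measure M UNIV)"
        by (intro integrable_mult_left integrable_abs compact_support_integrable[OF cont supp])
      have "norm (\<integral>t. norm (?g x t) \<partial>M) \<le> \<bar>\<phi> x\<bar> * (1 / y) * measure M UNIV" for x
        by (rule norm_integral_le) (use gb in auto)
      then show "AE x in lborel. norm (\<integral>t. norm (case (x, t) of (x, t) \<Rightarrow> ?g x t) \<partial>M) \<le>
          norm (\<bar>\<phi> x\<bar> * (1 / y) * measure M UNIV)"
        using y by simp
    qed measurable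
    have "integrable M (?g x)" for x
      by (rule integrable_bounded[OF _ gb]) measurable
    then show "AE x in lborel. integrable M (\<lambda>t. case (x, t) of (x, t) \<Rightarrow> ?g x t)"
      by simp
  qed
  have "(\<integral>t. poisson \<phi> y t \<partial>M) = (\<integral>x. (\<integral>t. ?g x t \<partial>M) \<partial>lborel)"
    unfolding poisson_def by (rule L.Fubini_integral[OF int])
  also have "\<dots> = (\<integral>x. \<phi> x * Im (cauchy_int M (Complex x y)) \<partial>lborel)"
  proof (intro Bochner_Integration.integral_cong refl)
    fix x
    have "Im (cauchy_int M (Complex x y)) = (\<integral>t. Im (1 / (complex_of_real t - Complex x y)) \<partial>M)"
      unfolding cauchy_int_def by (rule integral_Im[symmetric]) (rule integrable_cauchy, use y in simp)
    then show "(\<integral>t. ?g x t \<partial>M) = \<phi> x * Im (cauchy_int M (Complex x y))"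
      unfolding Im_cauchy_kernel by (simp only: integral_mult_right_zero)
  qed
  finally show "(\<integral>t. poisson \<phi> y t \<partial>M) = (\<integral>x. \<phi> x * Im (cauchy_int M (Complex x y)) \<partial>lborel)" .
  show "poisson \<phi> y \<in> borel_measurable borel"
    unfolding poisson_def[abs_def] by measurable
qed

end

text \<open>The error in Stieltjes inversion depends on the measure only through its total mass. Hence it
  serves both to invert a single transform and to pass to the limit in a sequence of transforms.\<close>

lemma stieltjes_approx:
  fixes \<phi> :: "real \<Rightarrow> real"
  assumes cont: "continuous_on UNIV \<phi>" and supp: "\<And>x. x \<notin> {a..b} \<Longrightarrow> \<phi> x = 0" and e: "e > 0"
  shows "\<exists>N. \<forall>k\<ge>N. \<forall>M. finite_borel_measure M \<longrightarrow>
    \<bar>(\<integral>x. \<phi> x * Im (cauchy_int M (Complex x (inverse (Suc k)))) \<partial>lborel) - pi * (\<integral>t. \<phi> t \<partial>M)\<bar> \<le> e * measure M UNIV"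
proof -
  obtain B where B: "\<And>x. \<bar>\<phi> x\<bar> \<le> B" using compact_support_bounded[OF cont supp] by blast
  have \<phi>m [measurable]: "\<phi> \<in> borel_measurable borel" by (rule borel_measurable_continuous_onI[OF cont])
  obtain N where N: "\<And>k t. k \<ge> N \<Longrightarrow> \<bar>poisson \<phi> (inverse (Suc k)) t - pi * \<phi> t\<bar> \<le> e"
    using poisson_approx[OF uniformly_continuous_compact_support[OF cont supp] B e] by blast
  show ?thesis
  proof (intro exI[of _ N] allI impI)
    fix k M assume k: "k \<ge> N" and "finite_borel_measure M"
    then interpret finite_borel_measure M by simp
    let ?y = "inverse (real (Suc k))"
    have y: "?y > 0" by simp
    have pm [measurable]: "poisson \<phi> ?y \<in> borel_measurable borel" by (rule integral_poisson(2)[OF cont supp y])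
    have "\<bar>poisson \<phi> ?y t\<bar> \<le> e + pi * B" for t
    proof -
      have "\<bar>pi * \<phi> t\<bar> \<le> pi * B" using B[of t] by (simp add: abs_mult)
      then show ?thesis using N[OF k, of t] by linarith
    qed
    then have i1: "integrable M (poisson \<phi> ?y)"
      by (intro integrable_bounded[where B = "e + pi * B"] pm) simp
    have i2: "integrable M (\<lambda>t. pi * \<phi> t)"
      by (intro integrable_mult_right integrable_bounded[where B = B]) (use B in auto)
    have "(\<integral>x. \<phi> x * Im (cauchy_int M (Complex x ?y)) \<partial>lborel) - pi * (\<integral>t. \<phi> t \<partial>M) =
        (\<integral>t. poisson \<phi> ?y t - pi * \<phi> t \<partial>M)"
      by (simp only: integral_poisson(1)[OF cont supp y, symmetric]
        Bochner_Integration.integral_diff[OF i1 i2] integral_mult_right_zero)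
    also have "\<bar>\<dots>\<bar> \<le> e * measure M UNIV"
    proof -
      have m: "(\<lambda>t. poisson \<phi> ?y t - pi * \<phi> t) \<in> borel_measurable borel"
        by (intro borel_measurable_diff borel_measurable_times pm \<phi>m) simp
      have "norm (poisson \<phi> ?y t - pi * \<phi> t) \<le> e" for t
        unfolding real_norm_def by (rule N[OF k])
      from norm_integral_le[OF m this] show ?thesis by (simp only: real_norm_def)
    qed
    finally show "\<bar>(\<integral>x. \<phi> x * Im (cauchy_int M (Complex x ?y)) \<partial>lborel) - pi * (\<integral>t. \<phi> t \<partial>M)\<bar> \<le> e * measure M UNIV" .
  qed
qed

lemma stieltjes_inversion:
  fixes \<phi> :: "real \<Rightarrow> real"
  assumes M: "finite_borel_measure M" and cont: "continuous_on UNIV \<phi>" and supp: "\<And>x. x \<notin> {a..b} \<Longrightarrow> \<phi> x = 0"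
  shows "(\<lambda>k. \<integral>x. \<phi> x * Im (cauchy_int M (Complex x (inverse (Suc k)))) \<partial>lborel) \<longlonglongrightarrow> pi * (\<integral>t. \<phi> t \<partial>M)"
proof (rule LIMSEQ_I)
  fix r :: real assume r: "r > 0"
  \<comment> \<open>Adding 1 to the mass avoids division by 0 for a null measure.\<close>
  define e where "e = r / (2 * (measure M UNIV + 1))"
  have m: "measure M UNIV \<ge> 0" by simp
  have e: "e > 0" unfolding e_def using r m by (intro divide_pos_pos mult_pos_pos add_nonneg_pos) auto
  have "e * measure M UNIV \<le> e * (measure M UNIV + 1)" using e by simp
  also have "\<dots> = r / 2"
  proof -
    have gen: "r / (2 * c) * c = r / 2" if "c > 0" for c
      using that by simp
    show ?thesis unfolding e_def by (rule gen) (use m in linarith)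
  qed
  also have "\<dots> < r" using r by simp
  finally show "\<exists>no. \<forall>k\<ge>no. norm ((\<integral>x. \<phi> x * Im (cauchy_int M (Complex x (inverse (Suc k)))) \<partial>lborel) - pi * (\<integral>t. \<phi> t \<partial>M)) < r"
  proof -
    assume less: "e * measure M UNIV < r"
    obtain N where "\<And>k. k \<ge> N \<Longrightarrow>
        \<bar>(\<integral>x. \<phi> x * Im (cauchy_int M (Complex x (inverse (Suc k)))) \<partial>lborel) - pi * (\<integral>t. \<phi> t \<partial>M)\<bar> \<le> e * measure M UNIV"
      using stieltjes_approx[OF cont supp e] M by blast
    then show ?thesis
      unfolding real_norm_def using less by (intro exI[of _ N] allI impI) (rule order_le_less_trans)
  qed
qed

text \<open>One height y is fixed at which inversion is accurate for all the measures at once, which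
  is possible because their masses are bounded together. At this height the pointwise convergence of
  the Cauchy integrals passes under the integral by domination.\<close>

lemma vague_convergence:
  fixes \<tau> :: "nat \<Rightarrow> real measure" and \<phi> :: "real \<Rightarrow> real"
  assumes fin: "\<And>k. finite_borel_measure (\<tau> k)" and bd: "\<And>k. measure (\<tau> k) UNIV \<le> B"
    and \<sigma>: "finite_borel_measure \<sigma>"
    and conv: "\<And>z. Im z > 0 \<Longrightarrow> (\<lambda>k. cauchy_int (\<tau> k) z) \<longlonglongrightarrow> cauchy_int \<sigma> z"
    and cont: "continuous_on UNIV \<phi>" and supp: "\<And>x. x \<notin> {a..b} \<Longrightarrow> \<phi> x = 0"
  shows "(\<lambda>k. \<integral>t. \<phi> t \<partial>\<tau> k) \<longlonglongrightarrow> (\<integral>t. \<phi> t \<partial>\<sigma>)"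
proof (rule LIMSEQ_I)
  fix r :: real assume r: "r > 0"
  have [measurable]: "\<phi> \<in> borel_measurable borel" by (rule borel_measurable_continuous_onI[OF cont])
  have B0: "B \<ge> 0" using bd[of 0] measure_nonneg order_trans by blast
  \<comment> \<open>Three errors, in units of e: inversion for \<open>\<tau> k\<close> contributes
    at most B, inversion for \<open>\<sigma>\<close> its mass, and the distance of the two integrals
    at height y contributes 1.\<close>
  define C where "C = B + measure \<sigma> UNIV + 1"
  have C: "C > 0" using B0 by (simp add: C_def add_nonneg_pos)
  define e where "e = r / C"
  have e: "e > 0" using r C by (simp add: e_def)
  obtain N where N: "\<And>M. finite_borel_measure M \<Longrightarrow>
    \<bar>(\<integral>x. \<phi> x * Im (cauchy_int M (Complex x (inverse (Suc N)))) \<partial>lborel) - pi * (\<integral>t. \<phi> t \<partial>M)\<bar> \<le> e * measure M UNIV"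
    using stieltjes_approx[OF cont supp e] by blast
  define y where "y = inverse (real (Suc N))"
  have y: "y > 0" by (simp add: y_def)
  define J where "J M = (\<integral>x. \<phi> x * Im (cauchy_int M (Complex x y)) \<partial>lborel)" for M
  have Im_m: "(\<lambda>x. Im (cauchy_int M (Complex x y))) \<in> borel_measurable borel" if "finite_borel_measure M" for M
    by (intro borel_measurable_continuous_onI continuous_on_Im
        finite_borel_measure.continuous_on_cauchy_int_line that y)
  have "(\<lambda>k. J (\<tau> k)) \<longlonglongrightarrow> J \<sigma>"
    unfolding J_def
  proof (rule integral_dominated_convergence[where w = "\<lambda>x. \<bar>\<phi> x\<bar> * (B / y)"])
    show "(\<lambda>x. \<phi> x * Im (cauchy_int \<sigma> (Complex x y))) \<in> borel_measurable lborel"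
      using Im_m[OF \<sigma>] by measurable
    show "(\<lambda>x. \<phi> x * Im (cauchy_int (\<tau> k) (Complex x y))) \<in> borel_measurable lborel" for k
      using Im_m[OF fin] by measurable
    show "integrable lborel (\<lambda>x. \<bar>\<phi> x\<bar> * (B / y))"
      by (intro integrable_mult_left integrable_abs compact_support_integrable[OF cont supp])
    show "AE x in lborel. (\<lambda>k. \<phi> x * Im (cauchy_int (\<tau> k) (Complex x y))) \<longlonglongrightarrow> \<phi> x * Im (cauchy_int \<sigma> (Complex x y))"
      using y by (intro AE_I2 tendsto_intros conv) simp
    have "\<bar>Im (cauchy_int (\<tau> k) (Complex x y))\<bar> \<le> B / y" for k x
    proof -
      have "\<bar>Im (cauchy_int (\<tau> k) (Complex x y))\<bar> \<le> measure (\<tau> k) UNIV / y"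
        using order_trans[OF abs_Im_le_cmod finite_borel_measure.cauchy_int_bound[OF fin, of "Complex x y"]] y by simp
      also have "\<dots> \<le> B / y" using bd y by (intro divide_right_mono) auto
      finally show ?thesis .
    qed
    then show "AE x in lborel. norm (\<phi> x * Im (cauchy_int (\<tau> k) (Complex x y))) \<le> \<bar>\<phi> x\<bar> * (B / y)" for k
      by (intro AE_I2) (simp only: real_norm_def abs_mult, intro mult_left_mono, auto)
  qed
  then obtain K where K: "\<And>k. k \<ge> K \<Longrightarrow> \<bar>J (\<tau> k) - J \<sigma>\<bar> < e"
    using LIMSEQ_D[OF _ e] by (metis real_norm_def)
  have "norm ((\<integral>t. \<phi> t \<partial>\<tau> k) - (\<integral>t. \<phi> t \<partial>\<sigma>)) < r" if k: "k \<ge> K" for k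
  proof -
    have "\<bar>J (\<tau> k) - pi * (\<integral>t. \<phi> t \<partial>\<tau> k)\<bar> \<le> e * B"
      using N[OF fin[of k]] order_trans[OF _ mult_left_mono[OF bd[of k], of e]] e by (simp add: J_def y_def)
    moreover have "\<bar>J \<sigma> - pi * (\<integral>t. \<phi> t \<partial>\<sigma>)\<bar> \<le> e * measure \<sigma> UNIV"
      using N[OF \<sigma>] by (simp add: J_def y_def)
    ultimately have "\<bar>pi * (\<integral>t. \<phi> t \<partial>\<tau> k) - pi * (\<integral>t. \<phi> t \<partial>\<sigma>)\<bar> < e * B + e * measure \<sigma> UNIV + e"
      using K[OF k] by linarith
    also have "\<dots> = e * C" by (simp add: C_def algebra_simps)
    also have "\<dots> = r" using C by (simp add: e_def)
    finally have "pi * \<bar>(\<integral>t. \<phi> t \<partial>\<tau> k) - (\<integral>t. \<phi> t \<partial>\<sigma>)\<bar> < r"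
      by (simp add: right_diff_distrib[symmetric] abs_mult)
    moreover have "1 * \<bar>(\<integral>t. \<phi> t \<partial>\<tau> k) - (\<integral>t. \<phi> t \<partial>\<sigma>)\<bar> \<le> pi * \<bar>(\<integral>t. \<phi> t \<partial>\<tau> k) - (\<integral>t. \<phi> t \<partial>\<sigma>)\<bar>"
      using pi_gt3 by (intro mult_right_mono) auto
    ultimately show ?thesis by simp
  qed
  then show "\<exists>no. \<forall>k\<ge>no. norm ((\<integral>t. \<phi> t \<partial>\<tau> k) - (\<integral>t. \<phi> t \<partial>\<sigma>)) < r" by blast
qed

section \<open>From test functions to intervals\<close>

definition inner_trapezoid :: "real \<Rightarrow> real \<Rightarrow> nat \<Rightarrow> real \<Rightarrow> real" where
  "inner_trapezoid a b j t = max 0 (min 1 (real (Suc j) * min (t - a) (b - t)))"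

text \<open>The outer trapezoid is 1 on the closed interval and falls to 0 within distance 1/(j + 1)
  of it, so the supports stay between a - 1 and b + 1; the inner one lives inside the open interval.
  The minimum of the two signed distances keeps both formulas meaningful when a \<ge> b.\<close>

definition outer_trapezoid :: "real \<Rightarrow> real \<Rightarrow> nat \<Rightarrow> real \<Rightarrow> real" where
  "outer_trapezoid a b j t = max 0 (min 1 (1 + real (Suc j) * min (t - a) (b - t)))"

lemma continuous_trapezoid:
  "continuous_on UNIV (inner_trapezoid a b j)" "continuous_on UNIV (outer_trapezoid a b j)"
  unfolding inner_trapezoid_def outer_trapezoid_def by (intro continuous_intros)+

lemma inner_trapezoid_bounds:
  "0 \<le> inner_trapezoid a b j t" "inner_trapezoid a b j t \<le> indicator {a<..<b} t"
  by (auto simp: inner_trapezoid_def indicator_def mult_le_0_iff min_le_iff_disj)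

lemma outer_trapezoid_bounds:
  "indicator {a..b} t \<le> outer_trapezoid a b j t" "outer_trapezoid a b j t \<le> indicator {a - 1..b + 1} t"
proof -
  show "indicator {a..b} t \<le> outer_trapezoid a b j t"
    by (auto simp: outer_trapezoid_def indicator_def)
  show "outer_trapezoid a b j t \<le> indicator {a - 1..b + 1} t"
  proof (cases "t \<in> {a - 1..b + 1}")
    case False
    then have m: "min (t - a) (b - t) < -1" by auto
    have "real (Suc j) * x < -1" if "x < -1" for x :: real
    proof -
      have "real (Suc j) * x \<le> 1 * x" by (rule mult_right_mono_neg) (use that in auto)
      then show ?thesis using that by linarith
    qed
    from this[OF m] have neg: "1 + real (Suc j) * min (t - a) (b - t) < 0" by simp
    have "max 0 (min 1 v) = 0" if "v < 0" for v :: real using that by simp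
    from this[OF neg] show ?thesis by (simp only: outer_trapezoid_def) simp
  qed (simp add: outer_trapezoid_def)
qed

lemma inner_trapezoid_tendsto: "(\<lambda>j. inner_trapezoid a b j t) \<longlonglongrightarrow> indicator {a<..<b} t"
proof (cases "t \<in> {a<..<b}")
  case True
  define m where "m = min (t - a) (b - t)"
  have m: "m > 0" using True by (simp add: m_def)
  obtain N where N: "real N > 1 / m" using reals_Archimedean2 by blast
  have "inner_trapezoid a b j t = 1" if "j \<ge> N" for j
  proof -
    have "1 / m < real (Suc j)" using N that by simp
    then have "1 \<le> real (Suc j) * m" using m by (simp add: field_simps)
    then show ?thesis by (simp add: inner_trapezoid_def flip: m_def)
  qed
  then have "eventually (\<lambda>j. inner_trapezoid a b j t = indicator {a<..<b} t) sequentially"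
    using True by (auto simp: eventually_sequentially)
  then show ?thesis by (rule tendsto_eventually)
next
  case False
  then have "inner_trapezoid a b j t = indicator {a<..<b} t" for j
    using inner_trapezoid_bounds[of a b j t] by simp
  then show ?thesis by simp
qed

lemma outer_trapezoid_tendsto: "(\<lambda>j. outer_trapezoid a b j t) \<longlonglongrightarrow> indicator {a..b} t"
proof (cases "t \<in> {a..b}")
  case True
  then have "outer_trapezoid a b j t = indicator {a..b} t" for j
    using outer_trapezoid_bounds(1)[of a b t j] by (simp add: outer_trapezoid_def)
  then show ?thesis by simp
next
  case False
  define m where "m = - min (t - a) (b - t)"
  have m: "m > 0" using False by (auto simp: m_def)
  obtain N where N: "real N > 1 / m" using reals_Archimedean2 by blast
  have "outer_trapezoid a b j t = 0" if "j \<ge> N" for j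
  proof -
    have "1 / m < real (Suc j)" using N that by simp
    then have "1 \<le> real (Suc j) * m" using m by (simp add: field_simps)
    moreover have "min (t - a) (b - t) = - m" by (simp add: m_def)
    ultimately show ?thesis by (simp add: outer_trapezoid_def)
  qed
  then have "eventually (\<lambda>j. outer_trapezoid a b j t = indicator {a..b} t) sequentially"
    using False by (auto simp: eventually_sequentially)
  then show ?thesis by (rule tendsto_eventually)
qed

context finite_borel_measure
begin

text \<open>W may be unbounded on the line, so domination by a constant rests on the common bounded
  support of the \<open>g j\<close>.\<close>

lemma integral_local_limit:
  fixes W :: "real \<Rightarrow> real"
  assumes W: "continuous_on UNIV W"
    and g: "\<And>j. g j \<in> borel_measurable borel" "h \<in> borel_measurable borel"
    and b: "\<And>j t. 0 \<le> g j t \<and> g j t \<le> indicator {c..d} t"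
    and lim: "\<And>t. (\<lambda>j. g j t) \<longlonglongrightarrow> h t"
  shows "(\<lambda>j. \<integral>t. g j t * W t \<partial>M) \<longlonglongrightarrow> (\<integral>t. h t * W t \<partial>M)" "integrable M (\<lambda>t. g j t * W t)"
proof -
  obtain C where C: "C \<ge> 0" "\<And>t. t \<in> {c..d} \<Longrightarrow> \<bar>W t\<bar> \<le> C"
    using continuous_bounded_on_interval[OF W] by blast
  have Wm: "W \<in> borel_measurable borel" by (rule borel_measurable_continuous_onI[OF W])
  have bd: "norm (g j t * W t) \<le> C" for j t
  proof (cases "t \<in> {c..d}")
    case True
    have "\<bar>g j t\<bar> * \<bar>W t\<bar> \<le> 1 * C"
      using b[of j t] True C by (intro mult_mono) auto
    then show ?thesis by (simp add: abs_mult)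
  next
    case False
    then have "g j t = 0" using b[of j t] by simp
    then show ?thesis using C by simp
  qed
  show "integrable M (\<lambda>t. g j t * W t)"
    by (rule integrable_bounded[OF _ bd]) (intro borel_measurable_times g Wm)
  show "(\<lambda>j. \<integral>t. g j t * W t \<partial>M) \<longlonglongrightarrow> (\<integral>t. h t * W t \<partial>M)"
  proof (rule integral_dominated_convergence[where w = "\<lambda>_. C"])
    show "AE t in M. (\<lambda>j. g j t * W t) \<longlonglongrightarrow> h t * W t"
      by (intro AE_I2 tendsto_intros lim)
  qed (use bd g Wm in \<open>auto simp: borel_meas_eq\<close>)
qed

lemma integral_indicator_weight_point:
  fixes W :: "real \<Rightarrow> real"
  shows "(\<integral>t. indicator {x} t * W t \<partial>M) = W x * measure M {x}"
proof -
  have "(\<integral>t. indicator {x} t * W t \<partial>M) = (\<integral>t. W x * indicator {x} t \<partial>M)"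
    by (intro Bochner_Integration.integral_cong refl) (auto simp: indicator_def)
  then show ?thesis by (simp add: space_eq_UNIV)
qed

lemma integrable_indicator_weight:
  fixes W :: "real \<Rightarrow> real"
  assumes W: "continuous_on UNIV W" and A: "A \<in> sets borel" "A \<subseteq> {c..d}"
  shows "integrable M (\<lambda>t. indicator A t * W t)"
  by (rule integral_local_limit(2)[OF W, of "\<lambda>_. indicator A" "indicator A" c d])
    (use A in \<open>auto simp: indicator_def\<close>)

lemma indicator_weight_closed_open:
  fixes W :: "real \<Rightarrow> real"
  assumes "measure M {a} = 0" "measure M {b} = 0" and W: "W \<in> borel_measurable borel"
  shows "(\<integral>t. indicator {a..b} t * W t \<partial>M) = (\<integral>t. indicator {a<..<b} t * W t \<partial>M)"
proof (rule integral_cong_AE)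
  have "AE t in M. t \<noteq> x" if "measure M {x} = 0" for x
  proof -
    have "{x} \<in> null_sets M" using that by (simp add: null_sets_def emeasure_eq_measure sets_M)
    from AE_not_in[OF this] show ?thesis by simp
  qed
  from this[OF assms(1)] this[OF assms(2)]
  show "AE t in M. indicator {a..b} t * W t = indicator {a<..<b} t * W t"
    by eventually_elim (auto simp: indicator_def)
  have "(\<lambda>t. indicator A t * W t) \<in> borel_measurable M" if "A \<in> sets borel" for A
    unfolding borel_meas_eq by (intro borel_measurable_times borel_measurable_indicator that W)
  then show "(\<lambda>t. indicator {a..b} t * W t) \<in> borel_measurable M"
    "(\<lambda>t. indicator {a<..<b} t * W t) \<in> borel_measurable M" by simp_all
qed

end

text \<open>A portmanteau argument: trapezoids times W are continuous with compact support and
  squeeze the integral over the interval. On the side of \<open>\<sigma>\<close> they converge to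
  the open and the closed interval, which have equal integrals because the end points are no
  atoms.\<close>

lemma interval_convergence:
  fixes \<tau> :: "nat \<Rightarrow> real measure" and W :: "real \<Rightarrow> real"
  assumes fin: "\<And>k. finite_borel_measure (\<tau> k)" and bd: "\<And>k. measure (\<tau> k) UNIV \<le> B"
    and \<sigma>: "finite_borel_measure \<sigma>"
    and conv: "\<And>z. Im z > 0 \<Longrightarrow> (\<lambda>k. cauchy_int (\<tau> k) z) \<longlonglongrightarrow> cauchy_int \<sigma> z"
    and W: "continuous_on UNIV W" "\<And>t. W t \<ge> 0"
    and null: "measure \<sigma> {a} = 0" "measure \<sigma> {b} = 0"
  shows "(\<lambda>k. \<integral>t. indicator {a<..<b} t * W t \<partial>\<tau> k) \<longlonglongrightarrow> (\<integral>t. indicator {a<..<b} t * W t \<partial>\<sigma>)"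
proof -
  interpret s: finite_borel_measure \<sigma> by (rule \<sigma>)
  let ?i = "inner_trapezoid a b" and ?o = "outer_trapezoid a b"
  have Wm: "W \<in> borel_measurable borel" by (rule borel_measurable_continuous_onI[OF W(1)])
  have im: "?i j \<in> borel_measurable borel" and om: "?o j \<in> borel_measurable borel" for j
    by (intro borel_measurable_continuous_onI continuous_trapezoid)+
  have ib: "0 \<le> ?i j t \<and> ?i j t \<le> indicator {a - 1..b + 1} t" for j t
    using inner_trapezoid_bounds[of a b j t]
    by (auto intro: order_trans simp: indicator_def split: if_splits)
  have ob: "0 \<le> ?o j t \<and> ?o j t \<le> indicator {a - 1..b + 1} t" for j t
    using outer_trapezoid_bounds(2)[of a b j t] by (simp add: outer_trapezoid_def)
  have ib0: "?i j t = 0" if "t \<notin> {a - 1..b + 1}" for j t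
    using ib[of j t] that by simp
  have ob0: "?o j t = 0" if "t \<notin> {a - 1..b + 1}" for j t
    using ob[of j t] that by simp
  let ?I = "\<integral>t. indicator {a<..<b} t * W t \<partial>\<sigma>"
  have lim_i: "(\<lambda>j. \<integral>t. ?i j t * W t \<partial>\<sigma>) \<longlonglongrightarrow> ?I"
    by (rule s.integral_local_limit(1)[OF W(1) im _ ib inner_trapezoid_tendsto]) simp
  have "(\<lambda>j. \<integral>t. ?o j t * W t \<partial>\<sigma>) \<longlonglongrightarrow> (\<integral>t. indicator {a..b} t * W t \<partial>\<sigma>)"
    by (rule s.integral_local_limit(1)[OF W(1) om _ ob outer_trapezoid_tendsto]) simp
  then have lim_o: "(\<lambda>j. \<integral>t. ?o j t * W t \<partial>\<sigma>) \<longlonglongrightarrow> ?I"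
    by (simp add: s.indicator_weight_closed_open[OF null Wm])
  have int_i: "finite_borel_measure M \<Longrightarrow> integrable M (\<lambda>t. ?i j t * W t)" for M j
    by (rule finite_borel_measure.integral_local_limit(2)[OF _ W(1) im _ ib inner_trapezoid_tendsto]) simp_all
  have int_o: "finite_borel_measure M \<Longrightarrow> integrable M (\<lambda>t. ?o j t * W t)" for M j
    by (rule finite_borel_measure.integral_local_limit(2)[OF _ W(1) om _ ob outer_trapezoid_tendsto]) simp_all
  have int_ind: "integrable (\<tau> k) (\<lambda>t. indicator {a<..<b} t * W t)" for k
    by (rule finite_borel_measure.integrable_indicator_weight[OF fin W(1), where c = a and d = b]) auto
  have vi: "(\<lambda>k. \<integral>t. ?i j t * W t \<partial>\<tau> k) \<longlonglongrightarrow> (\<integral>t. ?i j t * W t \<partial>\<sigma>)" for j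
    by (rule vague_convergence[OF fin bd \<sigma> conv, where a = "a - 1" and b = "b + 1"])
      (use ib0 in \<open>auto intro!: continuous_intros continuous_trapezoid W\<close>)
  have vo: "(\<lambda>k. \<integral>t. ?o j t * W t \<partial>\<tau> k) \<longlonglongrightarrow> (\<integral>t. ?o j t * W t \<partial>\<sigma>)" for j
    by (rule vague_convergence[OF fin bd \<sigma> conv, where a = "a - 1" and b = "b + 1"])
      (use ob0 in \<open>auto intro!: continuous_intros continuous_trapezoid W\<close>)
  show ?thesis
  proof (rule order_tendstoI)
    fix c assume "c < ?I"
    then have "eventually (\<lambda>j. c < (\<integral>t. ?i j t * W t \<partial>\<sigma>)) sequentially"
      by (rule order_tendstoD(1)[OF lim_i])
    then obtain j where "c < (\<integral>t. ?i j t * W t \<partial>\<sigma>)" by (auto simp: eventually_sequentially)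
    then have "eventually (\<lambda>k. c < (\<integral>t. ?i j t * W t \<partial>\<tau> k)) sequentially"
      by (rule order_tendstoD(1)[OF vi])
    then show "eventually (\<lambda>k. c < (\<integral>t. indicator {a<..<b} t * W t \<partial>\<tau> k)) sequentially"
    proof eventually_elim
      case (elim k)
      also have "(\<integral>t. ?i j t * W t \<partial>\<tau> k) \<le> (\<integral>t. indicator {a<..<b} t * W t \<partial>\<tau> k)"
        by (intro integral_mono int_i[OF fin] int_ind mult_right_mono inner_trapezoid_bounds W)
      finally show ?case .
    qed
  next
    fix c assume "?I < c"
    then have "eventually (\<lambda>j. (\<integral>t. ?o j t * W t \<partial>\<sigma>) < c) sequentially"
      by (rule order_tendstoD(2)[OF lim_o])
    then obtain j where "(\<integral>t. ?o j t * W t \<partial>\<sigma>) < c" by (auto simp: eventually_sequentially)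
    then have "eventually (\<lambda>k. (\<integral>t. ?o j t * W t \<partial>\<tau> k) < c) sequentially"
      by (rule order_tendstoD(2)[OF vo])
    then show "eventually (\<lambda>k. (\<integral>t. indicator {a<..<b} t * W t \<partial>\<tau> k) < c) sequentially"
    proof eventually_elim
      case (elim k)
      have "indicator {a<..<b} t \<le> ?o j t" for t
        using outer_trapezoid_bounds(1)[of a b t j] ob[of j t] by (auto simp: indicator_def split: if_splits)
      then have "(\<integral>t. indicator {a<..<b} t * W t \<partial>\<tau> k) \<le> (\<integral>t. ?o j t * W t \<partial>\<tau> k)"
        by (intro integral_mono int_o[OF fin] int_ind mult_right_mono W)
      also note elim
      finally show ?case .
    qed
  qed
qed

text \<open>Trapezoids stand in for the indicator because inversion needs continuous test functions:
  the height goes to 0 first, then the trapezoids fill the interval. The result reads off the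
  density Im H / pi wherever the Cauchy integral extends continuously to the axis.\<close>

lemma boundary_density:
  fixes H :: "complex \<Rightarrow> complex" and W :: "real \<Rightarrow> real"
  assumes \<sigma>: "finite_borel_measure \<sigma>"
    and H: "\<And>z. Im z > 0 \<Longrightarrow> cauchy_int \<sigma> z = H z"
    and contH: "continuous_on {z. Re z \<in> {a..b} \<and> Im z \<in> {0..1}} H"
    and W: "continuous_on UNIV W"
  shows "pi * (\<integral>t. indicator {a<..<b} t * W t \<partial>\<sigma>) =
    (\<integral>x. indicator {a<..<b} x * (W x * Im (H (of_real x))) \<partial>lborel)"
proof -
  interpret s: finite_borel_measure \<sigma> by (rule \<sigma>)
  \<comment> \<open>All heights 1/(k + 1) lie in (0, 1], so this compact rectangle contains every
    point used and supplies a uniform bound for H.\<close>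
  define R where "R = {z. Re z \<in> {a..b} \<and> Im z \<in> {0..1::real}}"
  have "R = cbox (Complex a 0) (Complex b 1)"
    by (auto simp: R_def in_cbox_complex_iff)
  then have "compact R" by simp
  then have "compact (H ` R)" using contH unfolding R_def by (intro compact_continuous_image)
  then obtain C where C: "\<And>z. z \<in> R \<Longrightarrow> cmod (H z) \<le> C"
    using compact_imp_bounded bounded_iff by (metis imageI)
  obtain D where D: "D \<ge> 0" "\<And>t. t \<in> {a..b} \<Longrightarrow> \<bar>W t\<bar> \<le> D"
    using continuous_bounded_on_interval[OF W] by blast
  let ?y = "\<lambda>k. inverse (real (Suc k))"
  let ?i = "inner_trapezoid a b"
  have yR: "Complex x (?y k) \<in> R" "complex_of_real x \<in> R" if "x \<in> {a..b}" for x k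
    using that by (auto simp: R_def inverse_le_1_iff)
  have Hy: "Im (H (Complex x (?y k))) = Im (cauchy_int \<sigma> (Complex x (?y k)))" for x k
    by (simp add: H)
  have i0: "?i j x = 0" if "x \<notin> {a..b}" for j x
    using inner_trapezoid_bounds[of a b j x] that by (auto simp: indicator_def split: if_splits)
  have i1: "\<bar>?i j x\<bar> \<le> 1" for j x
    by (simp add: inner_trapezoid_def)
  have cI: "continuous_on {a..b} (\<lambda>x. Im (H (of_real x)))"
  proof -
    have "continuous_on {a..b} (\<lambda>x. H (of_real x))"
      by (rule continuous_on_compose2[OF contH]) (auto intro!: continuous_intros)
    then show ?thesis by (rule continuous_on_Im)
  qed
  have cWI: "continuous_on {a..b} (\<lambda>x. W x * Im (H (of_real x)))"
    by (intro continuous_on_mult cI continuous_on_subset[OF W]) auto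
  have mWI: "(\<lambda>x. indicator {a..b} x * (W x * Im (H (of_real x)))) \<in> borel_measurable borel"
    using borel_measurable_continuous_on_indicator[OF _ cWI] by simp
  have bWI: "\<bar>W x * Im (H z)\<bar> \<le> D * C" if "x \<in> {a..b}" "z \<in> R" for x z
    using that D C[of z] abs_Im_le_cmod[of "H z"]
    by (simp only: abs_mult, intro mult_mono) (auto intro: order_trans)
  have eq: "pi * (\<integral>t. ?i j t * W t \<partial>\<sigma>) = (\<integral>x. ?i j x * (W x * Im (H (of_real x))) \<partial>lborel)" for j
  proof -
    have cont: "continuous_on UNIV (\<lambda>t. ?i j t * W t)"
      by (intro continuous_on_mult continuous_trapezoid W)
    \<comment> \<open>One sequence with two limits: inversion yields the integral against
      \<open>\<sigma>\<close>, continuity of H up to the axis yields the Lebesgue integral.\<close>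
    have "(\<lambda>k. \<integral>x. (?i j x * W x) * Im (cauchy_int \<sigma> (Complex x (?y k))) \<partial>lborel)
        \<longlonglongrightarrow> pi * (\<integral>t. ?i j t * W t \<partial>\<sigma>)"
      by (rule stieltjes_inversion[OF \<sigma> cont, where a = a and b = b]) (simp add: i0)
    moreover have "(\<lambda>k. \<integral>x. (?i j x * W x) * Im (cauchy_int \<sigma> (Complex x (?y k))) \<partial>lborel)
        \<longlonglongrightarrow> (\<integral>x. ?i j x * (W x * Im (H (of_real x))) \<partial>lborel)"
    proof (rule integral_dominated_convergence[where w = "\<lambda>x. indicator {a..b} x * (D * C)"])
      have m: "(\<lambda>x. ?i j x) \<in> borel_measurable borel"
        by (intro borel_measurable_continuous_onI continuous_trapezoid)
      have "(\<lambda>x. ?i j x * (W x * Im (H (of_real x)))) = (\<lambda>x. ?i j x * (indicator {a..b} x * (W x * Im (H (of_real x)))))"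
        using i0 by (auto simp: fun_eq_iff indicator_def)
      then show "(\<lambda>x. ?i j x * (W x * Im (H (of_real x)))) \<in> borel_measurable lborel"
        using borel_measurable_times[OF m mWI] by simp
      have c: "continuous_on UNIV (\<lambda>x. (?i j x * W x) * Im (cauchy_int \<sigma> (Complex x (?y k))))" for k
        by (intro continuous_on_mult continuous_on_Im cont s.continuous_on_cauchy_int_line) simp
      show "(\<lambda>x. (?i j x * W x) * Im (cauchy_int \<sigma> (Complex x (?y k)))) \<in> borel_measurable lborel" for k
        using borel_measurable_continuous_onI[OF c[of k]] by simp
      show "integrable lborel (\<lambda>x. indicator {a..b} x * (D * C))"
        by (intro integrable_mult_left integrable_real_indicator) (auto simp: emeasure_lborel_Icc_eq)
      show "AE x in lborel. (\<lambda>k. (?i j x * W x) * Im (cauchy_int \<sigma> (Complex x (?y k))))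
          \<longlonglongrightarrow> ?i j x * (W x * Im (H (of_real x)))"
      proof (rule AE_I2)
        fix x
        show "(\<lambda>k. (?i j x * W x) * Im (cauchy_int \<sigma> (Complex x (?y k)))) \<longlonglongrightarrow> ?i j x * (W x * Im (H (of_real x)))"
        proof (cases "x \<in> {a..b}")
          case True
          have e: "Complex x c = of_real x + \<i> * of_real c" for c by (simp add: complex_eq_iff)
          have "(\<lambda>k. Complex x (?y k)) \<longlonglongrightarrow> of_real x + \<i> * of_real 0"
            unfolding e by (intro tendsto_intros LIMSEQ_inverse_real_of_nat)
          then have "(\<lambda>k. Complex x (?y k)) \<longlonglongrightarrow> of_real x" by simp
          then have "(\<lambda>k. H (Complex x (?y k))) \<longlonglongrightarrow> H (of_real x)"
            using yR[OF True] contH unfolding R_def[symmetric]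
            by (intro continuous_on_tendsto_compose[where f = H and s = R]) (auto intro: always_eventually)
          from tendsto_mult[OF tendsto_const tendsto_Im[OF this], of "?i j x * W x"]
          show ?thesis unfolding Hy by (simp only: mult.assoc)
        qed (simp add: i0)
      qed
      show "AE x in lborel. norm ((?i j x * W x) * Im (cauchy_int \<sigma> (Complex x (?y k)))) \<le> indicator {a..b} x * (D * C)" for k
      proof (rule AE_I2)
        fix x
        show "norm ((?i j x * W x) * Im (cauchy_int \<sigma> (Complex x (?y k)))) \<le> indicator {a..b} x * (D * C)"
        proof (cases "x \<in> {a..b}")
          case True
          have "\<bar>?i j x\<bar> * \<bar>W x * Im (H (Complex x (?y k)))\<bar> \<le> 1 * (D * C)"
            using bWI[OF True yR(1)[OF True]] i1 by (intro mult_mono) auto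
          then show ?thesis using True by (simp add: Hy[symmetric] abs_mult mult.assoc del: of_nat_Suc)
        qed (simp add: i0)
      qed
    qed
    ultimately show ?thesis by (rule LIMSEQ_unique)
  qed
  have "(\<lambda>j. pi * (\<integral>t. ?i j t * W t \<partial>\<sigma>)) \<longlonglongrightarrow> pi * (\<integral>t. indicator {a<..<b} t * W t \<partial>\<sigma>)"
  proof (intro tendsto_mult tendsto_const s.integral_local_limit(1)[OF W, where c = a and d = b])
    show "0 \<le> ?i j t \<and> ?i j t \<le> indicator {a..b} t" for j t
      using inner_trapezoid_bounds(1)[of a b j t] i1[of j t] i0[of t j] by (cases "t \<in> {a..b}") auto
  qed (auto intro!: borel_measurable_continuous_onI continuous_trapezoid inner_trapezoid_tendsto)
  moreover have "(\<lambda>j. \<integral>x. ?i j x * (W x * Im (H (of_real x))) \<partial>lborel) \<longlonglongrightarrow>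
      (\<integral>x. indicator {a<..<b} x * (W x * Im (H (of_real x))) \<partial>lborel)"
  proof (rule integral_dominated_convergence[where w = "\<lambda>x. indicator {a..b} x * (D * C)"])
    have e: "g x * (W x * Im (H (of_real x))) = g x * (indicator {a..b} x * (W x * Im (H (of_real x))))"
      if "x \<notin> {a..b} \<longrightarrow> g x = 0" for g :: "real \<Rightarrow> real" and x
      using that by (auto simp: indicator_def)
    have gm: "(\<lambda>x. g x * (W x * Im (H (of_real x)))) \<in> borel_measurable lborel"
      if "g \<in> borel_measurable borel" "\<And>x. x \<notin> {a..b} \<Longrightarrow> g x = 0" for g :: "real \<Rightarrow> real"
      using borel_measurable_times[OF that(1) mWI] that(2) by (subst e) auto
    show "(\<lambda>x. indicator {a<..<b} x * (W x * Im (H (of_real x)))) \<in> borel_measurable lborel"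
      by (rule gm) (auto simp: indicator_def)
    show "(\<lambda>x. ?i j x * (W x * Im (H (of_real x)))) \<in> borel_measurable lborel" for j
      by (rule gm) (auto simp: i0 intro!: borel_measurable_continuous_onI continuous_trapezoid)
    show "integrable lborel (\<lambda>x. indicator {a..b} x * (D * C))"
      by (intro integrable_mult_left integrable_real_indicator) (auto simp: emeasure_lborel_Icc_eq)
    show "AE x in lborel. (\<lambda>j. ?i j x * (W x * Im (H (of_real x)))) \<longlonglongrightarrow> indicator {a<..<b} x * (W x * Im (H (of_real x)))"
      by (intro AE_I2 tendsto_mult tendsto_const inner_trapezoid_tendsto)
    show "AE x in lborel. norm (?i j x * (W x * Im (H (of_real x)))) \<le> indicator {a..b} x * (D * C)" for j
    proof (rule AE_I2)
      fix x
      show "norm (?i j x * (W x * Im (H (of_real x)))) \<le> indicator {a..b} x * (D * C)"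
      proof (cases "x \<in> {a..b}")
        case True
        have "\<bar>?i j x\<bar> * \<bar>W x * Im (H (of_real x))\<bar> \<le> 1 * (D * C)"
          using bWI[OF True yR(2)[OF True]] i1 by (intro mult_mono) auto
        then show ?thesis using True by (simp add: abs_mult)
      qed (simp add: i0)
    qed
  qed
  ultimately show ?thesis unfolding eq by (rule LIMSEQ_unique)
qed

text \<open>The function y^2/(t^2 + y^2) is bounded by 1 and tends to the indicator of 0, so
  dominated convergence isolates the atom. It covers the point 0, where boundary values of a power
  need not exist.\<close>

lemma (in finite_borel_measure) cauchy_int_atom_0:
  "(\<lambda>k. inverse (Suc k) * Im (cauchy_int M (Complex 0 (inverse (Suc k))))) \<longlonglongrightarrow> measure M {0}"
proof -
  let ?y = "\<lambda>k. inverse (real (Suc k))"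
  have eq: "?y k * Im (cauchy_int M (Complex 0 (?y k))) = (\<integral>t. (?y k)\<^sup>2 / (t\<^sup>2 + (?y k)\<^sup>2) \<partial>M)" for k
  proof -
    have "Im (cauchy_int M (Complex 0 (?y k))) = (\<integral>t. Im (1 / (complex_of_real t - Complex 0 (?y k))) \<partial>M)"
      unfolding cauchy_int_def by (rule integral_Im[symmetric]) (rule integrable_cauchy, simp)
    then have "?y k * Im (cauchy_int M (Complex 0 (?y k))) = (\<integral>t. ?y k * (?y k / ((t - 0)\<^sup>2 + (?y k)\<^sup>2)) \<partial>M)"
      unfolding Im_cauchy_kernel by (simp only: integral_mult_right_zero)
    also have "\<dots> = (\<integral>t. (?y k)\<^sup>2 / (t\<^sup>2 + (?y k)\<^sup>2) \<partial>M)"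
      by (intro Bochner_Integration.integral_cong refl) (simp only: power2_eq_square times_divide_eq_right diff_zero)
    finally show ?thesis .
  qed
  have "(\<lambda>k. \<integral>t. (?y k)\<^sup>2 / (t\<^sup>2 + (?y k)\<^sup>2) \<partial>M) \<longlonglongrightarrow> (\<integral>t. indicator {0} t \<partial>M)"
  proof (rule integral_dominated_convergence[where w = "\<lambda>_. 1"])
    show "AE t in M. (\<lambda>k. (?y k)\<^sup>2 / (t\<^sup>2 + (?y k)\<^sup>2)) \<longlonglongrightarrow> indicator {0} t"
    proof (rule AE_I2)
      fix t :: real
      show "(\<lambda>k. (?y k)\<^sup>2 / (t\<^sup>2 + (?y k)\<^sup>2)) \<longlonglongrightarrow> indicator {0} t"
      proof (cases "t = 0")
        case True
        then show ?thesis by simp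
      next
        case False
        have "(\<lambda>k. (?y k)\<^sup>2 / (t\<^sup>2 + (?y k)\<^sup>2)) \<longlonglongrightarrow> 0\<^sup>2 / (t\<^sup>2 + 0\<^sup>2)"
          by (intro tendsto_intros LIMSEQ_inverse_real_of_nat) (use False in simp)
        then show ?thesis using False by simp
      qed
    qed
    show "AE t in M. norm ((?y k)\<^sup>2 / (t\<^sup>2 + (?y k)\<^sup>2)) \<le> 1" for k
      by (intro AE_I2) (auto simp: divide_le_eq_1 abs_of_nonneg add_pos_nonneg sum_power2_gt_zero_iff)
  qed (auto simp: borel_meas_eq)
  then show ?thesis unfolding eq by (simp add: space_eq_UNIV)
qed

section \<open>Transforms that are powers\<close>

lemma i_times_powr:
  assumes "x > 0"
  shows "(of_real x * \<i>) powr of_real \<alpha> = of_real (x powr \<alpha>) * cis (\<alpha> * pi / 2)"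
    and "(of_real x * (-\<i>)) powr of_real \<alpha> = of_real (x powr \<alpha>) * cis (- (\<alpha> * pi / 2))"
proof -
  have e: "exp (complex_of_real \<alpha> * (of_real (ln x) + \<i> * of_real y)) = of_real (x powr \<alpha>) * cis (\<alpha> * y)" for y
    using assms by (simp add: powr_def cis_conv_exp exp_add[symmetric] exp_of_real[symmetric] algebra_simps del: exp_of_real)
  have "Ln (of_real x * \<i>) = of_real (ln x) + \<i> * of_real (pi / 2)"
    using assms by (simp add: Ln_times_of_real Ln_of_real)
  then show "(of_real x * \<i>) powr of_real \<alpha> = of_real (x powr \<alpha>) * cis (\<alpha> * pi / 2)"
    using assms e[of "pi / 2"] by (simp add: powr_def)
  have "Ln (of_real x * (-\<i>)) = of_real (ln x) + \<i> * of_real (- (pi / 2))"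
    using assms Ln_times_of_real[of x "-\<i>"] by (simp add: Ln_of_real)
  then show "(of_real x * (-\<i>)) powr of_real \<alpha> = of_real (x powr \<alpha>) * cis (- (\<alpha> * pi / 2))"
    using assms e[of "- (pi / 2)"] by (simp add: powr_def)
qed

lemma Re_times_cis: "Re (\<omega> * cis t) = cmod \<omega> * cos (Arg \<omega> + t)"
proof -
  have "\<omega> * cis t = rcis (cmod \<omega>) (Arg \<omega>) * rcis 1 t"
    by (simp add: rcis_cmod_Arg cis_rcis_eq)
  then show ?thesis by (simp add: rcis_mult)
qed

text \<open>For x > 0, division by \<open>\<i>\<close> sends x to -ix and -x to ix, so the principal
  branch rotates by -\<alpha> pi/2 on the right and by \<alpha> pi/2 on the left. The leading factor
  \<open>\<i>\<close> turns the imaginary part into the real part of the rotated \<omega>.\<close>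

lemma Im_power_boundary:
  assumes "x > 0"
  shows "Im (\<i> * \<omega> * (of_real x / \<i>) powr of_real \<alpha>) = cmod \<omega> * cos (\<alpha> * pi / 2 - Arg \<omega>) * x powr \<alpha>"
    and "Im (\<i> * \<omega> * (of_real (-x) / \<i>) powr of_real \<alpha>) = cmod \<omega> * cos (\<alpha> * pi / 2 + Arg \<omega>) * x powr \<alpha>"
proof -
  have "complex_of_real x / \<i> = of_real x * (-\<i>)" "complex_of_real (-x) / \<i> = of_real x * \<i>"
    by (simp_all add: complex_eq_iff)
  then have 1: "Im (\<i> * \<omega> * (of_real x / \<i>) powr of_real \<alpha>) = x powr \<alpha> * Re (\<omega> * cis (- (\<alpha> * pi / 2)))"
    and 2: "Im (\<i> * \<omega> * (of_real (-x) / \<i>) powr of_real \<alpha>) = x powr \<alpha> * Re (\<omega> * cis (\<alpha> * pi / 2))"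
    using i_times_powr[OF assms, of \<alpha>] by (simp_all add: algebra_simps)
  have 3: "cos (Arg \<omega> + - (\<alpha> * pi / 2)) = cos (\<alpha> * pi / 2 - Arg \<omega>)"
    using cos_minus[of "\<alpha> * pi / 2 - Arg \<omega>"] by simp
  show "Im (\<i> * \<omega> * (of_real x / \<i>) powr of_real \<alpha>) = cmod \<omega> * cos (\<alpha> * pi / 2 - Arg \<omega>) * x powr \<alpha>"
    unfolding 1 Re_times_cis 3 by (rule mult.commute)
  show "Im (\<i> * \<omega> * (of_real (-x) / \<i>) powr of_real \<alpha>) = cmod \<omega> * cos (\<alpha> * pi / 2 + Arg \<omega>) * x powr \<alpha>"
    unfolding 2 Re_times_cis add.commute[of "Arg \<omega>"] by (rule mult.commute)
qed

lemma integral_Ioo_FTC: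
  fixes F g :: "real \<Rightarrow> real"
  assumes "0 < a" "a < b" and F: "\<And>x. x > 0 \<Longrightarrow> (F has_real_derivative g x) (at x)" and g: "continuous_on {a..b} g"
  shows "(\<integral>x. indicator {a<..<b} x * g x \<partial>lborel) = F b - F a"
proof -
  have "(\<integral>x. indicator {a..b} x *\<^sub>R g x \<partial>lborel) = F b - F a"
  proof (rule integral_FTC_Icc)
    show "(F has_vector_derivative g x) (at x within {a..b})" if "a \<le> x" "x \<le> b" for x
      using F[of x] that assms(1)
      by (auto simp: has_real_derivative_iff_has_vector_derivative intro: has_vector_derivative_at_within)
  qed (use assms in auto)
  moreover have "(\<integral>x. indicator {a<..<b} x * g x \<partial>lborel) = (\<integral>x. indicator {a..b} x *\<^sub>R g x \<partial>lborel)"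
  proof (rule integral_cong_AE)
    have m: "(\<lambda>x. indicator {a..b} x *\<^sub>R g x) \<in> borel_measurable lborel"
      using borel_measurable_continuous_on_indicator[OF _ g] by simp
    then show "(\<lambda>x. indicator {a..b} x *\<^sub>R g x) \<in> borel_measurable lborel" .
    have "(\<lambda>x. indicator {a<..<b} x * g x) = (\<lambda>x. indicator {a<..<b} x * (indicator {a..b} x *\<^sub>R g x))"
      by (auto simp: indicator_def fun_eq_iff)
    then show "(\<lambda>x. indicator {a<..<b} x * g x) \<in> borel_measurable lborel"
      using borel_measurable_times[OF _ m, of "indicator {a<..<b}"] by simp
    have "AE x in lborel. x \<noteq> a \<and> x \<noteq> b"
      using AE_lborel_singleton[of a] AE_lborel_singleton[of b] by eventually_elim simp
    then show "AE x in lborel. indicator {a<..<b} x * g x = indicator {a..b} x *\<^sub>R g x"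
      by eventually_elim (auto simp: indicator_def)
  qed
  ultimately show ?thesis by simp
qed

lemma integral_Ioo_powr:
  fixes a b \<alpha> :: real
  assumes "0 < a" "a < b"
  shows "\<alpha> \<noteq> -1 \<Longrightarrow> (\<integral>x. indicator {a<..<b} x * x powr \<alpha> \<partial>lborel) = (b powr (\<alpha> + 1) - a powr (\<alpha> + 1)) / (\<alpha> + 1)"
    and "\<alpha> = -1 \<Longrightarrow> (\<integral>x. indicator {a<..<b} x * x powr \<alpha> \<partial>lborel) = ln b - ln a"
proof -
  have c: "continuous_on {a..b} (\<lambda>x. x powr \<alpha>)"
    by (intro continuous_intros) (use assms in auto)
  show "(\<integral>x. indicator {a<..<b} x * x powr \<alpha> \<partial>lborel) = (b powr (\<alpha> + 1) - a powr (\<alpha> + 1)) / (\<alpha> + 1)"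
    if "\<alpha> \<noteq> -1"
  proof -
    have "((\<lambda>x. x powr (\<alpha> + 1) / (\<alpha> + 1)) has_real_derivative x powr \<alpha>) (at x)" if "x > 0" for x
      using that \<open>\<alpha> \<noteq> -1\<close> by (auto intro!: derivative_eq_intros simp: add_eq_0_iff2)
    from integral_Ioo_FTC[OF assms this c] show ?thesis by (simp add: diff_divide_distrib)
  qed
  show "(\<integral>x. indicator {a<..<b} x * x powr \<alpha> \<partial>lborel) = ln b - ln a" if "\<alpha> = -1"
  proof -
    have "(ln has_real_derivative x powr \<alpha>) (at x)" if "x > 0" for x
      using DERIV_ln[OF that] that \<open>\<alpha> = -1\<close> by (simp add: powr_minus)
    from integral_Ioo_FTC[OF assms this c] show ?thesis .
  qed
qed

lemma powr_bounded_imp_nonpos: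
  assumes "\<And>x. x \<ge> 1 \<Longrightarrow> x powr \<beta> \<le> K"
  shows "\<beta> \<le> (0::real)"
proof (rule ccontr)
  assume "\<not> \<beta> \<le> 0"
  then have \<beta>: "\<beta> > 0" by simp
  have K: "K \<ge> 1" using assms[of 1] by simp
  have "((K + 1) powr (1 / \<beta>)) powr \<beta> \<le> K"
    by (rule assms) (use K \<beta> in \<open>auto intro: ge_one_powr_ge_zero\<close>)
  then show False using \<beta> K by (simp add: powr_powr)
qed

section \<open>Representations of a power: exponent, density and atom\<close>

locale power_transform =
  fixes n :: nat and \<sigma> :: "real measure" and R :: "real poly" and \<alpha> :: real and \<omega> :: complex
  assumes adm: "admissible n \<sigma> R" and \<omega>: "\<omega> \<noteq> 0"
    and Q: "Im z > 0 \<Longrightarrow> cauchy_sum n \<sigma> R z = \<i> * \<omega> * (z / \<i>) powr of_real \<alpha>"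
begin

sublocale s: finite_borel_measure \<sigma>
  using adm by (simp add: admissible_def)

lemma degR: "degree R < 2 * n"
  using adm by (simp add: admissible_def)

lemma n_pos: "n > 0"
  using degR by simp

lemma norm_on_imaginary_axis: "y > 0 \<Longrightarrow> cmod (cauchy_sum n \<sigma> R (\<i> * of_real y)) = cmod \<omega> * y powr \<alpha>"
  by (subst Q) (simp_all add: norm_mult powr_of_real)

lemma norm_bound_on_imaginary_axis:
  assumes "y > 0"
  shows "cmod \<omega> * y powr \<alpha> \<le> (\<Sum>i<2*n. \<bar>coeff R i\<bar> * y ^ i) + \<bar>1 - y\<^sup>2\<bar> ^ n * (measure \<sigma> UNIV / y)"
proof -
  let ?z = "\<i> * complex_of_real y"
  have "cmod (cpoly R ?z) \<le> (\<Sum>i<2*n. \<bar>coeff R i\<bar> * y ^ i)"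
    unfolding cpoly_eq_sum[OF degR] using assms
    by (intro order_trans[OF norm_sum] sum_mono) (simp add: norm_mult norm_power)
  moreover have "cmod ((1 + ?z\<^sup>2) ^ n * cauchy_int \<sigma> ?z) \<le> \<bar>1 - y\<^sup>2\<bar> ^ n * (measure \<sigma> UNIV / y)"
  proof -
    have "1 + ?z\<^sup>2 = of_real (1 - y\<^sup>2)" by (simp add: power_mult_distrib)
    then have e: "cmod ((1 + ?z\<^sup>2) ^ n) = \<bar>1 - y\<^sup>2\<bar> ^ n" by (simp only: norm_power norm_of_real)
    have "cmod (cauchy_int \<sigma> ?z) \<le> measure \<sigma> UNIV / y"
      using s.cauchy_int_bound[of ?z] assms by simp
    then show ?thesis unfolding norm_mult e by (intro mult_left_mono) auto
  qed
  ultimately show ?thesis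
    unfolding norm_on_imaginary_axis[OF assms, symmetric] cauchy_sum_def
    by (meson norm_triangle_mono)
qed

text \<open>Growth along the imaginary axis decides. Near 0 the Cauchy integral is at most of order
  1/y and the polynomial stays bounded; near infinity |1 - y^2|^n / y and a polynomial of degree
  below 2n are at most of order y^(2n-1).\<close>

lemma index_range: "- 1 \<le> \<alpha>" "\<alpha> \<le> 2 * real n - 1"
proof -
  define S where "S = (\<Sum>i<2*n. \<bar>coeff R i\<bar>)"
  define m where "m = measure \<sigma> UNIV"
  have m: "m \<ge> 0" and S: "S \<ge> 0" by (auto simp: m_def S_def sum_nonneg)
  have w: "cmod \<omega> > 0" using \<omega> by simp
  have "x powr (- \<alpha> - 1) \<le> (S + m) / cmod \<omega>" if x: "x \<ge> 1" for x
  proof -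
    \<comment> \<open>Substituting y = 1/x turns the behaviour at 0 into boundedness of a power for
      x \<ge> 1.\<close>
    define y where "y = 1 / x"
    have y: "y > 0" "y \<le> 1" using x by (auto simp: y_def)
    have "\<bar>1 - y\<^sup>2\<bar> \<le> 1" using y by (simp add: abs_le_iff power_le_one)
    then have "\<bar>1 - y\<^sup>2\<bar> ^ n \<le> 1" by (intro power_le_one) auto
    then have 1: "\<bar>1 - y\<^sup>2\<bar> ^ n * (m / y) \<le> 1 * (m / y)" using m y by (intro mult_right_mono) auto
    have 2: "(\<Sum>i<2*n. \<bar>coeff R i\<bar> * y ^ i) \<le> S"
      unfolding S_def using y by (intro sum_mono) (simp add: mult_left_le power_le_one)
    have "cmod \<omega> * y powr \<alpha> \<le> S + m / y"
      using norm_bound_on_imaginary_axis[OF y(1)] 1 2 by (simp add: m_def)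
    then have "cmod \<omega> * y powr \<alpha> * y \<le> (S + m / y) * y" using y by (intro mult_right_mono) auto
    also have "\<dots> \<le> S + m" using y S by (simp add: algebra_simps mult_left_le)
    finally have "cmod \<omega> * (y powr \<alpha> * y) \<le> S + m" by (simp add: mult.assoc)
    moreover have "y powr \<alpha> * y = x powr (- \<alpha> - 1)"
      using x by (simp add: y_def powr_divide powr_diff powr_minus field_simps)
    ultimately have "cmod \<omega> * x powr (- \<alpha> - 1) \<le> S + m" by (simp only:)
    then show ?thesis using w by (simp add: pos_le_divide_eq mult.commute)
  qed
  from powr_bounded_imp_nonpos[OF this] show "- 1 \<le> \<alpha>" by simp
  have "y powr (\<alpha> - (2 * real n - 1)) \<le> (S + 2 ^ n * m) / cmod \<omega>" if y: "y \<ge> 1" for y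
  proof -
    define N where "N = 2 * n - 1"
    have N: "2 * real n - 1 = real N" "2 * n = Suc N" using n_pos by (auto simp: N_def of_nat_diff)
    have y0: "y > 0" using y by simp
    have "(\<Sum>i<2*n. \<bar>coeff R i\<bar> * y ^ i) \<le> (\<Sum>i<2*n. \<bar>coeff R i\<bar> * y ^ N)"
      using y N by (intro sum_mono mult_left_mono power_increasing) auto
    then have 1: "(\<Sum>i<2*n. \<bar>coeff R i\<bar> * y ^ i) \<le> S * y ^ N" by (simp add: S_def sum_distrib_right)
    have "\<bar>1 - y\<^sup>2\<bar> \<le> 2 * y\<^sup>2" using one_le_power[OF y, of 2] by linarith
    then have "\<bar>1 - y\<^sup>2\<bar> ^ n \<le> (2 * y\<^sup>2) ^ n" by (intro power_mono) auto
    also have "\<dots> = 2 ^ n * (y * y ^ N)" by (simp add: power_mult_distrib N flip: power_mult)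
    finally have "\<bar>1 - y\<^sup>2\<bar> ^ n * (m / y) \<le> 2 ^ n * (y * y ^ N) * (m / y)"
      using m y0 by (intro mult_right_mono) auto
    then have 2: "\<bar>1 - y\<^sup>2\<bar> ^ n * (m / y) \<le> 2 ^ n * m * y ^ N" using y0 by (simp add: mult_ac)
    have "cmod \<omega> * y powr \<alpha> \<le> (S + 2 ^ n * m) * y ^ N"
      using norm_bound_on_imaginary_axis[OF y0] 1 2 by (simp add: m_def distrib_right)
    moreover have "y powr \<alpha> = y powr (\<alpha> - (2 * real n - 1)) * y ^ N"
      unfolding N using y0 by (simp add: powr_diff powr_realpow)
    ultimately have "(cmod \<omega> * y powr (\<alpha> - (2 * real n - 1))) * y ^ N \<le> (S + 2 ^ n * m) * y ^ N" by (simp add: mult.assoc)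
    then have "cmod \<omega> * y powr (\<alpha> - (2 * real n - 1)) \<le> S + 2 ^ n * m"
      by (rule mult_right_le_imp_le) (use y0 in simp)
    then show ?thesis using w by (simp add: pos_le_divide_eq mult.commute)
  qed
  from powr_bounded_imp_nonpos[OF this] show "\<alpha> \<le> 2 * real n - 1" by simp
qed

definition weight :: "real \<Rightarrow> real" where "weight t = (1 + t\<^sup>2) ^ n"

lemma weight_cont: "continuous_on UNIV weight"
  unfolding weight_def by (intro continuous_intros)

lemma weight_pos: "weight t > 0"
  unfolding weight_def by (intro zero_less_power) (simp add: add_pos_nonneg)

text \<open>The regularisation undone: on bounded Borel sets this is the mass under the measure with
  density \<open>weight\<close>. A real integral suffices there because \<open>weight\<close> is
  bounded on bounded sets; on unbounded sets the integral may fail to exist and then has value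
  0.\<close>

definition weighted_measure :: "real set \<Rightarrow> real" where "weighted_measure A = (\<integral>t. indicator A t * weight t \<partial>\<sigma>)"

lemma weighted_measure_nonneg: "weighted_measure A \<ge> 0"
  unfolding weighted_measure_def using weight_pos by (intro Bochner_Integration.integral_nonneg) (simp add: less_imp_le)

lemma weighted_measure_mono:
  assumes "A \<subseteq> B" "B \<subseteq> {c..d}" "A \<in> sets borel" "B \<in> sets borel"
  shows "weighted_measure A \<le> weighted_measure B"
  unfolding weighted_measure_def
  by (intro integral_mono s.integrable_indicator_weight[OF weight_cont, where c = c and d = d] mult_right_mono)
    (use assms weight_pos in \<open>auto simp: indicator_def less_imp_le\<close>)

lemma weighted_measure_point: "weighted_measure {x} = weight x * measure \<sigma> {x}"
  unfolding weighted_measure_def by (rule s.integral_indicator_weight_point)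

lemma weighted_measure_tendsto:
  assumes "\<And>k. A k \<in> sets borel" "B \<in> sets borel" "\<And>k. A k \<subseteq> {c..d}" "\<And>t. (\<lambda>k. indicator (A k) t :: real) \<longlonglongrightarrow> indicator B t"
  shows "(\<lambda>k. weighted_measure (A k)) \<longlonglongrightarrow> weighted_measure B"
  unfolding weighted_measure_def
proof (rule s.integral_local_limit(1)[OF weight_cont])
  show "0 \<le> (indicator (A k) t :: real) \<and> indicator (A k) t \<le> (indicator {c..d} t :: real)" for k t
    using assms(3)[of k] by (auto simp: indicator_def)
qed (use assms in auto)

text \<open>Solving the representation for the Cauchy integral gives a formula continuous up to the
  axis away from 0. On the axis R is real and has no imaginary part, and the denominator is just
  \<open>weight\<close>, so the boundary value of the power alone remains.\<close>

lemma weighted_measure_interval: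
  assumes "0 \<notin> {a..b}"
  shows "pi * weighted_measure {a<..<b} = (\<integral>x. indicator {a<..<b} x * Im (\<i> * \<omega> * (of_real x / \<i>) powr of_real \<alpha>) \<partial>lborel)"
proof -
  define G where "G z = (\<i> * \<omega> * (z / \<i>) powr of_real \<alpha> - cpoly R z) / (1 + z\<^sup>2) ^ n" for z
  define H where "H z = (if Im z > 0 then cauchy_int \<sigma> z else G z)" for z
  \<comment> \<open>An interval without 0 keeps Re z away from 0 in the rectangle, which excludes
    the zero \<open>\<i>\<close> of 1 + z^2 together with the branch point.\<close>
  have nz: "1 + z\<^sup>2 \<noteq> 0" if "Re z \<noteq> 0" "Im z \<ge> 0" for z :: complex
  proof
    assume "1 + z\<^sup>2 = 0"
    then have "(z - \<i>) * (z + \<i>) = 0" by (simp add: algebra_simps power2_eq_square)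
    then have "z = \<i> \<or> z = -\<i>" by (auto simp: add_eq_0_iff2)
    then show False using that by auto
  qed
  have HG: "H z = G z" if "Re z \<noteq> 0" "Im z \<ge> 0" for z
  proof (cases "Im z > 0")
    case True
    have "(1 + z\<^sup>2) ^ n * cauchy_int \<sigma> z = \<i> * \<omega> * (z / \<i>) powr of_real \<alpha> - cpoly R z"
      using Q[OF True] by (simp add: cauchy_sum_def algebra_simps)
    then show ?thesis using nz[OF that] True by (simp add: H_def G_def field_simps)
  qed (simp add: H_def)
  have ne: "Re z \<noteq> 0" if "Re z \<in> {a..b}" for z using that assms by auto
  have "continuous_on {z. Re z \<in> {a..b} \<and> Im z \<in> {0..1}} G"
    unfolding G_def
    by (intro holomorphic_on_imp_continuous_on holomorphic_intros)
      (use ne nz in \<open>auto simp: complex_nonpos_Reals_iff Im_divide Re_divide\<close>)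
  then have contH: "continuous_on {z. Re z \<in> {a..b} \<and> Im z \<in> {0..1}} H"
    by (rule continuous_on_eq) (use HG ne in auto)
  have "pi * weighted_measure {a<..<b} = (\<integral>x. indicator {a<..<b} x * (weight x * Im (H (of_real x))) \<partial>lborel)"
    unfolding weighted_measure_def by (rule boundary_density[OF s.finite_borel_measure_axioms _ contH weight_cont]) (simp add: H_def)
  also have "\<dots> = (\<integral>x. indicator {a<..<b} x * Im (\<i> * \<omega> * (of_real x / \<i>) powr of_real \<alpha>) \<partial>lborel)"
  proof (intro Bochner_Integration.integral_cong refl)
    fix x
    show "indicator {a<..<b} x * (weight x * Im (H (of_real x))) = indicator {a<..<b} x * Im (\<i> * \<omega> * (of_real x / \<i>) powr of_real \<alpha>)"
    proof (cases "x \<in> {a<..<b}")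
      case True
      then have "x \<noteq> 0" using assms by auto
      then have "H (of_real x) = G (of_real x)" by (intro HG) auto
      also have "\<dots> = (\<i> * \<omega> * (of_real x / \<i>) powr of_real \<alpha> - of_real (poly R x)) / of_real (weight x)"
        by (simp add: G_def weight_def cpoly_of_real)
      finally show ?thesis using weight_pos[of x] by (simp add: Im_divide_of_real)
    qed simp
  qed
  finally show ?thesis .
qed

definition "C_pos = cmod \<omega> * cos (\<alpha> * pi / 2 - Arg \<omega>)"
definition "C_neg = cmod \<omega> * cos (\<alpha> * pi / 2 + Arg \<omega>)"

lemma weighted_measure_pos:
  assumes "0 < a" "a < b"
  shows "pi * weighted_measure {a<..<b} = C_pos * (\<integral>x. indicator {a<..<b} x * x powr \<alpha> \<partial>lborel)"
proof -
  have "0 \<notin> {a..b}" using assms by simp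
  then have "pi * weighted_measure {a<..<b} = (\<integral>x. indicator {a<..<b} x * Im (\<i> * \<omega> * (of_real x / \<i>) powr of_real \<alpha>) \<partial>lborel)"
    by (rule weighted_measure_interval)
  also have "\<dots> = (\<integral>x. C_pos * (indicator {a<..<b} x * x powr \<alpha>) \<partial>lborel)"
  proof (intro Bochner_Integration.integral_cong refl)
    show "indicator {a<..<b} x * Im (\<i> * \<omega> * (of_real x / \<i>) powr of_real \<alpha>) = C_pos * (indicator {a<..<b} x * x powr \<alpha>)" for x
      using assms Im_power_boundary(1)[of x \<omega> \<alpha>] by (cases "x \<in> {a<..<b}") (auto simp: C_pos_def)
  qed
  finally show ?thesis by (simp only: integral_mult_right_zero)
qed

lemma weighted_measure_neg:
  assumes "0 < a" "a < b"
  shows "pi * weighted_measure {-b<..<-a} = C_neg * (\<integral>x. indicator {a<..<b} x * x powr \<alpha> \<partial>lborel)"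
proof -
  let ?g = "\<lambda>x. indicator {-b<..<-a} x * Im (\<i> * \<omega> * (of_real x / \<i>) powr of_real \<alpha>)"
  have "0 \<notin> {-b..-a}" using assms by simp
  then have "pi * weighted_measure {-b<..<-a} = (\<integral>x. ?g x \<partial>lborel)" by (rule weighted_measure_interval)
  also have "\<dots> = \<bar>-1\<bar> *\<^sub>R (\<integral>x. ?g (0 + (-1) * x) \<partial>lborel)"
    by (rule lborel_integral_real_affine) simp
  also have "\<dots> = (\<integral>x. C_neg * (indicator {a<..<b} x * x powr \<alpha>) \<partial>lborel)"
  proof -
    have "?g (0 + (-1) * x) = C_neg * (indicator {a<..<b} x * x powr \<alpha>)" for x
      using assms Im_power_boundary(2)[of x \<omega> \<alpha>] by (cases "x \<in> {a<..<b}") (auto simp: C_neg_def)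
    then show ?thesis by simp
  qed
  finally show ?thesis by (simp only: integral_mult_right_zero)
qed

text \<open>On the imaginary axis y times the power has imaginary part Re \<omega> y^(\<alpha>+1),
  while y times the polynomial tends to 0. Only the exponent -1 leaves a contribution in the
  limit.\<close>

lemma atom_0: "measure \<sigma> {0} = (if \<alpha> = -1 then Re \<omega> else 0)"
proof -
  let ?y = "\<lambda>k. inverse (real (Suc k))"
  let ?l = "if \<alpha> = -1 then Re \<omega> else 0"
  have y: "?y \<longlonglongrightarrow> 0" by (rule LIMSEQ_inverse_real_of_nat)
  let ?g = "\<lambda>k. (Re \<omega> * ?y k powr (\<alpha> + 1) - ?y k * Im (cpoly R (\<i> * of_real (?y k)))) / (1 - (?y k)\<^sup>2) ^ n"
  have "(\<lambda>k. Re \<omega> * ?y k powr (\<alpha> + 1)) \<longlonglongrightarrow> ?l"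
  proof (cases "\<alpha> = -1")
    case True
    then show ?thesis by simp
  next
    case False
    then have "\<alpha> + 1 > 0" using index_range(1) by simp
    then have "(\<lambda>k. ?y k powr (\<alpha> + 1)) \<longlonglongrightarrow> 0"
      using tendsto_powr2[OF y tendsto_const[of "\<alpha> + 1"]] by simp
    from tendsto_mult[OF tendsto_const[of "Re \<omega>"] this] show ?thesis using False by simp
  qed
  moreover have "(\<lambda>k. Im (cpoly R (\<i> * of_real (?y k)))) \<longlonglongrightarrow> Im (cpoly R (\<i> * of_real 0))"
    by (intro tendsto_Im tendsto_intros y)
  ultimately have "?g \<longlonglongrightarrow> (?l - 0 * Im (cpoly R (\<i> * of_real 0))) / (1 - 0\<^sup>2) ^ n"
    by (intro tendsto_divide tendsto_diff tendsto_mult tendsto_power tendsto_const y) auto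
  then have lim: "?g \<longlonglongrightarrow> ?l" by simp
  \<comment> \<open>k = 0 is left out: there the point is \<open>\<i>\<close>, where 1 + z^2 = 0 and
    the representation cannot be solved for the Cauchy integral.\<close>
  have "?y k * Im (cauchy_int \<sigma> (Complex 0 (?y k))) = ?g k" if k: "k > 0" for k
  proof -
    define c where "c = ?y k"
    have c: "c > 0" "c < 1" using k by (auto simp: c_def inverse_less_1_iff)
    have e: "Complex 0 c = \<i> * of_real c" by (simp add: complex_eq_iff)
    have "c\<^sup>2 < 1" using c by (simp add: power_less_one_iff)
    then have nz: "(1 - c\<^sup>2) ^ n \<noteq> 0" by simp
    have 1: "1 + (\<i> * of_real c)\<^sup>2 = complex_of_real (1 - c\<^sup>2)" by (simp add: power_mult_distrib)
    have "cpoly R (\<i> * of_real c) + of_real ((1 - c\<^sup>2) ^ n) * cauchy_int \<sigma> (\<i> * of_real c) = \<i> * \<omega> * of_real (c powr \<alpha>)"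
      using Q[of "\<i> * of_real c"] c unfolding cauchy_sum_def 1 by (simp add: powr_of_real)
    from arg_cong[OF this, of Im]
    have "Im (cpoly R (\<i> * of_real c)) + (1 - c\<^sup>2) ^ n * Im (cauchy_int \<sigma> (\<i> * of_real c)) = Re \<omega> * c powr \<alpha>"
      by (simp del: of_real_power of_real_diff)
    then have "Im (cauchy_int \<sigma> (\<i> * of_real c)) = (Re \<omega> * c powr \<alpha> - Im (cpoly R (\<i> * of_real c))) / (1 - c\<^sup>2) ^ n"
      using nz by (simp add: field_simps)
    then have "c * Im (cauchy_int \<sigma> (Complex 0 c)) = c * ((Re \<omega> * c powr \<alpha> - Im (cpoly R (\<i> * of_real c))) / (1 - c\<^sup>2) ^ n)"
      unfolding e by simp
    also have "\<dots> = (Re \<omega> * (c powr \<alpha> * c) - c * Im (cpoly R (\<i> * of_real c))) / (1 - c\<^sup>2) ^ n"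
      by (simp only: times_divide_eq_right right_diff_distrib mult_ac)
    also have "c powr \<alpha> * c = c powr (\<alpha> + 1)" using c by (simp add: powr_add)
    finally show ?thesis unfolding c_def .
  qed
  then have ev: "eventually (\<lambda>k. ?y k * Im (cauchy_int \<sigma> (Complex 0 (?y k))) = ?g k) sequentially"
    using eventually_gt_at_top by (rule eventually_mono[rotated])
  have "?g \<longlonglongrightarrow> measure \<sigma> {0}"
    by (rule Lim_transform_eventually[OF s.cauchy_int_atom_0 ev])
  with lim show ?thesis using LIMSEQ_unique by blast
qed

end

section \<open>Explicit masses of the limit measure\<close>

context power_transform
begin

text \<open>The double \<open>Suc\<close> keeps the value strictly below 1 already for k = 0, so the
  intervals from u k to 1 are non-empty and those around 1 stay to the right of 0.\<close>

abbreviation u :: "nat \<Rightarrow> real" where "u k \<equiv> inverse (real (Suc (Suc k)))"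

lemma u: "u k > 0" "u k < 1" "u \<longlonglongrightarrow> 0"
proof -
  show "u k > 0" "u k < 1" by (simp_all add: inverse_less_1_iff)
  show "u \<longlonglongrightarrow> 0" using LIMSEQ_Suc[OF LIMSEQ_inverse_real_of_nat] .
qed

lemma weighted_measure_tendsto_unit:
  "(\<lambda>k. weighted_measure {u k<..<1}) \<longlonglongrightarrow> weighted_measure {0<..<1}" "(\<lambda>k. weighted_measure {-1<..<- u k}) \<longlonglongrightarrow> weighted_measure {-1<..<0}"
proof -
  have ev: "eventually (\<lambda>k. u k < t) sequentially" if "t > 0" for t
    by (rule order_tendstoD(2)[OF u(3) that])
  show "(\<lambda>k. weighted_measure {u k<..<1}) \<longlonglongrightarrow> weighted_measure {0<..<1}"
  proof (rule weighted_measure_tendsto[where c = 0 and d = 1])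
    show "(\<lambda>k. indicator {u k<..<1} t :: real) \<longlonglongrightarrow> indicator {0<..<1} t" for t
    proof (cases "t > 0")
      case True
      from ev[OF this] show ?thesis
        by (intro tendsto_eventually, elim eventually_mono) (use True in \<open>simp add: indicator_def\<close>)
    next
      case False
      then have "t \<notin> {u k<..<1}" "t \<notin> {0<..<1}" for k using less_trans[OF u(1)[of k], of t] by auto
      then show ?thesis by simp
    qed
    show "{u k<..<1} \<subseteq> {0..1}" for k
    proof
      fix x assume x: "x \<in> {u k<..<1}"
      then have "u k < x" by (rule greaterThanLessThan_iff[THEN iffD1, THEN conjunct1])
      with u(1)[of k] have "0 < x" by (rule less_trans)
      with x show "x \<in> {0..1}" by simp
    qed
  qed auto
  show "(\<lambda>k. weighted_measure {-1<..<- u k}) \<longlonglongrightarrow> weighted_measure {-1<..<0}"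
  proof (rule weighted_measure_tendsto[where c = "-1" and d = 0])
    show "(\<lambda>k. indicator {-1<..<- u k} t :: real) \<longlonglongrightarrow> indicator {-1<..<0} t" for t
    proof (cases "t < 0")
      case True
      then have "- t > 0" by simp
      from ev[OF this] show ?thesis
        by (intro tendsto_eventually, elim eventually_mono) (use True in \<open>auto simp: indicator_def\<close>)
    next
      case False
      then have "t \<notin> {-1<..<- u k}" "t \<notin> {-1<..<0}" for k
        using less_trans[OF u(1)[of k], of "- t"] by (auto simp: less_minus_iff)
      then show ?thesis by simp
    qed
    show "{-1<..<- u k} \<subseteq> {-1..0}" for k
    proof
      fix x assume x: "x \<in> {-1<..<- u k}"
      then have "x < - u k" by (rule greaterThanLessThan_iff[THEN iffD1, THEN conjunct2])
      moreover have "- u k < 0" using u(1)[of k] by (simp only: neg_less_0_iff_less)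
      ultimately have "x < 0" by (rule less_trans)
      with x show "x \<in> {-1..0}" by simp
    qed
  qed auto
qed

lemma div_pi: "pi * d = c * i \<Longrightarrow> d = c / pi * i"
  by (simp add: field_simps)

text \<open>Exponents above -1 are integrable at 0, so the integrals of x^\<alpha> from u k to 1
  tend to 1/(\<alpha> + 1); the factor 1/pi comes from inversion.\<close>

lemma weighted_measure_unit:
  assumes "\<alpha> > -1"
  shows "weighted_measure {0<..<1} = C_pos / (pi * (\<alpha> + 1))" "weighted_measure {-1<..<0} = C_neg / (pi * (\<alpha> + 1))"
proof -
  have \<alpha>: "\<alpha> \<noteq> -1" "\<alpha> + 1 > 0" using assms by auto
  have up: "(\<lambda>k. u k powr (\<alpha> + 1)) \<longlonglongrightarrow> 0"
    using tendsto_powr2[OF u(3) tendsto_const[of "\<alpha> + 1"]] \<alpha> by simp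
  have lim: "(\<lambda>k. C / pi * ((1 - u k powr (\<alpha> + 1)) / (\<alpha> + 1))) \<longlonglongrightarrow> C / pi * ((1 - 0) / (\<alpha> + 1))" for C
    by (intro tendsto_intros up) (use \<alpha> in auto)
  have I: "(\<integral>x. indicator {u k<..<1} x * x powr \<alpha> \<partial>lborel) = (1 - u k powr (\<alpha> + 1)) / (\<alpha> + 1)" for k
    using integral_Ioo_powr(1)[OF u(1,2) \<alpha>(1), of k] by simp
  have "weighted_measure {u k<..<1} = C_pos / pi * ((1 - u k powr (\<alpha> + 1)) / (\<alpha> + 1))" for k
    using div_pi[OF weighted_measure_pos[OF u(1,2), of k]] unfolding I .
  then show "weighted_measure {0<..<1} = C_pos / (pi * (\<alpha> + 1))"
    using LIMSEQ_unique[OF weighted_measure_tendsto_unit(1)] lim[of C_pos] by simp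
  have "weighted_measure {-1<..<-u k} = C_neg / pi * ((1 - u k powr (\<alpha> + 1)) / (\<alpha> + 1))" for k
    using div_pi[OF weighted_measure_neg[OF u(1,2), of k]] unfolding I .
  then show "weighted_measure {-1<..<0} = C_neg / (pi * (\<alpha> + 1))"
    using LIMSEQ_unique[OF weighted_measure_tendsto_unit(2)] lim[of C_neg] by simp
qed

text \<open>For exponent -1 the two cosines reduce to sines of opposite sign: \<open>C_pos\<close>
  is -Im \<omega> and \<open>C_neg\<close> is Im \<omega>. Positivity of the measure makes both
  non-negative, so both vanish.\<close>

lemma C_zero:
  assumes "\<alpha> = -1"
  shows "C_pos = 0" "C_neg = 0" "Im \<omega> = 0"
proof -
  \<comment> \<open>Any interval at positive distance from 0 would do; here the integral is ln 2 >
    0, so the sign of the mass is the sign of the constant.\<close>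
  have I: "(\<integral>x. indicator {1<..<2} x * x powr \<alpha> \<partial>lborel) = ln 2"
    using integral_Ioo_powr(2)[of 1 2 \<alpha>] assms by simp
  have "0 \<le> C_pos * ln 2"
    using weighted_measure_pos[of 1 2] weighted_measure_nonneg[of "{1<..<2}"] pi_gt_zero unfolding I
    by (metis mult_nonneg_nonneg less_imp_le one_less_numeral_iff semiring_norm(76) zero_less_one)
  then have p: "C_pos \<ge> 0" by (simp add: zero_le_mult_iff)
  have "0 \<le> C_neg * ln 2"
    using weighted_measure_neg[of 1 2] weighted_measure_nonneg[of "{-2<..<-1}"] pi_gt_zero unfolding I
    by (metis mult_nonneg_nonneg less_imp_le one_less_numeral_iff semiring_norm(76) zero_less_one)
  then have q: "C_neg \<ge> 0" by (simp add: zero_le_mult_iff)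
  have Im: "Im \<omega> = cmod \<omega> * sin (Arg \<omega>)"
    using arg_cong[OF rcis_cmod_Arg[of \<omega>], of Im] by simp
  have "cos (- pi / 2 - Arg \<omega>) = - sin (Arg \<omega>)" "cos (- pi / 2 + Arg \<omega>) = sin (Arg \<omega>)"
    by (simp_all add: cos_diff cos_add)
  then have eq: "C_pos = - Im \<omega>" "C_neg = Im \<omega>"
    unfolding C_pos_def C_neg_def Im using assms by simp_all
  show "C_pos = 0" "C_neg = 0" "Im \<omega> = 0" using p q unfolding eq by auto
qed

text \<open>Required for using the interval limit with end points 1 and -1. An atom would persist in
  all shrinking neighbourhoods, whose masses tend to 0 because the density is a constant times a
  power.\<close>

lemma endpoint_atoms: "measure \<sigma> {1} = 0" "measure \<sigma> {-1} = 0"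
proof -
  let ?I = "\<lambda>k. \<integral>x. indicator {1 - u k<..<1 + u k} x * x powr \<alpha> \<partial>lborel"
  have lt: "0 < 1 - u k" "1 - u k < 1 + u k" for k using u(1,2)[of k] by auto
  \<comment> \<open>At exponent -1 the primitive would be a logarithm, but the constant is 0 there
    and the case is trivial.\<close>
  have lim: "(\<lambda>k. C * ?I k) \<longlonglongrightarrow> 0" if "\<alpha> = -1 \<Longrightarrow> C = 0" for C
  proof (cases "\<alpha> = -1")
    case False
    have "(\<lambda>k. C * (((1 + u k) powr (\<alpha> + 1) - (1 - u k) powr (\<alpha> + 1)) / (\<alpha> + 1))) \<longlonglongrightarrow>
        C * (((1 + 0) powr (\<alpha> + 1) - (1 - 0) powr (\<alpha> + 1)) / (\<alpha> + 1))"
      by (intro tendsto_intros u(3)) (use False in auto)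
    then show ?thesis using integral_Ioo_powr(1)[OF lt False] by simp
  qed (use that in simp)
  have sub: "weight x * measure \<sigma> {x} \<le> weighted_measure {x - u k<..<x + u k}" for x k
    unfolding weighted_measure_point[symmetric] using u(1)[of k] by (intro weighted_measure_mono[where c = "x - 1" and d = "x + 1"]) (use u(2)[of k] in auto)
  have "weight 1 * measure \<sigma> {1} \<le> 0"
  proof (rule LIMSEQ_le_const)
    show "(\<lambda>k. C_pos / pi * ?I k) \<longlonglongrightarrow> 0" by (rule lim) (drule C_zero(1), simp)
    have "weighted_measure {1 - u k<..<1 + u k} = C_pos / pi * ?I k" for k
      by (rule div_pi[OF weighted_measure_pos[OF lt]])
    then show "\<exists>N. \<forall>k\<ge>N. weight 1 * measure \<sigma> {1} \<le> C_pos / pi * ?I k" using sub[of 1] by simp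
  qed
  then show "measure \<sigma> {1} = 0"
    using weight_pos[of 1] by (simp add: mult_le_0_iff measure_le_0_iff)
  have "weight (-1) * measure \<sigma> {-1} \<le> 0"
  proof (rule LIMSEQ_le_const)
    show "(\<lambda>k. C_neg / pi * ?I k) \<longlonglongrightarrow> 0" by (rule lim) (drule C_zero(2), simp)
    have "weighted_measure {-1 - u k<..<-1 + u k} = C_neg / pi * ?I k" for k
      using div_pi[OF weighted_measure_neg[OF lt, of k]] by simp
    then show "\<exists>N. \<forall>k\<ge>N. weight (-1) * measure \<sigma> {-1} \<le> C_neg / pi * ?I k" using sub[of "-1"] by simp
  qed
  then show "measure \<sigma> {-1} = 0"
    using weight_pos[of "-1"] by (simp add: mult_le_0_iff measure_le_0_iff)
qed

text \<open>By \<open>C_zero\<close> no mass of (-1, 1) lies off 0, so all of it is the atom at 0.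
  That atom is Re \<omega>, non-negative as a mass and non-zero because \<omega> is real and not
  0.\<close>

lemma index_minus_one:
  assumes "\<alpha> = -1"
  shows "\<omega> \<in> \<real>" "Re \<omega> > 0" "weighted_measure {-1<..<1} = Re \<omega>"
proof -
  note C = C_zero[OF assms]
  show "\<omega> \<in> \<real>" using C(3) by (simp add: complex_is_Real_iff)
  have a: "measure \<sigma> {0} = Re \<omega>" using atom_0 assms by simp
  then have "Re \<omega> \<ge> 0" using measure_nonneg[of \<sigma> "{0}"] by simp
  moreover have "Re \<omega> \<noteq> 0" using C(3) \<omega> by (auto simp: complex_eq_iff)
  ultimately show "Re \<omega> > 0" by simp
  have "weighted_measure {u k<..<1} = 0" "weighted_measure {-1<..<- u k} = 0" for k
    using weighted_measure_pos[OF u(1,2), of k] weighted_measure_neg[OF u(1,2), of k] C by auto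
  then have z: "weighted_measure {0<..<1} = 0" "weighted_measure {-1<..<0} = 0"
    using LIMSEQ_unique[OF weighted_measure_tendsto_unit(1), of 0] LIMSEQ_unique[OF weighted_measure_tendsto_unit(2), of 0] by simp_all
  have i: "integrable \<sigma> (\<lambda>t. indicator A t * weight t)" if "A \<in> sets borel" "A \<subseteq> {-1..1}" for A
    by (rule s.integrable_indicator_weight[OF weight_cont that])
  have "weighted_measure {-1<..<1} = (\<integral>t. indicator {-1<..<0} t * weight t + indicator {0} t * weight t + indicator {0<..<1} t * weight t \<partial>\<sigma>)"
    unfolding weighted_measure_def by (intro Bochner_Integration.integral_cong refl) (auto simp: indicator_def)
  also have "\<dots> = weighted_measure {-1<..<0} + weighted_measure {0} + weighted_measure {0<..<1}"
  proof -
    have "integrable \<sigma> (\<lambda>t. indicator {-1<..<0} t * weight t)" "integrable \<sigma> (\<lambda>t. indicator {0} t * weight t)"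
      "integrable \<sigma> (\<lambda>t. indicator {0<..<1} t * weight t)"
      by (intro i; auto)+
    then show ?thesis unfolding weighted_measure_def by simp
  qed
  finally show "weighted_measure {-1<..<1} = Re \<omega>" using z weighted_measure_point[of 0] a by (simp add: weight_def)
qed

end

section \<open>Convergence of the measures\<close>

text \<open>The passage back: multiplying by the weight turns an admissible pair into a member of
  the class with the same transform. This is how the limit function is placed in the range.\<close>

lemma admissible_in_E_le:
  assumes adm: "admissible (\<kappa> + 1) \<sigma> R"
  defines "\<mu> \<equiv> density \<sigma> (\<lambda>t. ennreal ((1 + t\<^sup>2) ^ (\<kappa> + 1)))"
  shows "(\<mu>, R) \<in> E_le \<kappa>"
    and "Im z > 0 \<Longrightarrow> cauchy_transform \<kappa> (\<mu>, R) z = cauchy_sum (\<kappa> + 1) \<sigma> R z"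
proof -
  define n where "n = \<kappa> + 1"
  interpret finite_borel_measure \<sigma> using adm by (simp add: admissible_def)
  have deg: "degree R \<le> 2 * \<kappa> + 1" and lead: "measure \<sigma> UNIV \<le> coeff R (2 * \<kappa> + 1)"
    using adm by (auto simp: admissible_def)
  have \<mu>: "\<mu> = density \<sigma> (\<lambda>t. ennreal ((1 + t\<^sup>2) ^ n))" by (simp add: \<mu>_def n_def)
  have pos: "(1 + t\<^sup>2) ^ n > 0" for t :: real by (intro zero_less_power) (simp add: add_pos_nonneg)
  have wm [measurable]: "(\<lambda>t. ennreal ((1 + t\<^sup>2) ^ n)) \<in> borel_measurable borel" by measurable
  have dens: "(\<integral>t. g t \<partial>\<mu>) = (\<integral>t. (1 + t\<^sup>2) ^ n *\<^sub>R g t \<partial>\<sigma>)"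
    if "g \<in> borel_measurable borel" for g :: "real \<Rightarrow> 'b::{banach, second_countable_topology}"
    unfolding \<mu> by (rule integral_density) (use that pos in \<open>auto simp: borel_meas_eq less_imp_le\<close>)
  have "(\<integral>\<^sup>+ t. ennreal (1 / (1 + t\<^sup>2) ^ n) \<partial>\<mu>) =
      (\<integral>\<^sup>+ t. ennreal ((1 + t\<^sup>2) ^ n) * ennreal (1 / (1 + t\<^sup>2) ^ n) \<partial>\<sigma>)"
    unfolding \<mu> by (rule nn_integral_density) (auto simp: borel_meas_eq)
  also have "\<dots> = (\<integral>\<^sup>+ t. 1 \<partial>\<sigma>)"
  proof (intro nn_integral_cong)
    have "ennreal x * ennreal (1 / x) = 1" if "x > 0" for x :: real
      using that by (simp flip: ennreal_mult)
    then show "ennreal ((1 + t\<^sup>2) ^ n) * ennreal (1 / (1 + t\<^sup>2) ^ n) = 1" for t :: real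
      using pos by blast
  qed
  also have "\<dots> < \<infinity>" by (simp add: space_eq_UNIV emeasure_eq_measure)
  finally have nn: "(\<integral>\<^sup>+ t. ennreal (1 / (1 + t\<^sup>2) ^ n) \<partial>\<mu>) < \<infinity>" .
  have "(\<integral> t. 1 / (1 + t\<^sup>2) ^ n \<partial>\<mu>) = (\<integral>t. 1 \<partial>\<sigma>)"
  proof -
    have "x *\<^sub>R (1 / x) = 1" if "x > 0" for x :: real
      using that by simp
    from this[OF pos] show ?thesis by (subst dens) (simp_all only:, measurable)
  qed
  then have "(\<integral> t. 1 / (1 + t\<^sup>2) ^ n \<partial>\<mu>) \<le> coeff R (2 * \<kappa> + 1)"
    using lead by (simp add: space_eq_UNIV)
  then show "(\<mu>, R) \<in> E_le \<kappa>"
    using nn deg by (simp add: E_le_def n_def \<mu>_def M_is_borel)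
  show "cauchy_transform \<kappa> (\<mu>, R) z = cauchy_sum (\<kappa> + 1) \<sigma> R z" if z: "Im z > 0"
  proof -
    have "(\<integral> t. 1 / (complex_of_real t - z) * complex_of_real (1 / (1 + t\<^sup>2) ^ n) \<partial>\<mu>) =
        (\<integral> t. (1 + t\<^sup>2) ^ n *\<^sub>R (1 / (complex_of_real t - z) * complex_of_real (1 / (1 + t\<^sup>2) ^ n)) \<partial>\<sigma>)"
      by (rule dens) measurable
    also have "\<dots> = cauchy_int \<sigma> z"
      unfolding cauchy_int_def
    proof (intro Bochner_Integration.integral_cong refl)
      fix t :: real
      have gen: "complex_of_real x * complex_of_real (1 / x) = 1" if "x > 0" for x
        using that by simp
      from gen[OF pos[of t]] show "(1 + t\<^sup>2) ^ n *\<^sub>R (1 / (complex_of_real t - z) * complex_of_real (1 / (1 + t\<^sup>2) ^ n)) = 1 / (complex_of_real t - z)"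
        unfolding scaleR_conv_of_real by (metis (no_types, lifting) mult.commute mult.left_commute mult.right_neutral)
    qed
    finally show ?thesis
      using z by (simp add: cauchy_transform_def upper_half_plane_def cauchy_sum_def n_def)
  qed
qed

lemma Q_fun_apply: "Im z > 0 \<Longrightarrow> Q_fun \<alpha> \<omega> z = \<i> * \<omega> * (z / \<i>) powr of_real \<alpha>"
  by (simp add: Q_fun_def upper_half_plane_def)

lemma Q_fun_nonzero: "Im z > 0 \<Longrightarrow> \<omega> \<noteq> 0 \<Longrightarrow> Q_fun \<alpha> \<omega> z \<noteq> 0"
  by (subst Q_fun_apply) auto

lemma continuous_on_Q_fun: "continuous_on upper_half_plane (Q_fun \<alpha> \<omega>)"
proof -
  have "continuous_on upper_half_plane (\<lambda>z. \<i> * \<omega> * (z / \<i>) powr of_real \<alpha>)"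
    by (intro holomorphic_on_imp_continuous_on holomorphic_intros)
      (auto simp: upper_half_plane_def complex_nonpos_Reals_iff Re_divide)
  then show ?thesis
    by (rule continuous_on_eq) (simp add: Q_fun_def)
qed

section \<open>Interval masses and the form of the limit function\<close>

context converging_family
begin

text \<open>Convergence is known for the sums only. Along a subsequence the Cauchy integrals
  converge to those of some pair, and uniqueness identifies them with those of
  \<open>\<sigma>\<close>. Any pair representing the limit function is allowed.\<close>

lemma intervals_converge:
  fixes W :: "real \<Rightarrow> real"
  assumes \<sigma>: "admissible n \<sigma> R"
    and lim: "\<And>z. Im z > 0 \<Longrightarrow> ((\<lambda>r. rescaled q f r z) \<longlongrightarrow> cauchy_sum n \<sigma> R z) at_top"
    and W: "continuous_on UNIV W" "\<And>t. W t \<ge> 0"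
    and null: "measure \<sigma> {a} = 0" "measure \<sigma> {b} = 0"
  shows "((\<lambda>r. \<integral>t. indicator {a<..<b} t * W t \<partial>T r) \<longlongrightarrow> (\<integral>t. indicator {a<..<b} t * W t \<partial>\<sigma>)) at_top"
proof (rule tendsto_at_topI_sequentially)
  fix X :: "nat \<Rightarrow> real" assume X: "filterlim X at_top sequentially"
  obtain B r0 where r0: "r0 \<ge> x0" and B: "\<And>r i. r \<ge> r0 \<Longrightarrow> \<bar>coeff (P r) i\<bar> \<le> B"
    using eventually_coeffs_bounded by blast
  have fin\<sigma>: "finite_borel_measure \<sigma>" using \<sigma> by (simp add: admissible_def)
  have "eventually (\<lambda>k. X k \<ge> r0) sequentially" using X by (simp add: filterlim_at_top)
  then obtain N where N: "\<And>k. k \<ge> N \<Longrightarrow> X k \<ge> r0" by (auto simp: eventually_sequentially)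
  let ?I = "\<lambda>M. \<integral>t. indicator {a<..<b} t * W t \<partial>M"
  have "(\<lambda>k. ?I (T (X (k + N)))) \<longlonglongrightarrow> ?I \<sigma>"
  proof (rule tendsto_of_subseq)
    fix s :: "nat \<Rightarrow> nat" assume s: "strict_mono s"
    define Y where "Y k = X (s k + N)" for k
    have Y: "Y k \<ge> r0" for k using N by (simp add: Y_def)
    have Ylim: "filterlim Y at_top sequentially"
      unfolding Y_def by (rule filterlim_compose[OF X]) (rule filterlim_subseq, use s in \<open>auto simp: strict_mono_def\<close>)
    have admY: "admissible n (T (Y k)) (P (Y k))" for k using adm Y[of k] r0 by simp
    moreover have bdY: "\<bar>coeff (P (Y k)) i\<bar> \<le> B" for k i using B Y by blast
    ultimately obtain t \<sigma>' R' where t: "strict_mono (t :: nat \<Rightarrow> nat)" "admissible n \<sigma>' R'"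
      "cauchy_sums_tendsto n (\<lambda>k. T (Y (t k))) (\<lambda>k. P (Y (t k))) \<sigma>' R'"
      using cauchy_sum_compactness[of n "\<lambda>k. T (Y k)" "\<lambda>k. P (Y k)" B] by blast
    have eq: "cauchy_sum n \<sigma>' R' z = cauchy_sum n \<sigma> R z" if z: "Im z > 0" for z
    proof -
      have "Y (t k) \<ge> x0" for k using Y[of "t k"] r0 by simp
      then have "(\<lambda>k. rescaled q f (Y (t k)) z) \<longlonglongrightarrow> cauchy_sum n \<sigma>' R' z"
        using cauchy_sums_tendstoD(3)[OF t(3) z tendsto_const] z by (simp add: repr)
      moreover have "(\<lambda>k. rescaled q f (Y (t k)) z) \<longlonglongrightarrow> cauchy_sum n \<sigma> R z"
        by (rule filterlim_compose[OF lim[OF z]]) (rule filterlim_compose[OF Ylim filterlim_subseq[OF t(1)]])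
      ultimately show ?thesis by (rule LIMSEQ_unique)
    qed
    have "(\<lambda>k. ?I (T (Y (t k)))) \<longlonglongrightarrow> ?I \<sigma>"
    proof (rule interval_convergence[OF _ _ fin\<sigma> _ W null])
      show "finite_borel_measure (T (Y (t k)))" for k using admY by (simp add: admissible_def)
      show "measure (T (Y (t k))) UNIV \<le> B" for k by (rule admissible_coeff_bound[OF admY bdY])
      show "(\<lambda>k. cauchy_int (T (Y (t k))) z) \<longlonglongrightarrow> cauchy_int \<sigma> z" if z: "Im z > 0" for z
        using cauchy_sums_tendstoD(2)[OF t(3) z] cauchy_sum_unique(2)[OF t(2) \<sigma> eq z] by simp
    qed
    then show "\<exists>r. strict_mono r \<and> (\<lambda>k. ?I (T (X (s (r k) + N)))) \<longlonglongrightarrow> ?I \<sigma>"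
      using t(1) by (auto simp: Y_def)
  qed
  then show "(\<lambda>k. ?I (T (X k))) \<longlonglongrightarrow> ?I \<sigma>" by (rule LIMSEQ_offset)
qed

text \<open>The ratio f(cr)/f(r) is a quotient of rescaled values of q at c z0 and at z0, so its
  convergence is a consequence and not an assumption. It makes the limit homogeneous, hence a power,
  and the same exponent becomes the index of f.\<close>

lemma limit_is_power:
  obtains \<alpha> \<omega> where "\<omega> \<noteq> 0" "locally_uniform_limit_on upper_half_plane (rescaled q f) (Q_fun \<alpha> \<omega>) at_top"
    "\<And>c. c > 0 \<Longrightarrow> ((\<lambda>r. f (c * r) / f r) \<longlongrightarrow> c powr \<alpha>) at_top"
proof -
  obtain \<sigma> R where \<sigma>: "admissible n \<sigma> R"
    and seq: "\<And>X v z. filterlim X at_top sequentially \<Longrightarrow> v \<longlonglongrightarrow> z \<Longrightarrow> Im z > 0 \<Longrightarrow>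
     (\<lambda>k. rescaled q f (X k) (v k)) \<longlonglongrightarrow> cauchy_sum n \<sigma> R z"
    using ex_limit by auto
  define Q where "Q = cauchy_sum n \<sigma> R"
  have lim: "((\<lambda>r. rescaled q f r z) \<longlongrightarrow> Q z) at_top" if "Im z > 0" for z
    unfolding Q_def by (rule tendsto_at_topI_sequentially) (rule seq[OF _ tendsto_const that])
  have hol: "Q holomorphic_on upper_half_plane"
    unfolding Q_def using \<sigma> by (intro finite_borel_measure.cauchy_sum_holomorphic) (simp add: admissible_def)
  have "M \<noteq> {}" using M(3) by auto
  then obtain z0 where z0: "z0 \<in> M" by auto
  then have Im0: "Im z0 > 0" by (rule Im_M)
  obtain l where l: "l \<noteq> 0" "((\<lambda>r. rescaled q f r z0) \<longlongrightarrow> l) at_top" using lim_M[OF z0] by blast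
  have Q0: "Q z0 \<noteq> 0" using tendsto_unique[OF _ lim[OF Im0] l(2)] l(1) by simp
  \<comment> \<open>The quotient of values of Q is a limit of real ratios of f, so passing to the
    real part loses nothing.\<close>
  define g where "g c = Re (Q (of_real c * z0) / Q z0)" for c :: real
  have scale: "filterlim (\<lambda>r::real. c * r) at_top at_top" if "c > 0" for c
    using that by (intro filterlim_tendsto_pos_mult_at_top[OF tendsto_const _ filterlim_ident])
  \<comment> \<open>The value at cz for radius r is the value at z for radius cr, up to the ratio of
    f. That f(cr) is non-zero is known once cr \<ge> x0.\<close>
  have rel: "eventually (\<lambda>r. rescaled q f r (of_real c * z) = of_real (f (c * r) / f r) * rescaled q f (c * r) z) at_top"
    if "c > 0" for c z
  proof -
    have "eventually (\<lambda>r. c * r \<ge> x0) at_top" using scale[OF that] by (simp add: filterlim_at_top)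
    then show ?thesis
    proof eventually_elim
      case (elim r)
      then have "f (c * r) \<noteq> 0" using f_pos by fastforce
      then show ?case by (simp add: rescaled_def mult_ac)
    qed
  qed
  have ratio: "((\<lambda>r. complex_of_real (f (c * r) / f r)) \<longlongrightarrow> Q (of_real c * z0) / Q z0) at_top" if c: "c > 0" for c
  proof -
    have l1: "((\<lambda>r. rescaled q f (c * r) z0) \<longlongrightarrow> Q z0) at_top"
      by (rule filterlim_compose[OF lim[OF Im0] scale[OF c]])
    have "((\<lambda>r. rescaled q f r (of_real c * z0) / rescaled q f (c * r) z0) \<longlongrightarrow> Q (of_real c * z0) / Q z0) at_top"
      using c Im0 by (intro tendsto_divide lim l1 Q0) simp
    moreover have "eventually (\<lambda>r. rescaled q f (c * r) z0 \<noteq> 0) at_top"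
      by (rule tendsto_imp_eventually_ne[OF l1 Q0])
    then have "eventually (\<lambda>r. rescaled q f r (of_real c * z0) / rescaled q f (c * r) z0 = of_real (f (c * r) / f r)) at_top"
      using rel[OF c, of z0] by eventually_elim simp
    ultimately show ?thesis by (rule Lim_transform_eventually)
  qed
  have ratio_g: "((\<lambda>r. f (c * r) / f r) \<longlongrightarrow> g c) at_top" if "c > 0" for c
    using tendsto_Re[OF ratio[OF that]] by (simp add: g_def)
  have hom: "Q (of_real c * z) = of_real (g c) * Q z" if c: "c > 0" and z: "z \<in> upper_half_plane" for c z
  proof -
    have Imz: "Im z > 0" using z by (simp add: upper_half_plane_def)
    have "((\<lambda>r. of_real (f (c * r) / f r) * rescaled q f (c * r) z) \<longlongrightarrow> of_real (g c) * Q z) at_top"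
      by (intro tendsto_mult tendsto_of_real ratio_g[OF c] filterlim_compose[OF lim[OF Imz] scale[OF c]])
    moreover have "((\<lambda>r. of_real (f (c * r) / f r) * rescaled q f (c * r) z) \<longlongrightarrow> Q (of_real c * z)) at_top"
      by (rule Lim_transform_eventually[OF lim rel[OF c]]) (use c Imz in simp)
    ultimately show ?thesis using tendsto_unique trivial_limit_at_top_linorder by blast
  qed
  have "z0 \<in> upper_half_plane" using Im0 by (simp add: upper_half_plane_def)
  from homogeneous_holomorphic_is_power[OF hol this Q0 hom]
  obtain \<alpha> \<omega> where \<omega>: "\<omega> \<noteq> 0" and Q: "\<And>z. z \<in> upper_half_plane \<Longrightarrow> Q z = \<i> * \<omega> * (z / \<i>) powr of_real \<alpha>"
    and g: "\<And>c. c > 0 \<Longrightarrow> g c = c powr \<alpha>"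
    by (metis (no_types, lifting))
  have QQ: "Q z = Q_fun \<alpha> \<omega> z" if "z \<in> upper_half_plane" for z
    using Q[OF that] that by (simp add: Q_fun_def)
  have "locally_uniform_limit_on upper_half_plane (rescaled q f) (Q_fun \<alpha> \<omega>) at_top"
  proof (rule locally_uniform_limitI[OF open_upper_half_plane _ continuous_on_Q_fun])
    fix X :: "nat \<Rightarrow> real" and v z
    assume "filterlim X at_top sequentially" "v \<longlonglongrightarrow> z" "z \<in> upper_half_plane"
    then show "(\<lambda>k. rescaled q f (X k) (v k)) \<longlonglongrightarrow> Q_fun \<alpha> \<omega> z"
      using seq[of X v z] QQ[of z] by (simp add: Q_def upper_half_plane_def)
  qed
  with \<omega> show thesis using that[of \<omega> \<alpha>] ratio_g g by metis
qed

end

theorem theorem3p2: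
  fixes \<kappa> :: nat and \<mu> :: "real measure" and p :: "real poly"
    and q :: "complex \<Rightarrow> complex" and x0 :: real and f :: "real \<Rightarrow> real"
  assumes "(\<mu>, p) \<in> E_le \<kappa>"
    and "q = cauchy_transform \<kappa> (\<mu>, p)"
    and "pos_measurable_from x0 f"
  shows "(cond_i q f \<longleftrightarrow> cond_ii q x0 f) \<and>
    (cond_ii q x0 f \<longleftrightarrow> (\<exists>\<alpha> \<omega>. cond_iii \<kappa> q x0 f \<alpha> \<omega>)) \<and>
    (\<forall>\<alpha> \<omega>. cond_iii \<kappa> q x0 f \<alpha> \<omega> \<longrightarrow>
       \<alpha> \<in> {-1 .. 2 * real \<kappa> + 1} \<and>
       Q_fun \<alpha> \<omega> \<in> cauchy_transform \<kappa> ` E_le \<kappa> \<and>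
       (let \<mu>' = measure_component \<kappa> (Q_fun \<alpha> \<omega>) in
          \<forall>a b. a < b \<and> measure \<mu>' {a} = 0 \<and> measure \<mu>' {b} = 0 \<longrightarrow>
            ((\<lambda>r. 1 / (r * f r) * measure \<mu> {r * a <..< r * b}) \<longlongrightarrow> measure \<mu>' {a <..< b}) at_top) \<and>
       (\<alpha> > -1 \<longrightarrow>
          ((\<lambda>r. 1 / (r * f r) * measure \<mu> {0 <..< r}) \<longlongrightarrow>
             1 / pi * (cmod \<omega> / (\<alpha> + 1)) * cos (\<alpha> * pi / 2 - Arg \<omega>)) at_top \<and>
          ((\<lambda>r. 1 / (r * f r) * measure \<mu> {-r <..< 0}) \<longlongrightarrow>
             1 / pi * (cmod \<omega> / (\<alpha> + 1)) * cos (\<alpha> * pi / 2 + Arg \<omega>)) at_top) \<and>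
       (\<alpha> = -1 \<longrightarrow>
          \<omega> \<in> \<real> \<and> Re \<omega> > 0 \<and>
          ((\<lambda>r. 1 / (r * f r) * measure \<mu> {-r <..< r}) \<longlongrightarrow> Re \<omega>) at_top))"
proof -
  define n where "n = \<kappa> + 1"
  define V where "V t = (1 + t\<^sup>2) ^ n" for t :: real
  have x0: "x0 > 0" and f_pos: "\<And>r. r \<ge> x0 \<Longrightarrow> f r > 0"
    using assms(3) by (auto simp: pos_measurable_from_def)
  have V: "continuous_on UNIV V" "\<And>t. V t > 0"
    unfolding V_def by (intro continuous_intros, intro zero_less_power) (simp add: add_pos_nonneg)
  \<comment> \<open>For radius r the scaling factor is 1 / f r. The last clause later turns weighted
    integrals over \<open>T r\<close> into the quotients of the theorem.\<close>
  define G where "G r \<tau> P \<longleftrightarrow> admissible n \<tau> P \<and>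
      (\<forall>z. Im z > 0 \<longrightarrow> cauchy_sum n \<tau> P z = of_real (1 / f r) * q (of_real r * z)) \<and>
      (\<forall>A\<in>sets borel. (\<integral>t. indicator A t * V t \<partial>\<tau>) = 1 / f r / r * measure \<mu> ((\<lambda>t. t / r) -` A))"
    for r \<tau> P
  have "\<exists>\<tau> P. G r \<tau> P" if r: "r \<ge> x0" for r
  proof -
    have "r > 0" "1 / f r > 0" using x0 f_pos[OF r] r by auto
    from E_le_rescale[OF assms(1) this] show ?thesis
      unfolding G_def n_def V_def assms(2) .
  qed
  then obtain T P where G: "\<And>r. r \<ge> x0 \<Longrightarrow> G r (T r) (P r)"
    by metis
  note TP = G[unfolded G_def]
  have family: "rescaled_family n T P q f x0"
    by unfold_locales (use x0 f_pos TP in \<open>auto simp: rescaled_def\<close>)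
  have meas: "(\<integral>t. indicator {a<..<b} t * V t \<partial>T r) = 1 / (r * f r) * measure \<mu> {r * a<..<r * b}"
    if r: "r \<ge> x0" for r a b
  proof -
    have "r > 0" using r x0 by simp
    then have "(\<lambda>t. t / r) -` {a<..<b} = {r * a<..<r * b}"
      by (auto simp: pos_less_divide_eq pos_divide_less_eq mult.commute)
    then show ?thesis using TP[OF r] by (simp add: mult.commute)
  qed
  have conv_family: "\<exists>M w. converging_family n T P q f x0 M w" if "cond_i q f"
    using that family unfolding cond_i_def converging_family_def converging_family_axioms_def by blast
  have i_iii: "\<exists>\<alpha> \<omega>. cond_iii \<kappa> q x0 f \<alpha> \<omega>" if i: "cond_i q f"
  proof -
    obtain M w where "converging_family n T P q f x0 M w" using conv_family[OF i] by blast
    then interpret converging_family n T P q f x0 M w .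
    obtain \<alpha> \<omega> where \<omega>: "\<omega> \<noteq> 0"
      and unif: "locally_uniform_limit_on upper_half_plane (rescaled q f) (Q_fun \<alpha> \<omega>) at_top"
      and rv: "\<And>c. c > 0 \<Longrightarrow> ((\<lambda>r. f (c * r) / f r) \<longlongrightarrow> c powr \<alpha>) at_top"
      using limit_is_power by blast
    obtain \<sigma> R where \<sigma>: "admissible n \<sigma> R"
      and seq: "\<And>X v z. filterlim X at_top sequentially \<Longrightarrow> v \<longlonglongrightarrow> z \<Longrightarrow> Im z > 0 \<Longrightarrow>
        (\<lambda>k. rescaled q f (X k) (v k)) \<longlonglongrightarrow> cauchy_sum n \<sigma> R z"
      using ex_limit by auto
    have "cauchy_sum n \<sigma> R z = \<i> * \<omega> * (z / \<i>) powr of_real \<alpha>" if z: "Im z > 0" for z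
    proof -
      have "((\<lambda>r. rescaled q f r z) \<longlongrightarrow> Q_fun \<alpha> \<omega> z) at_top"
        using locally_uniform_limit_on_tendsto[OF unif] z by (simp add: upper_half_plane_def)
      from filterlim_compose[OF this filterlim_real_sequentially]
      have "(\<lambda>k. rescaled q f (real k) z) \<longlonglongrightarrow> Q_fun \<alpha> \<omega> z" .
      from LIMSEQ_unique[OF seq[OF filterlim_real_sequentially tendsto_const z] this]
      show ?thesis by (simp add: Q_fun_apply z)
    qed
    \<comment> \<open>The limit is a transform and a power at the same time, and this confines the
      exponent.\<close>
    then interpret pt: power_transform n \<sigma> R \<alpha> \<omega>
      by unfold_locales (use \<sigma> \<omega> in auto)
    have "\<alpha> \<in> {- 2 * real \<kappa> - 1 .. 2 * real \<kappa> + 1}"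
      using pt.index_range by (simp add: n_def)
    then show ?thesis
      using \<omega> unif rv assms(3) unfolding cond_iii_def regularly_varying_index_def by blast
  qed
  have ii_i: "cond_i q f" if ii: "cond_ii q x0 f"
  proof -
    obtain \<alpha> z0 l where rv: "regularly_varying_index x0 f \<alpha>" and z0: "z0 \<in> upper_half_plane"
      and l: "l \<noteq> 0" "((\<lambda>r. rescaled q f r z0) \<longlongrightarrow> l) at_top"
      using ii unfolding cond_ii_def regularly_varying_def by blast
    \<comment> \<open>Regular variation carries the limit at z0 along the ray through z0, and this
      ray accumulates at z0 itself.\<close>
    define M where "M = (\<lambda>c. complex_of_real c * z0) ` {0<..}"
    have z0_pos: "Im z0 > 0" using z0 by (simp add: upper_half_plane_def)
    have "M \<subseteq> upper_half_plane" using z0_pos by (auto simp: M_def upper_half_plane_def)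
    moreover have "z0 islimpt M"
    proof -
      have "(\<lambda>k. of_real (1 + inverse (real (Suc k))) * z0) \<longlonglongrightarrow> of_real (1 + 0) * z0"
        by (intro tendsto_intros LIMSEQ_inverse_real_of_nat)
      then have "(\<lambda>k. of_real (1 + inverse (real (Suc k))) * z0) \<longlonglongrightarrow> z0" by simp
      moreover have "of_real (1 + inverse (real (Suc k))) * z0 \<in> M - {z0}" for k
      proof -
        have "of_real (1 + inverse (real (Suc k))) * z0 \<in> M"
          unfolding M_def by (rule imageI) (simp add: add_pos_pos del: of_nat_Suc)
        moreover have "of_real (1 + inverse (real (Suc k))) * z0 - z0 = of_real (inverse (real (Suc k))) * z0"
          by (simp add: algebra_simps del: of_nat_Suc)
        moreover have "of_real (inverse (real (Suc k))) * z0 \<noteq> 0" using z0_pos by (auto simp del: of_nat_Suc)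
        ultimately show ?thesis by auto
      qed
      ultimately show ?thesis
        unfolding islimpt_sequential
        by (intro exI[of _ "\<lambda>k. of_real (1 + inverse (real (Suc k))) * z0"] conjI allI)
    qed
    moreover have "\<exists>l. l \<noteq> 0 \<and> ((\<lambda>r. rescaled q f r z) \<longlongrightarrow> l) at_top" if zM: "z \<in> M" for z
    proof -
      obtain c where c: "c > 0" and z: "z = of_real c * z0" using zM by (auto simp: M_def)
      have scale: "filterlim (\<lambda>r::real. c * r) at_top at_top"
        using c by (intro filterlim_tendsto_pos_mult_at_top[OF tendsto_const _ filterlim_ident])
      have "((\<lambda>r. f (c * r) / f r) \<longlongrightarrow> c powr \<alpha>) at_top"
        using rv c by (simp add: regularly_varying_index_def)
      then have "((\<lambda>r. of_real (f (c * r) / f r) * rescaled q f (c * r) z0) \<longlongrightarrow> of_real (c powr \<alpha>) * l) at_top"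
        by (intro tendsto_mult tendsto_of_real filterlim_compose[OF l(2) scale])
      moreover have "eventually (\<lambda>r. c * r \<ge> x0) at_top" using scale by (simp add: filterlim_at_top)
      then have "eventually (\<lambda>r. of_real (f (c * r) / f r) * rescaled q f (c * r) z0 = rescaled q f r z) at_top"
      proof eventually_elim
        case (elim r)
        then have "f (c * r) \<noteq> 0" using f_pos by fastforce
        then show ?case by (simp add: rescaled_def z mult_ac)
      qed
      ultimately have "((\<lambda>r. rescaled q f r z) \<longlongrightarrow> of_real (c powr \<alpha>) * l) at_top"
        by (rule Lim_transform_eventually)
      moreover have "of_real (c powr \<alpha>) * l \<noteq> 0" using l c by simp
      ultimately show ?thesis by blast
    qed
    ultimately show ?thesis unfolding cond_i_def using z0 by blast
  qed
  have iii_lim: "((\<lambda>r. rescaled q f r z) \<longlongrightarrow> Q_fun \<alpha> \<omega> z) at_top" "Q_fun \<alpha> \<omega> z \<noteq> 0"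
    if "cond_iii \<kappa> q x0 f \<alpha> \<omega>" "z \<in> upper_half_plane" for \<alpha> \<omega> z
    using that locally_uniform_limit_on_tendsto[of upper_half_plane "rescaled q f" "Q_fun \<alpha> \<omega>" at_top z]
      Q_fun_nonzero[of z \<omega> \<alpha>]
    by (auto simp: cond_iii_def upper_half_plane_def)
  have i_in: "\<i> \<in> upper_half_plane" by (simp add: upper_half_plane_def)
  have iii_i: "cond_i q f" if iii: "cond_iii \<kappa> q x0 f \<alpha> \<omega>" for \<alpha> \<omega>
  proof -
    have "\<i> islimpt upper_half_plane"
      using open_upper_half_plane i_in by (intro interior_limit_point) (simp add: interior_open)
    then show ?thesis unfolding cond_i_def using iii_lim[OF iii] i_in by blast
  qed
  have iii_ii: "cond_ii q x0 f" if iii: "cond_iii \<kappa> q x0 f \<alpha> \<omega>" for \<alpha> \<omega>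
  proof -
    have "regularly_varying x0 f" using iii unfolding cond_iii_def regularly_varying_def by blast
    then show ?thesis unfolding cond_ii_def using iii_lim[OF iii] i_in by blast
  qed
  have "\<alpha> \<in> {-1 .. 2 * real \<kappa> + 1} \<and>
       Q_fun \<alpha> \<omega> \<in> cauchy_transform \<kappa> ` E_le \<kappa> \<and>
       (let \<mu>' = measure_component \<kappa> (Q_fun \<alpha> \<omega>) in
          \<forall>a b. a < b \<and> measure \<mu>' {a} = 0 \<and> measure \<mu>' {b} = 0 \<longrightarrow>
            ((\<lambda>r. 1 / (r * f r) * measure \<mu> {r * a <..< r * b}) \<longlongrightarrow> measure \<mu>' {a <..< b}) at_top) \<and>
       (\<alpha> > -1 \<longrightarrow>
          ((\<lambda>r. 1 / (r * f r) * measure \<mu> {0 <..< r}) \<longlongrightarrow>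
             1 / pi * (cmod \<omega> / (\<alpha> + 1)) * cos (\<alpha> * pi / 2 - Arg \<omega>)) at_top \<and>
          ((\<lambda>r. 1 / (r * f r) * measure \<mu> {-r <..< 0}) \<longlongrightarrow>
             1 / pi * (cmod \<omega> / (\<alpha> + 1)) * cos (\<alpha> * pi / 2 + Arg \<omega>)) at_top) \<and>
       (\<alpha> = -1 \<longrightarrow>
          \<omega> \<in> \<real> \<and> Re \<omega> > 0 \<and>
          ((\<lambda>r. 1 / (r * f r) * measure \<mu> {-r <..< r}) \<longlongrightarrow> Re \<omega>) at_top)"
    if iii: "cond_iii \<kappa> q x0 f \<alpha> \<omega>" for \<alpha> \<omega>
  proof -
    obtain M w where "converging_family n T P q f x0 M w" using conv_family[OF iii_i[OF iii]] by blast
    then interpret converging_family n T P q f x0 M w .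
    have \<omega>: "\<omega> \<noteq> 0" and \<alpha>_le: "\<alpha> \<le> 2 * real \<kappa> + 1" using iii by (auto simp: cond_iii_def)
    have lim: "((\<lambda>r. rescaled q f r z) \<longlongrightarrow> Q_fun \<alpha> \<omega> z) at_top" if "Im z > 0" for z
      using iii_lim[OF iii] that by (simp add: upper_half_plane_def)
    \<comment> \<open>Stated for every representing pair, because it is applied twice: to the pair
      from compactness, where the constants are computed, and to the pair obtained from the chosen
      preimage. This bypasses a comparison of the two measures.\<close>
    have main: "((\<lambda>r. 1 / (r * f r) * measure \<mu> {r * a<..<r * b}) \<longlongrightarrow> (\<integral>t. indicator {a<..<b} t * V t \<partial>\<sigma>)) at_top"
      if \<sigma>: "admissible n \<sigma> R" "\<And>z. Im z > 0 \<Longrightarrow> cauchy_sum n \<sigma> R z = Q_fun \<alpha> \<omega> z"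
        and null: "measure \<sigma> {a} = 0" "measure \<sigma> {b} = 0" for \<sigma> R a b
    proof -
      have "((\<lambda>r. \<integral>t. indicator {a<..<b} t * V t \<partial>T r) \<longlongrightarrow> (\<integral>t. indicator {a<..<b} t * V t \<partial>\<sigma>)) at_top"
        using \<sigma> lim V by (intro intervals_converge[OF \<sigma>(1) _ V(1) _ null]) (auto intro: less_imp_le)
      moreover have "eventually (\<lambda>r. (\<integral>t. indicator {a<..<b} t * V t \<partial>T r) = 1 / (r * f r) * measure \<mu> {r * a<..<r * b}) at_top"
        using eventually_ge_at_top[of x0] by eventually_elim (rule meas)
      ultimately show ?thesis by (rule Lim_transform_eventually)
    qed
    obtain \<sigma> R where \<sigma>: "admissible n \<sigma> R"
      and seq: "\<And>X v z. filterlim X at_top sequentially \<Longrightarrow> v \<longlonglongrightarrow> z \<Longrightarrow> Im z > 0 \<Longrightarrow>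
        (\<lambda>k. rescaled q f (X k) (v k)) \<longlonglongrightarrow> cauchy_sum n \<sigma> R z"
      using ex_limit by auto
    have \<sigma>Q: "cauchy_sum n \<sigma> R z = Q_fun \<alpha> \<omega> z" if z: "Im z > 0" for z
      by (rule LIMSEQ_unique[OF seq[OF filterlim_real_sequentially tendsto_const z]])
        (rule filterlim_compose[OF lim[OF z] filterlim_real_sequentially])
    interpret pt: power_transform n \<sigma> R \<alpha> \<omega>
      by unfold_locales (use \<sigma> \<omega> \<sigma>Q in \<open>auto simp: Q_fun_apply\<close>)
    have VW: "V = pt.weight" by (simp add: fun_eq_iff V_def pt.weight_def)
    have main_D: "((\<lambda>r. 1 / (r * f r) * measure \<mu> {r * a<..<r * b}) \<longlongrightarrow> pt.weighted_measure {a<..<b}) at_top"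
      if "measure \<sigma> {a} = 0" "measure \<sigma> {b} = 0" for a b
      using main[OF \<sigma> \<sigma>Q that] by (simp add: pt.weighted_measure_def VW)
    define \<mu>s where "\<mu>s = density \<sigma> (\<lambda>t. ennreal ((1 + t\<^sup>2) ^ (\<kappa> + 1)))"
    have "(\<mu>s, R) \<in> E_le \<kappa>"
      unfolding \<mu>s_def by (rule admissible_in_E_le(1)[OF \<sigma>[unfolded n_def]])
    \<comment> \<open>Equality of total functions: outside the half-plane both sides take the same
      default value.\<close>
    moreover have "cauchy_transform \<kappa> (\<mu>s, R) = Q_fun \<alpha> \<omega>"
    proof
      fix z
      show "cauchy_transform \<kappa> (\<mu>s, R) z = Q_fun \<alpha> \<omega> z"
      proof (cases "Im z > 0")
        case True
        then show ?thesis
          using admissible_in_E_le(2)[OF \<sigma>[unfolded n_def]] \<sigma>Q[OF True] by (simp add: \<mu>s_def n_def)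
      next
        case False
        then show ?thesis by (simp add: cauchy_transform_def Q_fun_def upper_half_plane_def)
      qed
    qed
    ultimately have ran: "Q_fun \<alpha> \<omega> \<in> cauchy_transform \<kappa> ` E_le \<kappa>" by (metis imageI)
    define \<mu>' where "\<mu>' = measure_component \<kappa> (Q_fun \<alpha> \<omega>)"
    have general: "((\<lambda>r. 1 / (r * f r) * measure \<mu> {r * a <..< r * b}) \<longlongrightarrow> measure \<mu>' {a <..< b}) at_top"
      if null: "measure \<mu>' {a} = 0" "measure \<mu>' {b} = 0" for a b
    proof -
      define X where "X = inv_into (E_le \<kappa>) (cauchy_transform \<kappa>) (Q_fun \<alpha> \<omega>)"
      have X: "X \<in> E_le \<kappa>" "cauchy_transform \<kappa> X = Q_fun \<alpha> \<omega>"
        unfolding X_def by (rule inv_into_into[OF ran], rule f_inv_into_f[OF ran])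
      have X_eq: "X = (\<mu>', snd X)" by (simp add: \<mu>'_def measure_component_def X_def)
      \<comment> \<open>Rescaling with r = c = 1 turns the chosen preimage into an admissible pair
        whose weighted integrals are the values of \<open>\<mu>'\<close>.\<close>
      obtain \<tau> S where \<tau>: "admissible n \<tau> S"
        "\<And>z. Im z > 0 \<Longrightarrow> cauchy_sum n \<tau> S z = of_real 1 * cauchy_transform \<kappa> (\<mu>', snd X) (of_real 1 * z)"
        and m: "\<And>A. A \<in> sets borel \<Longrightarrow> (\<integral>t. indicator A t * (1 + t\<^sup>2) ^ (\<kappa> + 1) \<partial>\<tau>) = 1 / 1 * measure \<mu>' ((\<lambda>t. t / 1) -` A)"
        using E_le_rescale[of \<mu>' "snd X" \<kappa> 1 1] X(1) unfolding X_eq[symmetric] n_def by auto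
      have m': "(\<integral>t. indicator A t * V t \<partial>\<tau>) = measure \<mu>' A" if "A \<in> sets borel" for A
        using m[OF that] by (simp add: V_def n_def vimage_def)
      interpret t: finite_borel_measure \<tau> using \<tau>(1) by (simp add: admissible_def)
      \<comment> \<open>The weight is positive at every point, so an absent atom of
        \<open>\<mu>'\<close> is an absent atom of its regularisation.\<close>
      have null': "measure \<tau> {x} = 0" if "measure \<mu>' {x} = 0" for x
        using m'[of "{x}"] V(2)[of x] that by (simp add: t.integral_indicator_weight_point)
      have "cauchy_sum n \<tau> S z = Q_fun \<alpha> \<omega> z" if "Im z > 0" for z
        using \<tau>(2)[OF that] X(2) X_eq by simp
      from main[OF \<tau>(1) this null'[OF null(1)] null'[OF null(2)]] show ?thesis
        by (simp add: m')
    qed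
    have pos: "((\<lambda>r. 1 / (r * f r) * measure \<mu> {0 <..< r}) \<longlongrightarrow>
             1 / pi * (cmod \<omega> / (\<alpha> + 1)) * cos (\<alpha> * pi / 2 - Arg \<omega>)) at_top"
      and neg: "((\<lambda>r. 1 / (r * f r) * measure \<mu> {-r <..< 0}) \<longlongrightarrow>
             1 / pi * (cmod \<omega> / (\<alpha> + 1)) * cos (\<alpha> * pi / 2 + Arg \<omega>)) at_top" if "\<alpha> > -1"
    proof -
      \<comment> \<open>The interval (0, r) is the case a = 0, b = 1, and (-r, 0) the case a = -1, b
        = 0, so 0 must not be an atom; for exponents above -1 it is none.\<close>
      have 0: "measure \<sigma> {0} = 0" using pt.atom_0 that by simp
      from main_D[OF 0 pt.endpoint_atoms(1)]
      show "((\<lambda>r. 1 / (r * f r) * measure \<mu> {0 <..< r}) \<longlongrightarrow>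
             1 / pi * (cmod \<omega> / (\<alpha> + 1)) * cos (\<alpha> * pi / 2 - Arg \<omega>)) at_top"
        by (simp add: pt.weighted_measure_unit(1)[OF that] pt.C_pos_def)
      from main_D[OF pt.endpoint_atoms(2) 0]
      show "((\<lambda>r. 1 / (r * f r) * measure \<mu> {-r <..< 0}) \<longlongrightarrow>
             1 / pi * (cmod \<omega> / (\<alpha> + 1)) * cos (\<alpha> * pi / 2 + Arg \<omega>)) at_top"
        by (simp add: pt.weighted_measure_unit(2)[OF that] pt.C_neg_def)
    qed
    have minus_one: "\<omega> \<in> \<real> \<and> Re \<omega> > 0 \<and>
          ((\<lambda>r. 1 / (r * f r) * measure \<mu> {-r <..< r}) \<longlongrightarrow> Re \<omega>) at_top" if "\<alpha> = -1"
      using main_D[OF pt.endpoint_atoms(2,1)] pt.index_minus_one[OF that] by simp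
    show ?thesis
      unfolding Let_def \<mu>'_def[symmetric]
      using ran general pos neg minus_one pt.index_range(1) \<alpha>_le by auto
  qed
  then show ?thesis
    using i_iii ii_i iii_i iii_ii by blast
qed

end
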